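(* Consider the $N$-player game with decentralized Markov policies and interaction weights $\lambda_{ij}\ge0$ described in the context, and let $$r^\star:=\inf_{p\in(0,\infty)^N}\max_{i\in[N]}\frac1{p_i}\sum_{j\ne i}|p_i\lambda_{ij}-p_j\lambda_{ji}|.$$ The following statements are equivalent: (i) $r^\star=0$; (ii) there exists $p=(p_1,\dots,p_N)\in(0,\infty)^N$ such that $p_i\lambda_{ij}=p_j\lambda_{ji}$ for all $i,j\in[N]$; (iii) $(\lambda_{ij})_{i,j\in[N]}$ satisfies the Kolmogorov cyclic condition: (a) for all $i\ne j$, $\lambda_{ij}=0$ if and only if $\lambda_{ji}=0$; and (b) for every finite cycle $i_1,i_2,\dots,i_m,i_{m+1}$ in $[N]$ with $i_{m+1}=i_1$, $$\prod_{k=1}^m\lambda_{i_ki_{k+1}}=\prod_{k=1}^m\lambda_{i_{k+1}i_k}.$$ If any of these conditions holds, let $p^\star=(p_i^\star)_{i\in[N]}\in(0,\infty)^N$ satisfy $p^\star_i\lambda_{ij}=p^\star_j\lambda_{ji}$ for all $i,j\in[N]$. Then any minimizer over $\Pi$ of $$\Phi^{p^\star}(\phi):=\mathbb{E}\left[\int_0^T F^{p^\star}\big(X^{\phi}_t,\phi(t,X^{\phi}_t)\big)\,dt+G^{p^\star}(X^{\phi}_T)\right]$$ is a Nash equilibrium of the game, where, for $p\in(0,\infty)^N$, $$F^p(x,a):=\sum_{i=1}^N p_if_i(x_i,a_i)+\sum_{1\le i<j\le N}\frac{p_i\lambda_{ij}+p_j\lambda_{ji}}{2}K(x_i-x_j),\qquad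 G^p(x):=\sum_{i=1}^N p_ig_i(x_i),$$ $X^\phi=(X_i^{\phi_i})_{i\in[N]}$ and $\phi(t,X^\phi_t)=(\phi_i(t,X^{\phi_i}_{i,t}))_{i\in[N]}$.
   Context: Setting. $T>0$ is a fixed horizon, $[N]=\{1,\dots,N\}$ is the set of players, and $d,k,m\in\mathbb{N}$. For each $i\in[N]$, $A_i\subset\mathbb{R}^k$ is a nonempty compact action set, and $\Pi_i\subset C([0,T]\times\mathbb{R}^d;A_i)$ is a nonempty set of admissible policies, each locally Lipschitz continuous in the spatial variable (uniformly in $t\in[0,T]$). Standing assumption: each $\Pi_i$ is compact in the compact-open topology (uniform convergence on compact subsets of $[0,T]\times\mathbb{R}^d$). Let $\Pi=\prod_{i\in[N]}\Pi_i$ and $\Pi_{-i}=\prod_{j\ne i}\Pi_j$. Dynamics. $W$ is an $m$-dimensional Brownian motion on a complete probability space $(\Omega,\mathcal F,\mathbb P)$. For $\phi_i\in\Pi_i$, player $i$'s state $X_i^{\phi_i}$ solves $$dX_{i,t}=b_i(X_{i,t},\phi_i(t,X_{i,t}))\,dt+\sigma_i(X_{i,t},\phi_i(t,X_{i,t}))\,dW_t,\quad X_{i,0}=\xi_i,\quad t\in[0,T],$$ with $\xi_i\in\mathbb{R}^d$ given and $b_i:\mathbb{R}^d\times A_i\to\mathbb{R}^d$, $\sigma_i:\mathbb{R}^d\times A_i\to\mathbb{R}^{d\times m}$ Lipschitz continuous. Costs. For $\phi=(\phi_i)_{i\in[N]}\in\Pi$, player $i$ minimizes over $\phi_i\in\Pi_i$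 $$J_i(\phi)=\mathbb{E}\left[\int_0^T\Big(f_i\big(X^{\phi_i}_{i,t},\phi_i(t,X^{\phi_i}_{i,t})\big)+\sum_{j\ne i}\lambda_{ij}K(X^{\phi_i}_{i,t}-X^{\phi_j}_{j,t})\Big)dt+g_i(X^{\phi_i}_{i,T})\right],$$ where $\lambda_{ij}\ge 0$ are constants, $f_i:\mathbb{R}^d\times A_i\to\mathbb{R}$ and $g_i:\mathbb{R}^d\to\mathbb{R}$ are continuous with at most quadratic growth, and $K:\mathbb{R}^d\to\mathbb{R}$ is bounded and continuous with $K(x)=K(-x)$ for all $x$ and $K\not\equiv0$. Diagonal entries $\lambda_{ii}$ play no role (they may be taken to be arbitrary nonnegative numbers). Nash equilibrium. $\bar\phi\in\Pi$ is a Nash equilibrium if $J_i(\bar\phi)\le J_i(\phi_i,\bar\phi_{-i})$ for all $\phi_i\in\Pi_i$ and $i\in[N]$. *)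

theory Defs
  imports "HOL-Probability.Probability"
begin

section \<open>Stochastic differential equations driven by Brownian motion\<close>

definition past :: "'w measure \<Rightarrow> (real \<Rightarrow> 'w \<Rightarrow> real^'m) \<Rightarrow> real \<Rightarrow> 'w set set" where
  "past M W t = {W s -` B \<inter> space M | s B. s \<in> {0..t} \<and> B \<in> sets borel}"

text \<open>Standard Brownian motion, started at 0, with time set \<open>[0, \<infinity>)\<close>. An increment over \<open>[s, t]\<close> is
  independent of the past up to \<open>s\<close> and has law \<open>N(0, (t - s) I)\<close>; the latter is expressed through
  independent components (\<^const>\<open>normal_density\<close> takes the standard deviation).\<close>

definition brownian_motion :: "'w measure \<Rightarrow> (real \<Rightarrow> 'w \<Rightarrow> real^'m) \<Rightarrow> bool" where
  "brownian_motion M W \<longleftrightarrow>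
     (\<forall>t\<ge>0. W t \<in> borel_measurable M) \<and>
     (\<forall>\<omega>\<in>space M. continuous_on {0..} (\<lambda>t. W t \<omega>)) \<and>
     (AE \<omega> in M. W 0 \<omega> = 0) \<and>
     (\<forall>s t. 0 \<le> s \<and> s < t \<longrightarrow>
        prob_space.indep_set M (sigma_sets (space M) (past M W s))
          {(\<lambda>\<omega>. W t \<omega> - W s \<omega>) -` B \<inter> space M | B. B \<in> sets borel} \<and>
        prob_space.indep_vars M (\<lambda>_. borel) (\<lambda>c \<omega>. W t \<omega> $ c - W s \<omega> $ c) UNIV \<and>
        (\<forall>c. distributed M lborel (\<lambda>\<omega>. W t \<omega> $ c - W s \<omega> $ c) (normal_density 0 (sqrt (t - s)))))"

text \<open>The filtration generated by \<open>W\<close>, augmented by the null sets of \<open>M\<close>.\<close>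

definition brownian_filtration :: "'w measure \<Rightarrow> (real \<Rightarrow> 'w \<Rightarrow> real^'m) \<Rightarrow> real \<Rightarrow> 'w measure" where
  "brownian_filtration M W t = sigma (space M) (past M W t \<union> null_sets M)"

text \<open>A simple process with values in the \<open>d \<times> m\<close> matrices is given by a partition
  \<open>0 = \<tau> 0 < \<dots> < \<tau> n = T\<close> and bounded random matrices \<open>\<eta> k\<close> known at time \<open>\<tau> k\<close>; its value is
  \<open>\<eta> k\<close> on \<open>(\<tau> k, \<tau> (k + 1)]\<close>.\<close>

definition simple_data ::
  "'w measure \<Rightarrow> (real \<Rightarrow> 'w \<Rightarrow> real^'m) \<Rightarrow> real \<Rightarrow> nat \<Rightarrow> (nat \<Rightarrow> real) \<Rightarrow> (nat \<Rightarrow> 'w \<Rightarrow> real^'m^'d) \<Rightarrow> bool"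
  where
  "simple_data M W T n \<tau> \<eta> \<longleftrightarrow>
     \<tau> 0 = 0 \<and> \<tau> n = T \<and> (\<forall>k<n. \<tau> k < \<tau> (Suc k)) \<and>
     (\<forall>k<n. \<eta> k \<in> borel_measurable (brownian_filtration M W (\<tau> k)) \<and>
            (\<exists>C. \<forall>\<omega>\<in>space M. norm (\<eta> k \<omega>) \<le> C))"

definition simple_process ::
  "nat \<Rightarrow> (nat \<Rightarrow> real) \<Rightarrow> (nat \<Rightarrow> 'w \<Rightarrow> real^'m^'d) \<Rightarrow> real \<Rightarrow> 'w \<Rightarrow> real^'m^'d" where
  "simple_process n \<tau> \<eta> s \<omega> = (\<Sum>k<n. indicator {\<tau> k <.. \<tau> (Suc k)} s *\<^sub>R \<eta> k \<omega>)"

definition simple_stochastic_integral ::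
  "(real \<Rightarrow> 'w \<Rightarrow> real^'m) \<Rightarrow> nat \<Rightarrow> (nat \<Rightarrow> real) \<Rightarrow> (nat \<Rightarrow> 'w \<Rightarrow> real^'m^'d) \<Rightarrow> real \<Rightarrow> 'w \<Rightarrow> real^'d" where
  "simple_stochastic_integral W n \<tau> \<eta> t \<omega> =
     (\<Sum>k<n. \<eta> k \<omega> *v (W (min t (\<tau> (Suc k))) \<omega> - W (min t (\<tau> k)) \<omega>))"

text \<open>Measurability is part of the definition because \<^const>\<open>measure\<close> is 0 on non-measurable sets.\<close>

definition vanishes_in_probability :: "'w measure \<Rightarrow> (nat \<Rightarrow> 'w \<Rightarrow> ennreal) \<Rightarrow> bool" where
  "vanishes_in_probability M Z \<longleftrightarrow>
     (\<forall>j. Z j \<in> borel_measurable M) \<and>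
     (\<forall>\<epsilon>>0. (\<lambda>j. measure M {\<omega>\<in>space M. ennreal \<epsilon> < Z j \<omega>}) \<longlonglongrightarrow> 0)"

definition progressive ::
  "'w measure \<Rightarrow> (real \<Rightarrow> 'w \<Rightarrow> real^'m) \<Rightarrow> real \<Rightarrow> (real \<Rightarrow> 'w \<Rightarrow> 'b::topological_space) \<Rightarrow> bool" where
  "progressive M W T H \<longleftrightarrow>
     (\<forall>t\<in>{0..T}. (\<lambda>(s, \<omega>). H s \<omega>) \<in>
        borel_measurable (restrict_space borel {0..t} \<Otimes>\<^sub>M brownian_filtration M W t))"

text \<open>\<open>I\<close> is (a continuous version of) the Ito integral process \<open>t \<mapsto> \<integral>\<^sub>0\<^sup>t H dW\<close> on \<open>[0, T]\<close>: the limit,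
  in probability and uniformly in time, of the integrals of simple processes approximating \<open>H\<close> in
  \<open>L\<^sup>2(0, T)\<close> in probability. As simple processes are bounded, the existence of such an approximation
  contains the usual requirement that \<open>\<integral>\<^sub>0\<^sup>T |H|\<^sup>2 dt < \<infinity>\<close> almost surely; no integrability
  in \<open>\<omega>\<close> is imposed. The extended reals keep infinite integrals and suprema from collapsing to
  default values.\<close>

definition is_ito_integral ::
  "'w measure \<Rightarrow> (real \<Rightarrow> 'w \<Rightarrow> real^'m) \<Rightarrow> real \<Rightarrow> (real \<Rightarrow> 'w \<Rightarrow> real^'m^'d) \<Rightarrow> (real \<Rightarrow> 'w \<Rightarrow> real^'d) \<Rightarrow> bool"
  where
  "is_ito_integral M W T H I \<longleftrightarrow>
     progressive M W T H \<and>
     (\<forall>t\<in>{0..T}. I t \<in> borel_measurable (brownian_filtration M W t)) \<and>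
     (\<forall>\<omega>\<in>space M. continuous_on {0..T} (\<lambda>t. I t \<omega>)) \<and>
     (\<exists>n \<tau> \<eta>. (\<forall>j. simple_data M W T (n j) (\<tau> j) (\<eta> j)) \<and>
        vanishes_in_probability M
          (\<lambda>j \<omega>. \<integral>\<^sup>+ s\<in>{0..T}. ennreal ((norm (simple_process (n j) (\<tau> j) (\<eta> j) s \<omega> - H s \<omega>))\<^sup>2) \<partial>lborel) \<and>
        vanishes_in_probability M
          (\<lambda>j \<omega>. SUP t\<in>{0..T}. ennreal (norm (simple_stochastic_integral W (n j) (\<tau> j) (\<eta> j) t \<omega> - I t \<omega>))))"

text \<open>Strong solution on \<open>[0, T]\<close> of
  \<open>dX\<^sub>t = b(X\<^sub>t, \<phi>(t, X\<^sub>t)) dt + \<sigma>(X\<^sub>t, \<phi>(t, X\<^sub>t)) dW\<^sub>t\<close>, \<open>X\<^sub>0 = \<xi>\<close>.\<close>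

definition strong_solution ::
  "'w measure \<Rightarrow> (real \<Rightarrow> 'w \<Rightarrow> real^'m) \<Rightarrow> real \<Rightarrow> (real^'d \<Rightarrow> real^'k \<Rightarrow> real^'d) \<Rightarrow>
   (real^'d \<Rightarrow> real^'k \<Rightarrow> real^'m^'d) \<Rightarrow> real^'d \<Rightarrow> (real \<times> (real^'d) \<Rightarrow> real^'k) \<Rightarrow>
   (real \<Rightarrow> 'w \<Rightarrow> real^'d) \<Rightarrow> bool" where
  "strong_solution M W T b \<sigma> \<xi> \<phi> X \<longleftrightarrow>
     (\<forall>t\<in>{0..T}. X t \<in> borel_measurable (brownian_filtration M W t)) \<and>
     (\<forall>\<omega>\<in>space M. continuous_on {0..T} (\<lambda>t. X t \<omega>)) \<and>
     (\<exists>I. is_ito_integral M W T (\<lambda>t \<omega>. \<sigma> (X t \<omega>) (\<phi> (t, X t \<omega>))) I \<and>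
        (AE \<omega> in M. \<forall>t\<in>{0..T}.
           X t \<omega> = \<xi> + (LINT s:{0..t}|lborel. b (X s \<omega>) (\<phi> (s, X s \<omega>))) + I t \<omega>))"


section \<open>Admissible policies\<close>

text \<open>The compact-open topology on the continuous functions \<open>S \<rightarrow> 'b\<close>; a function on \<open>S\<close> is
  represented by its \<^const>\<open>extensional\<close> extension, which makes the topology Hausdorff for
  Hausdorff \<open>'b\<close>.\<close>

definition compact_open_topology ::
  "'a::topological_space set \<Rightarrow> ('a \<Rightarrow> 'b::topological_space) topology" where
  "compact_open_topology S =
     topology_generated_by
       {{f \<in> extensional S. continuous_on S f \<and> f ` C \<subseteq> U} | C U. compact C \<and> C \<subseteq> S \<and> open U}"

definition policy_class ::
  "real \<Rightarrow> (real^'k) set \<Rightarrow> (real \<times> (real^'d) \<Rightarrow> real^'k) set \<Rightarrow> bool" where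
  "policy_class T A P \<longleftrightarrow>
     P \<noteq> {} \<and>
     (\<forall>\<phi>\<in>P. \<phi> \<in> extensional ({0..T} \<times> UNIV) \<and>
        continuous_on ({0..T} \<times> UNIV) \<phi> \<and> \<phi> ` ({0..T} \<times> UNIV) \<subseteq> A \<and>
        (\<forall>x. \<exists>u>0. \<exists>L. \<forall>t\<in>{0..T}. L-lipschitz_on (cball x u) (\<lambda>y. \<phi> (t, y)))) \<and>
     compactin (compact_open_topology ({0..T} \<times> UNIV)) P"


section \<open>The game\<close>

text \<open>Players are the numbers \<open>1, \<dots>, N\<close>. Throughout, \<open>X i \<psi>\<close> is the state process of player \<open>i\<close> when
  this player uses the policy \<open>\<psi>\<close>, and a policy profile is an element of \<open>PiE {1..N} P\<close>.\<close>

definition cost ::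
  "'w measure \<Rightarrow> real \<Rightarrow> nat \<Rightarrow> (nat \<Rightarrow> real^'d \<Rightarrow> real^'k \<Rightarrow> real) \<Rightarrow> (nat \<Rightarrow> real^'d \<Rightarrow> real) \<Rightarrow>
   (real^'d \<Rightarrow> real) \<Rightarrow> (nat \<Rightarrow> nat \<Rightarrow> real) \<Rightarrow>
   (nat \<Rightarrow> (real \<times> (real^'d) \<Rightarrow> real^'k) \<Rightarrow> real \<Rightarrow> 'w \<Rightarrow> real^'d) \<Rightarrow>
   nat \<Rightarrow> (nat \<Rightarrow> real \<times> (real^'d) \<Rightarrow> real^'k) \<Rightarrow> real" where
  "cost M T N f g K \<Lambda> X i \<phi> =
     prob_space.expectation M (\<lambda>\<omega>.
       (LINT t:{0..T}|lborel.
          f i (X i (\<phi> i) t \<omega>) (\<phi> i (t, X i (\<phi> i) t \<omega>)) +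
          (\<Sum>j\<in>{1..N} - {i}. \<Lambda> i j * K (X i (\<phi> i) t \<omega> - X j (\<phi> j) t \<omega>))) +
       g i (X i (\<phi> i) T \<omega>))"

definition nash_equilibrium ::
  "nat \<Rightarrow> (nat \<Rightarrow> 'p set) \<Rightarrow> (nat \<Rightarrow> (nat \<Rightarrow> 'p) \<Rightarrow> real) \<Rightarrow> (nat \<Rightarrow> 'p) \<Rightarrow> bool" where
  "nash_equilibrium N P J \<phi> \<longleftrightarrow>
     \<phi> \<in> PiE {1..N} P \<and> (\<forall>i\<in>{1..N}. \<forall>\<psi>\<in>P i. J i \<phi> \<le> J i (\<phi>(i := \<psi>)))"

definition running_potential ::
  "nat \<Rightarrow> (nat \<Rightarrow> real^'d \<Rightarrow> real^'k \<Rightarrow> real) \<Rightarrow> (real^'d \<Rightarrow> real) \<Rightarrow> (nat \<Rightarrow> nat \<Rightarrow> real) \<Rightarrow>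
   (nat \<Rightarrow> real) \<Rightarrow> (nat \<Rightarrow> real^'d) \<Rightarrow> (nat \<Rightarrow> real^'k) \<Rightarrow> real" where
  "running_potential N f K \<Lambda> p x a =
     (\<Sum>i\<in>{1..N}. p i * f i (x i) (a i)) +
     (\<Sum>(i, j)\<in>{(i, j). 1 \<le> i \<and> i < j \<and> j \<le> N}. (p i * \<Lambda> i j + p j * \<Lambda> j i) / 2 * K (x i - x j))"

definition terminal_potential ::
  "nat \<Rightarrow> (nat \<Rightarrow> real^'d \<Rightarrow> real) \<Rightarrow> (nat \<Rightarrow> real) \<Rightarrow> (nat \<Rightarrow> real^'d) \<Rightarrow> real" where
  "terminal_potential N g p x = (\<Sum>i\<in>{1..N}. p i * g i (x i))"

definition potential ::
  "'w measure \<Rightarrow> real \<Rightarrow> nat \<Rightarrow> (nat \<Rightarrow> real^'d \<Rightarrow> real^'k \<Rightarrow> real) \<Rightarrow> (nat \<Rightarrow> real^'d \<Rightarrow> real) \<Rightarrow>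
   (real^'d \<Rightarrow> real) \<Rightarrow> (nat \<Rightarrow> nat \<Rightarrow> real) \<Rightarrow>
   (nat \<Rightarrow> (real \<times> (real^'d) \<Rightarrow> real^'k) \<Rightarrow> real \<Rightarrow> 'w \<Rightarrow> real^'d) \<Rightarrow>
   (nat \<Rightarrow> real) \<Rightarrow> (nat \<Rightarrow> real \<times> (real^'d) \<Rightarrow> real^'k) \<Rightarrow> real" where
  "potential M T N f g K \<Lambda> X p \<phi> =
     prob_space.expectation M (\<lambda>\<omega>.
       (LINT t:{0..T}|lborel.
          running_potential N f K \<Lambda> p (\<lambda>i. X i (\<phi> i) t \<omega>) (\<lambda>i. \<phi> i (t, X i (\<phi> i) t \<omega>))) +
       terminal_potential N g p (\<lambda>i. X i (\<phi> i) T \<omega>))"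


section \<open>Interaction weights\<close>

definition positive_weights :: "nat \<Rightarrow> (nat \<Rightarrow> real) set" where
  "positive_weights N = {1..N} \<rightarrow>\<^sub>E {0<..}"

definition r_star :: "nat \<Rightarrow> (nat \<Rightarrow> nat \<Rightarrow> real) \<Rightarrow> real" where
  "r_star N \<Lambda> =
     (INF p\<in>positive_weights N. MAX i\<in>{1..N}.
        1 / p i * (\<Sum>j\<in>{1..N} - {i}. \<bar>p i * \<Lambda> i j - p j * \<Lambda> j i\<bar>))"

definition kolmogorov_cyclic :: "nat \<Rightarrow> (nat \<Rightarrow> nat \<Rightarrow> real) \<Rightarrow> bool" where
  "kolmogorov_cyclic N \<Lambda> \<longleftrightarrow>
     (\<forall>i\<in>{1..N}. \<forall>j\<in>{1..N}. i \<noteq> j \<longrightarrow> (\<Lambda> i j = 0 \<longleftrightarrow> \<Lambda> j i = 0)) \<and>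
     (\<forall>m\<ge>1::nat. \<forall>c :: nat \<Rightarrow> nat. (\<forall>k\<in>{1..m + 1}. c k \<in> {1..N}) \<and> c (m + 1) = c 1 \<longrightarrow>
        (\<Prod>k = 1..m. \<Lambda> (c k) (c (k + 1))) = (\<Prod>k = 1..m. \<Lambda> (c (k + 1)) (c k)))"

end

(* Detailed balance is the potential condition. If the maximum in r_star tends to 0 along weights p,
   then p_j L_ji / p_i tends to L_ij, and along a cycle the factors p_j / p_i cancel, which gives the
   Kolmogorov condition; conversely the weights are products of the ratios L_ij / L_ji along walks,
   and the cyclic condition makes them independent of the walk. Under detailed balance the potential
   is p_i times the cost of player i plus a term that does not involve the policy of player i.

   This last splitting needs all expectations to be finite (a non-integrable expectation is 0 by
   convention), hence second moments of the solutions of the SDE. No stopping times are needed: the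
   L^2 bound for integrals of simple processes is localised by switching off the integrand once its
   accumulated energy exceeds a level, and passes to Ito integrals by Fatou's lemma. *)

theory Submission
  imports Defs
begin

section \<open>Detailed balance and the cyclic condition\<close>

text \<open>The infimum in \<open>r_star\<close> is over a noncompact set: near-optimal weights may
  run off to 0 or infinity, since unconnected groups of players can be rescaled independently. Hence
  no limit of the weights is taken. Only the products \<open>p j / p i * \<Lambda> j i\<close> are
  known to converge, and the cyclic condition is the form in which the ratios disappear.

  On the stochastic side \<open>is_ito_integral\<close> is a limit in probability with no moments in
  \<omega>, so neither an L^2 identity nor Gronwall's inequality applies to the state directly. All
  terms are therefore measured by one increasing process, the time integral \<open>u\<close> of
  \<open>1 + (norm X)^2\<close>. By linear growth of the coefficients, which is uniform over the
  bounded action sets, \<open>u\<close> dominates both the squared drift and the energy of the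
  integrand. The expectation of \<open>min L (u t)\<close> is finite from the start, and its
  estimate has constants free of \<open>L\<close>, so \<open>L\<close> can be sent to infinity.
  Second moments suffice because \<open>f\<close> and \<open>g\<close> grow at most quadratically
  and \<open>K\<close> is bounded.\<close>

text \<open>A near-minimizer works for all pairs at once: a single summand divided by
  \<open>p i\<close> is at most the maximum over the rows.\<close>

lemma r_star_zero_imp_close:
  assumes N: "1 \<le> N" and r: "r_star N \<Lambda> = 0" and e: "0 < (e::real)"
  obtains p where "p \<in> positive_weights N"
    "\<And>i j. i \<in> {1..N} \<Longrightarrow> j \<in> {1..N} \<Longrightarrow> \<bar>\<Lambda> i j - p j / p i * \<Lambda> j i\<bar> < e"
proof -
  let ?F = "\<lambda>p. MAX i\<in>{1..N}. 1 / p i * (\<Sum>j\<in>{1..N} - {i}. \<bar>p i * \<Lambda> i j - p j * \<Lambda> j i\<bar>)"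
  have ne: "positive_weights N \<noteq> {}"
    unfolding positive_weights_def by (auto simp: PiE_eq_empty_iff intro!: exI[of _ 1])
  have "\<exists>p\<in>positive_weights N. ?F p < e"
    using cInf_lessD[of "?F ` positive_weights N" e] ne r e unfolding r_star_def by auto
  then obtain p where p: "p \<in> positive_weights N" and lt: "?F p < e" by blast
  have pp: "p i > 0" if "i \<in> {1..N}" for i
    using p that by (auto simp: positive_weights_def)
  have "\<bar>\<Lambda> i j - p j / p i * \<Lambda> j i\<bar> < e" if ij: "i \<in> {1..N}" "j \<in> {1..N}" for i j
  proof (cases "i = j")
    case True
    then show ?thesis using e pp[OF ij(1)] by simp
  next
    case False
    have "\<bar>\<Lambda> i j - p j / p i * \<Lambda> j i\<bar> = 1 / p i * \<bar>p i * \<Lambda> i j - p j * \<Lambda> j i\<bar>"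
    proof -
      have "p i * \<Lambda> i j - p j * \<Lambda> j i = p i * (\<Lambda> i j - p j / p i * \<Lambda> j i)"
        using pp[OF ij(1)] by (simp add: field_simps)
      then show ?thesis using pp[OF ij(1)] by (simp add: abs_mult)
    qed
    also have "\<dots> \<le> 1 / p i * (\<Sum>j\<in>{1..N} - {i}. \<bar>p i * \<Lambda> i j - p j * \<Lambda> j i\<bar>)"
      using pp[OF ij(1)] ij False
      by (intro mult_left_mono member_le_sum[of j _ "\<lambda>j. \<bar>p i * \<Lambda> i j - p j * \<Lambda> j i\<bar>"]) auto
    also have "\<dots> \<le> ?F p"
      using ij by (intro Max_ge) auto
    finally show ?thesis using lt by simp
  qed
  with p that show thesis by blast
qed

lemma cyclic_product_telescopes:
  fixes p :: "nat \<Rightarrow> real" and m :: nat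
  assumes "1 \<le> m" "c (m + 1) = c 1" "\<And>k. k \<in> {1..m} \<Longrightarrow> p (c k) \<noteq> 0"
  shows "(\<Prod>k = 1..m. p (c (k + 1)) / p (c k)) = 1"
proof -
  have "(\<Prod>k = 1..m. p (c (k + 1)) / p (c k)) = p (c (m + 1)) / p (c 1)"
    using assms(1,3)
  proof (induction m rule: dec_induct)
    case base
    then show ?case by simp
  next
    case (step n)
    then have "(\<Prod>k = 1..n. p (c (k + 1)) / p (c k)) = p (c (n + 1)) / p (c 1)" by simp
    moreover have "p (c (n + 1)) \<noteq> 0" using step.prems[of "n+1"] step.hyps by simp
    ultimately show ?case by simp
  qed
  also have "\<dots> = 1" using assms(2) assms(3)[of 1] assms(1) by simp
  finally show ?thesis .
qed

text \<open>Taking \<open>e = 1 / Suc n\<close> gives weights \<open>p n\<close> that may degenerate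
  as \<open>n\<close> grows. Both halves of the cyclic condition follow from the limits in
  \<open>lim\<close>, which involve ratios of the weights only.\<close>

lemma r_star_zero_imp_kolmogorov:
  assumes N: "1 \<le> N" and r: "r_star N \<Lambda> = 0"
  shows "kolmogorov_cyclic N \<Lambda>"
proof -
  have "\<exists>p. p \<in> positive_weights N \<and>
      (\<forall>i\<in>{1..N}. \<forall>j\<in>{1..N}. \<bar>\<Lambda> i j - p j / p i * \<Lambda> j i\<bar> < 1 / real (Suc n))" for n
    by (rule r_star_zero_imp_close[OF N r, of "1 / real (Suc n)"]) auto
  then obtain p where p: "\<And>n. p n \<in> positive_weights N"
    and pe: "\<And>n i j. i \<in> {1..N} \<Longrightarrow> j \<in> {1..N} \<Longrightarrow>
               \<bar>\<Lambda> i j - p n j / p n i * \<Lambda> j i\<bar> < 1 / real (Suc n)"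
    by metis
  have pp: "p n i > 0" if "i \<in> {1..N}" for i n
    using p[of n] that by (auto simp: positive_weights_def)
  have lim: "(\<lambda>n. p n j / p n i * \<Lambda> j i) \<longlonglongrightarrow> \<Lambda> i j" if "i \<in> {1..N}" "j \<in> {1..N}" for i j
  proof (rule LIMSEQ_I)
    fix e :: real assume "0 < e"
    then obtain n0 where n0: "1 / real (Suc n0) < e" using nat_approx_posE by blast
    have "norm (p n j / p n i * \<Lambda> j i - \<Lambda> i j) < e" if "n \<ge> n0" for n
    proof -
      have "1 / real (Suc n) \<le> 1 / real (Suc n0)" using that by (simp add: field_simps)
      then show ?thesis using pe[OF \<open>i \<in> _\<close> \<open>j \<in> _\<close>, of n] n0 by (simp add: abs_minus_commute)
    qed
    then show "\<exists>no. \<forall>n\<ge>no. norm (p n j / p n i * \<Lambda> j i - \<Lambda> i j) < e" by blast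
  qed
  \<comment> \<open>Here the convergent sequence is constantly 0, whatever the ratios do.\<close>
  have zero: "\<Lambda> i j = 0" if "i \<in> {1..N}" "j \<in> {1..N}" "\<Lambda> j i = 0" for i j
    using lim[OF that(1,2)] that(3) LIMSEQ_unique[of "\<lambda>_. 0::real"] by fastforce
  have prod: "(\<Prod>k = 1..m. \<Lambda> (c k) (c (k + 1))) = (\<Prod>k = 1..m. \<Lambda> (c (k + 1)) (c k))"
    if m: "1 \<le> m" and c: "\<And>k. k \<in> {1..m + 1} \<Longrightarrow> c k \<in> {1..N}" "c (m + 1) = c 1" for m and c :: "nat \<Rightarrow> nat"
  proof -
    have "(\<lambda>n. \<Prod>k = 1..m. p n (c (k + 1)) / p n (c k) * \<Lambda> (c (k + 1)) (c k))
        \<longlonglongrightarrow> (\<Prod>k = 1..m. \<Lambda> (c k) (c (k + 1)))"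
      by (intro tendsto_prod lim c(1)) auto
    \<comment> \<open>The ratios telescope around the cycle, so this product does not depend on
      \<open>n\<close> and must equal its limit.\<close>
    moreover have "(\<Prod>k = 1..m. p n (c (k + 1)) / p n (c k) * \<Lambda> (c (k + 1)) (c k))
        = (\<Prod>k = 1..m. \<Lambda> (c (k + 1)) (c k))" for n
    proof -
      have "p n (c k) \<noteq> 0" if "k \<in> {1..m}" for k using pp[of "c k" n] c(1)[of k] that by auto
      from cyclic_product_telescopes[OF m c(2), of "p n", OF this]
      show ?thesis by (subst prod.distrib) simp
    qed
    ultimately show ?thesis by (simp add: LIMSEQ_const_iff)
  qed
  show ?thesis
    unfolding kolmogorov_cyclic_def using zero prod by blast
qed

lemma detailed_balance_imp_r_star:
  assumes N: "1 \<le> N" and p: "p \<in> positive_weights N"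
    and db: "\<And>i j. i \<in> {1..N} \<Longrightarrow> j \<in> {1..N} \<Longrightarrow> p i * \<Lambda> i j = p j * \<Lambda> j i"
  shows "r_star N \<Lambda> = 0"
proof -
  let ?F = "\<lambda>p. MAX i\<in>{1..N}. 1 / p i * (\<Sum>j\<in>{1..N} - {i}. \<bar>p i * \<Lambda> i j - p j * \<Lambda> j i\<bar>)"
  have nonneg: "0 \<le> ?F q" if "q \<in> positive_weights N" for q
  proof -
    \<comment> \<open>Player 1 exists because \<open>1 \<le> N\<close>, and one nonnegative row
      makes the maximum nonnegative.\<close>
    have "0 \<le> 1 / q 1 * (\<Sum>j\<in>{1..N} - {1}. \<bar>q 1 * \<Lambda> 1 j - q j * \<Lambda> j 1\<bar>)"
      using that N by (intro mult_nonneg_nonneg sum_nonneg) (auto simp: positive_weights_def PiE_iff less_imp_le)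
    also have "\<dots> \<le> ?F q" using N by (intro Max_ge) auto
    finally show ?thesis .
  qed
  have "?F p = (MAX i\<in>{1..N}. (0::real))"
    using db by (intro arg_cong[where f=Max] image_cong refl) (auto simp: sum.neutral)
  also have "\<dots> = 0" using N by (simp add: image_constant_conv)
  finally have "?F p = 0" .
  moreover have "r_star N \<Lambda> \<le> ?F p"
    unfolding r_star_def using nonneg p by (intro cINF_lower bdd_belowI2[of _ 0]) auto
  moreover have "0 \<le> r_star N \<Lambda>"
    unfolding r_star_def using nonneg p by (intro cINF_greatest) auto
  ultimately show ?thesis by simp
qed

text \<open>\<open>weighted_walk V \<Lambda> i j w\<close>: some walk from \<open>i\<close> to \<open>j\<close> along edges of positive weight forces
  \<open>p j = w * p i\<close> in any solution of the detailed balance equations.\<close>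

inductive weighted_walk :: "'a set \<Rightarrow> ('a \<Rightarrow> 'a \<Rightarrow> real) \<Rightarrow> 'a \<Rightarrow> 'a \<Rightarrow> real \<Rightarrow> bool" for V \<Lambda> i where
  nil: "i \<in> V \<Longrightarrow> weighted_walk V \<Lambda> i i 1"
| snoc: "weighted_walk V \<Lambda> i j w \<Longrightarrow> k \<in> V \<Longrightarrow> 0 < \<Lambda> j k \<Longrightarrow> 0 < \<Lambda> k j \<Longrightarrow>
    weighted_walk V \<Lambda> i k (w * (\<Lambda> j k / \<Lambda> k j))"

lemma weighted_walk_pos: "weighted_walk V \<Lambda> i j w \<Longrightarrow> 0 < w \<and> i \<in> V \<and> j \<in> V"
  by (induction rule: weighted_walk.induct) auto

lemma weighted_walk_trans:
  assumes "weighted_walk V \<Lambda> j k v" "weighted_walk V \<Lambda> i j w"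
  shows "weighted_walk V \<Lambda> i k (w * v)"
  using assms
proof (induction rule: weighted_walk.induct)
  case nil
  then show ?case by simp
next
  case (snoc k v l)
  from weighted_walk.snoc[OF snoc.IH[OF snoc.prems] snoc.hyps(2-4)]
  show ?case by (simp only: mult.assoc)
qed

lemma weighted_walk_sym: "weighted_walk V \<Lambda> i j w \<Longrightarrow> weighted_walk V \<Lambda> j i (1 / w)"
proof (induction rule: weighted_walk.induct)
  case nil
  then show ?case using weighted_walk.nil[of i V \<Lambda>] by simp
next
  case (snoc j w k)
  have "weighted_walk V \<Lambda> k j (1 * (\<Lambda> k j / \<Lambda> j k))"
    using snoc.hyps weighted_walk_pos[OF snoc.hyps(1)] by (intro weighted_walk.snoc weighted_walk.nil) auto
  from weighted_walk_trans[OF snoc.IH this] show ?case by (simp add: field_simps)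
qed

text \<open>Translates walks into the indexing of \<open>kolmogorov_cyclic\<close>. The relation
  between the two products is kept free of division, and positivity of the backward product allows
  it to be cancelled later.\<close>

lemma weighted_walk_imp_path:
  assumes "weighted_walk V \<Lambda> i j w"
  shows "\<exists>(n::nat) c. c 1 = i \<and> c (n + 1) = j \<and> (\<forall>k\<in>{1..n + 1}. c k \<in> V) \<and>
    (\<Prod>k = 1..n. \<Lambda> (c k) (c (k + 1))) = w * (\<Prod>k = 1..n. \<Lambda> (c (k + 1)) (c k)) \<and>
    0 < (\<Prod>k = 1..n::nat. \<Lambda> (c (k + 1)) (c k))"
  using assms
proof (induction rule: weighted_walk.induct)
  case nil
  then show ?case by (intro exI[of _ 0] exI[of _ "\<lambda>_. i"]) auto
next
  case (snoc j w l)
  then obtain n :: nat and c where c: "c 1 = i" "c (n + 1) = j" "\<forall>k\<in>{1..n + 1}. c k \<in> V"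
    "(\<Prod>k = 1..n. \<Lambda> (c k) (c (k + 1))) = w * (\<Prod>k = 1..n. \<Lambda> (c (k + 1)) (c k))"
    "0 < (\<Prod>k = 1..n. \<Lambda> (c (k + 1)) (c k))" by blast
  \<comment> \<open>A walk with \<open>n\<close> edges occupies the indices 1 to
    \<open>n + 1\<close>, so the new vertex gets index \<open>n + 2\<close>.\<close>
  let ?c = "c(n + 2 := l)"
  have 1: "(\<Prod>k = 1..n. \<Lambda> (?c k) (?c (k + 1))) = (\<Prod>k = 1..n. \<Lambda> (c k) (c (k + 1)))"
    by (intro prod.cong) auto
  have 2: "(\<Prod>k = 1..n. \<Lambda> (?c (k + 1)) (?c k)) = (\<Prod>k = 1..n. \<Lambda> (c (k + 1)) (c k))"
    by (intro prod.cong) auto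
  show ?case
  proof (intro exI[of _ "n + 1"] exI[of _ ?c] conjI)
    show "?c 1 = i" "?c (n + 1 + 1) = l" using c by auto
    show "\<forall>k\<in>{1..n + 1 + 1}. ?c k \<in> V" using c(3) snoc.hyps(2) by (auto simp: atLeastAtMostSuc_conv)
    show "(\<Prod>k = 1..n + 1. \<Lambda> (?c k) (?c (k + 1))) =
        w * (\<Lambda> j l / \<Lambda> l j) * (\<Prod>k = 1..n + 1. \<Lambda> (?c (k + 1)) (?c k))"
      using 1 2 c(2,4) snoc.hyps by (simp add: field_simps)
    show "0 < (\<Prod>k = 1..n + 1. \<Lambda> (?c (k + 1)) (?c k))"
      using 2 c(2,5) snoc.hyps by simp
  qed
qed

text \<open>For a closed walk the cyclic condition equates the forward and backward products, whose
  quotient is \<open>w\<close>. This is the independence of the walk in another form.\<close>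

lemma kolmogorov_closed_walk:
  assumes K: "kolmogorov_cyclic N \<Lambda>" and w: "weighted_walk {1..N} \<Lambda> i i w"
  shows "w = 1"
proof -
  obtain n :: nat and c where c: "c 1 = i" "c (n + 1) = i" "\<forall>k\<in>{1..n + 1}. c k \<in> {1..N}"
    "(\<Prod>k = 1..n. \<Lambda> (c k) (c (k + 1))) = w * (\<Prod>k = 1..n. \<Lambda> (c (k + 1)) (c k))"
    "0 < (\<Prod>k = 1..n. \<Lambda> (c (k + 1)) (c k))"
    using weighted_walk_imp_path[OF w] by blast
  show ?thesis
  proof (cases "n = 0")
    \<comment> \<open>The cyclic condition speaks about cycles with at least one edge, so the empty
      walk is treated apart; both of its products are 1.\<close>
    case True
    then show ?thesis using c by simp
  next
    case False
    then have "(\<Prod>k = 1..n. \<Lambda> (c k) (c (k + 1))) = (\<Prod>k = 1..n. \<Lambda> (c (k + 1)) (c k))"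
      using K c(1-3) unfolding kolmogorov_cyclic_def by auto
    then have "1 * (\<Prod>k = 1..n. \<Lambda> (c (k + 1)) (c k)) = w * (\<Prod>k = 1..n. \<Lambda> (c (k + 1)) (c k))"
      using c(4) by (simp only: mult_1)
    then show ?thesis using c(5) by (subst (asm) mult_cancel_right) (metis less_irrefl)
  qed
qed

text \<open>Each connected component gets a root, and \<open>p j\<close> is the weight of some walk
  from the root to \<open>j\<close>. For adjacent \<open>i\<close> and \<open>j\<close>, going from
  the root to \<open>i\<close>, along the edge to \<open>j\<close> and back to the root is a closed
  walk, and weight 1 of this walk is detailed balance for the edge.\<close>

lemma kolmogorov_imp_detailed_balance:
  assumes K: "kolmogorov_cyclic N \<Lambda>" and nn: "\<And>i j. i \<in> {1..N} \<Longrightarrow> j \<in> {1..N} \<Longrightarrow> 0 \<le> \<Lambda> i j"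
  shows "\<exists>p\<in>positive_weights N. \<forall>i\<in>{1..N}. \<forall>j\<in>{1..N}. p i * \<Lambda> i j = p j * \<Lambda> j i"
proof -
  let ?W = "weighted_walk {1..N} \<Lambda>"
  \<comment> \<open>The choice depends on \<open>j\<close> only through the set of vertices from
    which \<open>j\<close> can be reached, so all vertices of a component share one root.\<close>
  define root where "root j = (SOME i. \<exists>w. ?W i j w)" for j
  define p where "p = restrict (\<lambda>j. SOME w. ?W (root j) j w) {1..N}"
  have p: "?W (root j) j (p j)" if "j \<in> {1..N}" for j
  proof -
    have "\<exists>i w. ?W i j w" using weighted_walk.nil[OF that] by blast
    then have "\<exists>w. ?W (root j) j w" unfolding root_def by (rule someI_ex)
    then have "?W (root j) j (SOME w. ?W (root j) j w)" by (rule someI_ex)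
    then show ?thesis using that by (simp add: p_def)
  qed
  have "p \<in> positive_weights N"
    using weighted_walk_pos[OF p] by (auto simp: positive_weights_def p_def)
  moreover have "p i * \<Lambda> i j = p j * \<Lambda> j i" if ij: "i \<in> {1..N}" "j \<in> {1..N}" for i j
  proof (cases "i = j \<or> \<Lambda> i j = 0")
    case True
    then have "i = j \<or> \<Lambda> i j = 0 \<and> \<Lambda> j i = 0" using K ij unfolding kolmogorov_cyclic_def by metis
    then show ?thesis by auto
  next
    case False
    then have "\<Lambda> j i \<noteq> 0" using K ij unfolding kolmogorov_cyclic_def by auto
    then have pos: "0 < \<Lambda> i j" "0 < \<Lambda> j i" using nn[OF ij] nn[OF ij(2,1)] False by auto
    have e: "?W i j (1 * (\<Lambda> i j / \<Lambda> j i))"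
      using ij pos by (intro weighted_walk.snoc weighted_walk.nil)
    \<comment> \<open>The two predicates in \<open>k\<close> coincide as functions, and then
      \<open>SOME\<close> picks the same root for \<open>i\<close> and \<open>j\<close>.\<close>
    have "(\<exists>w. ?W k i w) \<longleftrightarrow> (\<exists>w. ?W k j w)" for k
      using weighted_walk_trans[OF e] weighted_walk_trans[OF weighted_walk_sym[OF e]] by blast
    then have r: "root i = root j" unfolding root_def by simp
    have "?W (root i) j (p i * (\<Lambda> i j / \<Lambda> j i))"
      using weighted_walk_trans[OF e p[OF ij(1)]] by simp
    from weighted_walk_trans[OF weighted_walk_sym[OF p[OF ij(2)]] this[unfolded r]]
    have "p i * (\<Lambda> i j / \<Lambda> j i) * (1 / p j) = 1" by (rule kolmogorov_closed_walk[OF K])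
    then show ?thesis using pos weighted_walk_pos[OF p[OF ij(2)]] by (simp add: field_simps)
  qed
  ultimately show ?thesis by blast
qed

section \<open>Processes with continuous paths and independence\<close>

text \<open>Time is rounded down to a grid of mesh \<open>1 / Suc n\<close>. The rounded process
  uses countably many measurable maps, hence is jointly measurable, and it converges pointwise by
  continuity of the paths.\<close>

lemma borel_measurable_pair_of_continuous_paths:
  fixes Y :: "real \<Rightarrow> 'w \<Rightarrow> 'b::metric_space"
  assumes meas: "\<And>t. Y t \<in> borel_measurable M"
    and cont: "\<And>\<omega>. \<omega> \<in> space M \<Longrightarrow> continuous_on UNIV (\<lambda>t. Y t \<omega>)"
  shows "(\<lambda>(t, \<omega>). Y t \<omega>) \<in> borel_measurable (borel \<Otimes>\<^sub>M M)"
proof (rule borel_measurable_LIMSEQ_metric)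
  let ?r = "\<lambda>(n::nat) (t::real). of_int \<lfloor>real (Suc n) * t\<rfloor> / real (Suc n)"
  show "(\<lambda>(t, \<omega>). Y (?r n t) \<omega>) \<in> borel_measurable (borel \<Otimes>\<^sub>M M)" for n
  proof -
    have "(\<lambda>z. (\<lambda>k z. Y (of_int k / real (Suc n)) (snd z)) \<lfloor>real (Suc n) * fst z\<rfloor> z)
        \<in> borel_measurable ((borel :: real measure) \<Otimes>\<^sub>M M)"
      by (rule measurable_compose_countable) (use meas in measurable)
    then show ?thesis by (simp add: case_prod_beta')
  qed
  show "(\<lambda>n. case z of (t, \<omega>) \<Rightarrow> Y (?r n t) \<omega>) \<longlonglongrightarrow> (case z of (t, \<omega>) \<Rightarrow> Y t \<omega>)"
    if "z \<in> space (borel \<Otimes>\<^sub>M M)" for z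
  proof -
    obtain t \<omega> where z: "z = (t, \<omega>)" "\<omega> \<in> space M"
      using \<open>z \<in> _\<close> by (cases z) (auto simp: space_pair_measure)
    have "(\<lambda>n. ?r n t) \<longlonglongrightarrow> t"
    proof (rule real_tendsto_sandwich[where f="\<lambda>n. t - 1 / real (Suc n)" and h="\<lambda>n. t"])
      have "t - 1 / real (Suc n) \<le> ?r n t \<and> ?r n t \<le> t" for n
      proof -
        have "real (Suc n) * t - 1 \<le> of_int \<lfloor>real (Suc n) * t\<rfloor>" "of_int \<lfloor>real (Suc n) * t\<rfloor> \<le> real (Suc n) * t"
          using floor_correct[of "real (Suc n) * t"] by linarith+
        then have "(real (Suc n) * t - 1) / real (Suc n) \<le> ?r n t" "?r n t \<le> (real (Suc n) * t) / real (Suc n)"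
          by (intro divide_right_mono; simp)+
        then show ?thesis by (simp add: diff_divide_distrib)
      qed
      then show "\<forall>\<^sub>F n in sequentially. t - 1 / real (Suc n) \<le> ?r n t"
        "\<forall>\<^sub>F n in sequentially. ?r n t \<le> t" by auto
      show "(\<lambda>n. t - 1 / real (Suc n)) \<longlonglongrightarrow> t"
        using tendsto_diff[OF tendsto_const[of t] LIMSEQ_Suc[OF lim_1_over_n]] by simp
    qed auto
    moreover have "isCont (\<lambda>t. Y t \<omega>) t"
      using cont[OF z(2)] by (simp add: continuous_on_eq_continuous_at)
    ultimately show ?thesis
      unfolding z by (auto intro: isCont_tendsto_compose)
  qed
qed

lemma continuous_on_clamp:
  fixes f :: "real \<Rightarrow> 'b::topological_space"
  assumes "continuous_on {0..T} f" "0 \<le> T"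
  shows "continuous_on UNIV (\<lambda>t. f (max 0 (min T t)))"
  by (rule continuous_on_compose2[OF assms(1)]) (use assms(2) in \<open>auto intro!: continuous_intros\<close>)

text \<open>Nothing is known about \<open>Y\<close> at times outside the interval. The indicator
  removes these times, and clamping time to the interval gives paths that are continuous on the
  whole line.\<close>

lemma borel_measurable_pair_interval:
  fixes Y :: "real \<Rightarrow> 'w \<Rightarrow> 'b::{second_countable_topology, real_normed_vector}"
  assumes "0 \<le> T" and meas: "\<And>t. t \<in> {0..T} \<Longrightarrow> Y t \<in> borel_measurable M"
    and cont: "\<And>\<omega>. \<omega> \<in> space M \<Longrightarrow> continuous_on {0..T} (\<lambda>t. Y t \<omega>)"
  shows "(\<lambda>(t, \<omega>). indicator {0..T} t *\<^sub>R Y t \<omega>) \<in> borel_measurable (borel \<Otimes>\<^sub>M M)"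
proof -
  have "(\<lambda>(t, \<omega>). Y (max 0 (min T t)) \<omega>) \<in> borel_measurable (borel \<Otimes>\<^sub>M M)"
    using assms by (intro borel_measurable_pair_of_continuous_paths continuous_on_clamp) auto
  then have "(\<lambda>z. indicator {0..T} (fst z) *\<^sub>R (\<lambda>(t, \<omega>). Y (max 0 (min T t)) \<omega>) z) \<in> borel_measurable (borel \<Otimes>\<^sub>M M)"
    by measurable
  moreover have "(\<lambda>z. indicator {0..T} (fst z) *\<^sub>R (\<lambda>(t, \<omega>). Y (max 0 (min T t)) \<omega>) z)
      = (\<lambda>(t, \<omega>). indicator {0..T} t *\<^sub>R Y t \<omega>)"
    by (auto simp: fun_eq_iff indicator_def max_def min_def)
  ultimately show ?thesis by simp
qed

section \<open>Independence and null sets\<close>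

text \<open>Augmentation changes every event by a null set at most, which probabilities do not see.
  This carries independence of Brownian increments from the raw past over to
  \<open>brownian_filtration\<close>.\<close>

lemma (in prob_space) indep_augmented:
  assumes indep: "indep_set (sigma_sets (space M) P) B"
    and P: "P \<subseteq> sets M"
  shows "indep_set (sigma_sets (space M) (P \<union> null_sets M)) B"
proof -
  have B: "B \<subseteq> events" using indep_setD_ev2[OF indep] .
  have PS: "P \<union> null_sets M \<subseteq> Pow (space M)" using P sets.sets_into_space by (auto dest: null_setsD2)
  have A: "sigma_sets (space M) (P \<union> null_sets M) \<subseteq> events"
    using P by (intro sets.sigma_sets_subset) auto
  have SP: "sigma_sets (space M) P \<subseteq> events"
    using P by (intro sets.sigma_sets_subset) auto
  \<comment> \<open>Agreeing off a null set with some set of the original sigma-algebra is preserved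
    by complements and countable unions and holds for both kinds of generators.\<close>
  have approx: "\<exists>A'\<in>sigma_sets (space M) P. \<exists>n\<in>null_sets M. a - n = A' - n"
    if "a \<in> sigma_sets (space M) (P \<union> null_sets M)" for a
    using that
  proof (induction rule: sigma_sets.induct)
    case (Basic a)
    then show ?case
    proof
      assume "a \<in> P" then show ?thesis by (intro bexI[of _ a] bexI[of _ "{}"]) auto
    next
      assume "a \<in> null_sets M"
      then show ?thesis by (intro bexI[of _ "{}"] bexI[of _ a]) (auto intro: sigma_sets.Empty)
    qed
  next
    case Empty
    then show ?case by (intro bexI[of _ "{}"] bexI[of _ "{}"]) (auto intro: sigma_sets.Empty)
  next
    case (Compl a)
    then obtain A' n where "A' \<in> sigma_sets (space M) P" "n \<in> null_sets M" "a - n = A' - n" by blast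
    note A' = this
    have "x \<in> a \<longleftrightarrow> x \<in> A'" if "x \<notin> n" for x using A'(3) that by blast
    then have "space M - a - n = space M - A' - n" by auto
    then show ?case using A'(2) sigma_sets.Compl[OF A'(1)] by blast
  next
    case (Union a)
    have "\<exists>p. fst p \<in> sigma_sets (space M) P \<and> snd p \<in> null_sets M \<and> a i - snd p = fst p - snd p" for i
      using Union.IH[of i] by auto
    then obtain p where p: "\<And>i. fst (p i) \<in> sigma_sets (space M) P \<and> snd (p i) \<in> null_sets M \<and>
        a i - snd (p i) = fst (p i) - snd (p i)" by metis
    have "x \<in> a i \<longleftrightarrow> x \<in> fst (p i)" if "x \<notin> snd (p i)" for x i using p[of i] that by blast
    then have "(\<Union>i. a i) - (\<Union>i. snd (p i)) = (\<Union>i. fst (p i)) - (\<Union>i. snd (p i))" by auto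
    moreover have "(\<Union>i. snd (p i)) \<in> null_sets M" using p by (intro null_sets_UN) auto
    moreover have "(\<Union>i. fst (p i)) \<in> sigma_sets (space M) P" using p by (intro sigma_sets.Union) auto
    ultimately show ?case by blast
  qed
  show ?thesis
  proof (rule indep_setI[OF A B])
    fix a b assume a: "a \<in> sigma_sets (space M) (P \<union> null_sets M)" and b: "b \<in> B"
    obtain A' n where A': "A' \<in> sigma_sets (space M) P" "n \<in> null_sets M" "a - n = A' - n"
      using approx[OF a] by blast
    have AE: "AE x in M. x \<in> a \<longleftrightarrow> x \<in> A'"
      using AE_not_in[OF A'(2)] by eventually_elim (use A'(3) in blast)
    have [measurable]: "a \<in> events" "A' \<in> events" "b \<in> events" using a A A'(1) SP b B by auto
    have "prob (a \<inter> b) = prob (A' \<inter> b)" "prob a = prob A'"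
      using AE by (auto intro!: finite_measure_eq_AE)
    then show "prob (a \<inter> b) = prob a * prob b"
      using indep_setD[OF indep A'(1) b] by simp
  qed
qed

text \<open>Stands in for conditioning on \<open>F\<close>: a factor known at the start of an
  increment is separated from a function of the increment.\<close>

lemma (in prob_space) expectation_mult_indep:
  fixes Y Z :: "'a \<Rightarrow> real"
  assumes F: "subalgebra M F" and Y: "Y \<in> borel_measurable F" "integrable M Y"
    and Z: "integrable M Z"
    and indep: "indep_set (sets F) {Z -` B \<inter> space M | B. B \<in> sets borel}"
  shows "integrable M (\<lambda>x. Y x * Z x)" "expectation (\<lambda>x. Y x * Z x) = expectation Y * expectation Z"
proof -
  have rv: "random_variable borel Y" "random_variable borel Z" using Y Z by auto
  have sp: "space F = space M" using F by (simp add: subalgebra_def)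
  have "sigma_sets (space M) {Y -` A \<inter> space M |A. A \<in> sets borel} \<subseteq> sets F"
    using measurable_sets[OF Y(1)] by (subst sp[symmetric], intro sets.sigma_sets_subset) (auto simp: sp)
  moreover have "sigma_sets (space M) {Z -` A \<inter> space M |A. A \<in> sets borel} \<subseteq> {Z -` B \<inter> space M | B. B \<in> sets borel}"
  proof -
    have "{Z -` B \<inter> space M | B. B \<in> sets borel} = sets (vimage_algebra (space M) Z borel)"
      by (subst sets_vimage_algebra2) auto
    then show ?thesis 
      by (metis sets.sigma_sets_subset space_vimage_algebra subset_refl)
  qed
  ultimately have "indep_var borel Y borel Z"
    unfolding indep_var_eq using rv
    by (intro conjI indep_setI)
      (use indep_setD_ev1[OF indep] indep_setD_ev2[OF indep] in \<open>blast intro: indep_setD[OF indep]\<close>)+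
  then show "integrable M (\<lambda>x. Y x * Z x)" "expectation (\<lambda>x. Y x * Z x) = expectation Y * expectation Z"
    using Y Z by (auto intro: indep_var_integrable indep_var_lebesgue_integral)
qed

section \<open>Matrix-vector products and discrete martingale transforms\<close>

lemma borel_measurable_vec_component[measurable]:
  fixes f :: "'w \<Rightarrow> real^'n"
  assumes "f \<in> borel_measurable M" shows "(\<lambda>x. f x $ i) \<in> borel_measurable M"
  using assms by (intro borel_measurable_continuous_on[of "\<lambda>x. x $ i"]) (auto intro: continuous_intros)

lemma borel_measurable_matrix_component[measurable]:
  fixes f :: "'w \<Rightarrow> real^'m^'n"
  assumes "f \<in> borel_measurable M" shows "(\<lambda>x. f x $ i $ j) \<in> borel_measurable M"
  by (intro borel_measurable_continuous_on[OF _ assms, of "\<lambda>x. x $ i $ j"] continuous_intros)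

text \<open>The norm of \<open>real^'m^'d\<close> is the Frobenius norm, so Cauchy-Schwarz on every
  row is enough.\<close>

lemma norm_matrix_vector_mult_le:
  fixes A :: "real^'m^'d"
  shows "norm (A *v x) \<le> norm A * norm x"
proof -
  have "norm (A *v x) = L2_set (\<lambda>i. norm (A $ i \<bullet> x)) UNIV"
    by (simp add: norm_vec_def matrix_vector_mul_component)
  also have "\<dots> \<le> L2_set (\<lambda>i. norm (A $ i) * norm x) UNIV"
    by (intro L2_set_mono) (auto simp: Cauchy_Schwarz_ineq2)
  also have "\<dots> = norm A * norm x"
    by (subst L2_set_left_distrib[symmetric]) (auto simp: norm_vec_def)
  finally show ?thesis .
qed

lemma continuous_on_matrix_vector_mult[continuous_intros]:
  fixes f :: "'a::topological_space \<Rightarrow> real^'m^'d" 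
  assumes "continuous_on S f" "continuous_on S g"
  shows "continuous_on S (\<lambda>x. f x *v g x)"
proof -
  have "continuous_on S (\<lambda>x. \<chi> i. \<Sum>j\<in>UNIV. f x $ i $ j * g x $ j)"
    using assms by (intro continuous_intros)
  then show ?thesis by (simp add: matrix_vector_mult_def)
qed

lemma borel_measurable_matrix_vector_mult[measurable]:
  fixes f :: "'w \<Rightarrow> real^'m^'d" 
  assumes "f \<in> borel_measurable M" "g \<in> borel_measurable M"
  shows "(\<lambda>x. f x *v g x) \<in> borel_measurable M"
  by (rule borel_measurable_continuous_Pair[OF assms]) (intro continuous_intros)

text \<open>When the square of the last partial sum is expanded, the cross term is a sum of products
  of something known at stage \<open>n\<close> with a centered component of \<open>D n\<close>
  independent of that stage, so its expectation vanishes. The factor \<open>CARD('m)\<close> is the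
  price for using the second moments of the components of \<open>D k\<close> but no information on
  their correlations.\<close>

lemma (in prob_space) martingale_transform_second_moment:
  fixes \<theta> :: "nat \<Rightarrow> 'a \<Rightarrow> real^'m^'d" and D :: "nat \<Rightarrow> 'a \<Rightarrow> real^'m" and v :: "nat \<Rightarrow> real"
  assumes sub: "\<And>k. k \<le> n \<Longrightarrow> subalgebra M (F k)"
    and mono: "\<And>k. k < n \<Longrightarrow> sets (F k) \<subseteq> sets (F (Suc k))"
    and \<theta>: "\<And>k. k < n \<Longrightarrow> \<theta> k \<in> borel_measurable (F k)" 
      "\<And>k. k < n \<Longrightarrow> \<exists>C. \<forall>\<omega>\<in>space M. norm (\<theta> k \<omega>) \<le> C"
    and D: "\<And>k. k < n \<Longrightarrow> D k \<in> borel_measurable (F (Suc k))"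
      "\<And>k. k < n \<Longrightarrow> indep_set (sets (F k)) {D k -` B \<inter> space M | B. B \<in> sets borel}"
      "\<And>k c. k < n \<Longrightarrow> expectation (\<lambda>\<omega>. D k \<omega> $ c) = 0"
      "\<And>k c. k < n \<Longrightarrow> integrable M (\<lambda>\<omega>. (D k \<omega> $ c)\<^sup>2)"
      "\<And>k c. k < n \<Longrightarrow> expectation (\<lambda>\<omega>. (D k \<omega> $ c)\<^sup>2) = v k"
  defines "S \<equiv> \<lambda>n \<omega>. \<Sum>k<n. \<theta> k \<omega> *v D k \<omega>"
  shows "S n \<in> borel_measurable (F n) \<and> integrable M (\<lambda>\<omega>. (norm (S n \<omega>))\<^sup>2) \<and>
    expectation (\<lambda>\<omega>. (norm (S n \<omega>))\<^sup>2) \<le>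
      real CARD('m) * (\<Sum>k<n. v k * expectation (\<lambda>\<omega>. (norm (\<theta> k \<omega>))\<^sup>2))"
  using sub mono \<theta> D
proof (induction n)
  case 0
  then show ?case by (simp add: S_def)
next
  case (Suc n)
  have IH: "S n \<in> borel_measurable (F n)" "integrable M (\<lambda>\<omega>. (norm (S n \<omega>))\<^sup>2)"
    "expectation (\<lambda>\<omega>. (norm (S n \<omega>))\<^sup>2) \<le>
      real CARD('m) * (\<Sum>k<n. v k * expectation (\<lambda>\<omega>. (norm (\<theta> k \<omega>))\<^sup>2))"
    using Suc.IH Suc.prems by simp_all
  note sub = Suc.prems(1)[of n, simplified] and D = Suc.prems(5-9)[of n, simplified]
  obtain C where C: "\<And>\<omega>. \<omega> \<in> space M \<Longrightarrow> norm (\<theta> n \<omega>) \<le> C" using Suc.prems(4)[of n] by auto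
  then have "0 \<le> C" using not_empty norm_ge_zero order_trans by blast
  have \<theta>F: "\<theta> n \<in> borel_measurable (F n)" using Suc.prems(3)[of n] by simp
  have sub': "subalgebra (F (Suc n)) (F n)"
    using Suc.prems(2)[of n] Suc.prems(1)[of n] Suc.prems(1)[of "Suc n"] by (simp add: subalgebra_def)
  have SnF: "S n \<in> borel_measurable (F (Suc n))" "\<theta> n \<in> borel_measurable (F (Suc n))"
    using measurable_from_subalg[OF sub'] IH(1) \<theta>F by auto
  have S_Suc: "S (Suc n) = (\<lambda>\<omega>. S n \<omega> + \<theta> n \<omega> *v D n \<omega>)"
    by (simp add: S_def)
  have meas: "S (Suc n) \<in> borel_measurable (F (Suc n))"
    unfolding S_Suc using SnF D(1) by measurable
  have M[measurable]: "S n \<in> borel_measurable M" "\<theta> n \<in> borel_measurable M" "D n \<in> borel_measurable M"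
    using measurable_from_subalg[OF sub] measurable_from_subalg[OF Suc.prems(1)[of "Suc n"]] IH(1) \<theta>F D(1) by auto
  have indep: "indep_set (sets (F n)) {(\<lambda>\<omega>. h (D n \<omega>)) -` B \<inter> space M | B. B \<in> sets borel}"
    if h: "h \<in> borel_measurable borel" for h :: "real^'m \<Rightarrow> real"
    unfolding indep_set_def
  proof (rule indep_sets_mono_sets[OF D(2)[unfolded indep_set_def]])
    have "(\<lambda>\<omega>. h (D n \<omega>)) -` B \<inter> space M = D n -` (h -` B) \<inter> space M" "h -` B \<in> sets borel" if "B \<in> sets borel" for B
      using measurable_sets[OF h that] by auto
    then show "case_bool (sets (F n)) {(\<lambda>\<omega>. h (D n \<omega>)) -` B \<inter> space M |B. B \<in> sets borel} i
        \<subseteq> case_bool (sets (F n)) {D n -` B \<inter> space M |B. B \<in> sets borel} i" for i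
      by (cases i) (auto, blast)
  qed
  have Dint: "integrable M (\<lambda>\<omega>. D n \<omega> $ c)" for c
    by (rule square_integrable_imp_integrable) (use D(4) in auto)
  \<comment> \<open>The factor \<open>S n \<omega> $ a * \<theta> n \<omega> $ a $ b\<close> is
    known at stage \<open>n\<close>. It is integrable because \<theta> is bounded by
    \<open>C\<close> and \<open>S n\<close> is square integrable, with a number bounded by 1 plus
    its square.\<close>
  have cross: "integrable M (\<lambda>\<omega>. S n \<omega> $ a * \<theta> n \<omega> $ a $ b * D n \<omega> $ b)"
    "expectation (\<lambda>\<omega>. S n \<omega> $ a * \<theta> n \<omega> $ a $ b * D n \<omega> $ b) = 0" for a b
  proof -
    have "integrable M (\<lambda>\<omega>. S n \<omega> $ a * \<theta> n \<omega> $ a $ b)"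
    proof (rule Bochner_Integration.integrable_bound[of _ "\<lambda>\<omega>. C * (1 + (norm (S n \<omega>))\<^sup>2)"])
      show "integrable M (\<lambda>\<omega>. C * (1 + (norm (S n \<omega>))\<^sup>2))" using IH(2) by auto
      show "AE \<omega> in M. norm (S n \<omega> $ a * \<theta> n \<omega> $ a $ b) \<le> norm (C * (1 + (norm (S n \<omega>))\<^sup>2))"
      proof (rule AE_I2)
        fix \<omega> assume "\<omega> \<in> space M"
        have "\<bar>\<theta> n \<omega> $ a $ b\<bar> \<le> C"
          using C[OF \<open>\<omega> \<in> _\<close>] Finite_Cartesian_Product.norm_nth_le[of "\<theta> n \<omega>" a] Finite_Cartesian_Product.norm_nth_le[of "\<theta> n \<omega> $ a" b] by simp
        moreover have "\<bar>S n \<omega> $ a\<bar> \<le> 1 + (norm (S n \<omega>))\<^sup>2"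
        proof -
          have "0 \<le> (norm (S n \<omega>) - 1)\<^sup>2" by simp
          then have "2 * norm (S n \<omega>) \<le> 1 + (norm (S n \<omega>))\<^sup>2" by (simp add: power2_diff)
          then show ?thesis using Finite_Cartesian_Product.norm_nth_le[of "S n \<omega>" a] norm_ge_zero[of "S n \<omega>"] by simp
        qed
        ultimately have "\<bar>S n \<omega> $ a\<bar> * \<bar>\<theta> n \<omega> $ a $ b\<bar> \<le> (1 + (norm (S n \<omega>))\<^sup>2) * C"
          by (intro mult_mono) auto
        then show "norm (S n \<omega> $ a * \<theta> n \<omega> $ a $ b) \<le> norm (C * (1 + (norm (S n \<omega>))\<^sup>2))"
          using \<open>0 \<le> C\<close>
          by (simp add: abs_mult mult.commute)
      qed
    qed measurable
    moreover have "(\<lambda>\<omega>. S n \<omega> $ a * \<theta> n \<omega> $ a $ b) \<in> borel_measurable (F n)"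
      using IH(1) \<theta>F by measurable
    ultimately show "integrable M (\<lambda>\<omega>. S n \<omega> $ a * \<theta> n \<omega> $ a $ b * D n \<omega> $ b)"
      "expectation (\<lambda>\<omega>. S n \<omega> $ a * \<theta> n \<omega> $ a $ b * D n \<omega> $ b) = 0"
      using expectation_mult_indep[OF sub _ _ Dint[of b] indep[of "\<lambda>x. x $ b"]] D(3)[of b] by auto
  qed
  have inner: "S n \<omega> \<bullet> (\<theta> n \<omega> *v D n \<omega>) = (\<Sum>a\<in>UNIV. \<Sum>b\<in>UNIV. S n \<omega> $ a * \<theta> n \<omega> $ a $ b * D n \<omega> $ b)" for \<omega>
    by (simp add: inner_vec_def matrix_vector_mult_def sum_distrib_left mult.assoc)
  have cr: "integrable M (\<lambda>\<omega>. S n \<omega> \<bullet> (\<theta> n \<omega> *v D n \<omega>))" "expectation (\<lambda>\<omega>. S n \<omega> \<bullet> (\<theta> n \<omega> *v D n \<omega>)) = 0"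
    unfolding inner using cross by (auto simp: Bochner_Integration.integral_sum)
  have \<theta>2: "integrable M (\<lambda>\<omega>. (norm (\<theta> n \<omega>))\<^sup>2)"
  proof (rule integrable_const_bound[of _ "C\<^sup>2"])
    show "AE \<omega> in M. norm ((norm (\<theta> n \<omega>))\<^sup>2) \<le> C\<^sup>2"
      using C by (auto intro!: power_mono)
  qed measurable
  have sq: "integrable M (\<lambda>\<omega>. (norm (\<theta> n \<omega>))\<^sup>2 * (D n \<omega> $ c)\<^sup>2)"
    "expectation (\<lambda>\<omega>. (norm (\<theta> n \<omega>))\<^sup>2 * (D n \<omega> $ c)\<^sup>2) = expectation (\<lambda>\<omega>. (norm (\<theta> n \<omega>))\<^sup>2) * v n" for c
    using expectation_mult_indep[OF sub _ \<theta>2 D(4)[of c] indep[of "\<lambda>x. (x $ c)\<^sup>2"]] \<theta>F D(5)[of c] by simp_all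
  let ?R = "\<lambda>\<omega>. \<Sum>c\<in>UNIV. (norm (\<theta> n \<omega>))\<^sup>2 * (D n \<omega> $ c)\<^sup>2"
  have R: "integrable M ?R" "expectation ?R = real CARD('m) * (v n * expectation (\<lambda>\<omega>. (norm (\<theta> n \<omega>))\<^sup>2))"
    using sq by (auto simp: Bochner_Integration.integral_sum)
  \<comment> \<open>Source of \<open>CARD('m)\<close>: the squared norm of \<open>D n\<close> is
    split into its components, each of which contributes \<open>v n\<close> after taking
    expectations.\<close>
  have le: "(norm (\<theta> n \<omega> *v D n \<omega>))\<^sup>2 \<le> ?R \<omega>" for \<omega>
  proof -
    have "(norm (\<theta> n \<omega> *v D n \<omega>))\<^sup>2 \<le> (norm (\<theta> n \<omega>) * norm (D n \<omega>))\<^sup>2"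
      by (intro power_mono norm_matrix_vector_mult_le) auto
    also have "\<dots> = ?R \<omega>"
      by (simp add: power_mult_distrib norm_vec_def L2_set_def sum_distrib_left sum_nonneg)
    finally show ?thesis .
  qed
  have xi: "integrable M (\<lambda>\<omega>. (norm (\<theta> n \<omega> *v D n \<omega>))\<^sup>2)"
    by (rule Bochner_Integration.integrable_bound[OF R(1)]) (use le in \<open>auto intro: order_trans[OF _ abs_ge_self]\<close>)
  have expand: "(norm (S (Suc n) \<omega>))\<^sup>2 = (norm (S n \<omega>))\<^sup>2 + 2 * (S n \<omega> \<bullet> (\<theta> n \<omega> *v D n \<omega>)) + (norm (\<theta> n \<omega> *v D n \<omega>))\<^sup>2" for \<omega>
    unfolding S_Suc power2_norm_eq_inner by (simp add: inner_add_left inner_add_right inner_commute)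
  have "integrable M (\<lambda>\<omega>. (norm (S (Suc n) \<omega>))\<^sup>2)"
    unfolding expand using IH(2) cr(1) xi by auto
  moreover have "expectation (\<lambda>\<omega>. (norm (S (Suc n) \<omega>))\<^sup>2) = expectation (\<lambda>\<omega>. (norm (S n \<omega>))\<^sup>2) + expectation (\<lambda>\<omega>. (norm (\<theta> n \<omega> *v D n \<omega>))\<^sup>2)"
    unfolding expand using IH(2) cr xi by simp
  moreover have "expectation (\<lambda>\<omega>. (norm (\<theta> n \<omega> *v D n \<omega>))\<^sup>2) \<le> expectation ?R"
    by (intro integral_mono xi R le)
  ultimately show ?case
    using meas IH(3) R(2) by (simp add: algebra_simps)
qed

section \<open>Energy estimates for stochastic integrals\<close>

lemma past_subset_sets:
  assumes "brownian_motion M W" shows "past M W t \<subseteq> sets M"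
  using assms unfolding past_def brownian_motion_def by (auto intro!: measurable_sets)

lemma
  assumes "brownian_motion M W"
  shows space_brownian_filtration: "space (brownian_filtration M W t) = space M"
    and sets_brownian_filtration: "sets (brownian_filtration M W t) = sigma_sets (space M) (past M W t \<union> null_sets M)"
proof -
  have "past M W t \<union> null_sets M \<subseteq> sets M" using past_subset_sets[OF assms] by auto
  then have "past M W t \<union> null_sets M \<subseteq> Pow (space M)" using sets.space_closed by blast
  then show "space (brownian_filtration M W t) = space M"
    "sets (brownian_filtration M W t) = sigma_sets (space M) (past M W t \<union> null_sets M)"
    unfolding brownian_filtration_def by auto
qed

lemma subalgebra_brownian_filtration:
  assumes "brownian_motion M W" shows "subalgebra M (brownian_filtration M W t)"
proof -
  have "sigma_sets (space M) (past M W t \<union> null_sets M) \<subseteq> sets M"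
    using past_subset_sets[OF assms] by (intro sets.sigma_sets_subset) auto
  then show ?thesis
    unfolding subalgebra_def space_brownian_filtration[OF assms] sets_brownian_filtration[OF assms] by simp
qed

lemma brownian_filtration_mono:
  assumes "brownian_motion M W" "s \<le> t"
  shows "sets (brownian_filtration M W s) \<subseteq> sets (brownian_filtration M W t)"
proof -
  have "{0..s} \<subseteq> {0..t}" using assms(2) by simp
  then have "past M W s \<subseteq> past M W t" unfolding past_def by blast
  then show ?thesis
    unfolding sets_brownian_filtration[OF assms(1)] by (intro sigma_sets_mono') blast
qed

lemma measurable_brownian_filtration_mono:
  assumes "brownian_motion M W" "s \<le> t" "f \<in> measurable (brownian_filtration M W s) N"
  shows "f \<in> measurable (brownian_filtration M W t) N"
  by (rule measurable_from_subalg[OF _ assms(3)])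
    (simp add: subalgebra_def space_brownian_filtration[OF assms(1)] brownian_filtration_mono[OF assms(1,2)])

lemma brownian_motion_adapted:
  fixes W :: "real \<Rightarrow> 'w \<Rightarrow> real^'m"
  assumes bm: "brownian_motion M W" and "0 \<le> s" "s \<le> t"
  shows "W s \<in> borel_measurable (brownian_filtration M W t)"
proof (rule measurableI)
  fix B :: "(real^'m) set" assume "B \<in> sets borel"
  then have "W s -` B \<inter> space M \<in> past M W t" using assms(2,3) by (auto simp: past_def)
  then show "W s -` B \<inter> space (brownian_filtration M W t) \<in> sets (brownian_filtration M W t)"
    unfolding space_brownian_filtration[OF bm] sets_brownian_filtration[OF bm] by auto
qed simp

lemma (in prob_space) brownian_increment:
  assumes bm: "brownian_motion M W" and st: "0 \<le> s" "s < t"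
  shows "indep_set (sets (brownian_filtration M W s))
      {(\<lambda>\<omega>. W t \<omega> - W s \<omega>) -` B \<inter> space M | B. B \<in> sets borel}"
    and "expectation (\<lambda>\<omega>. (W t \<omega> - W s \<omega>) $ c) = 0"
    and "integrable M (\<lambda>\<omega>. ((W t \<omega> - W s \<omega>) $ c)\<^sup>2)"
    and "expectation (\<lambda>\<omega>. ((W t \<omega> - W s \<omega>) $ c)\<^sup>2) = t - s"
proof -
  have "indep_set (sigma_sets (space M) (past M W s)) {(\<lambda>\<omega>. W t \<omega> - W s \<omega>) -` B \<inter> space M | B. B \<in> sets borel}"
    and D: "distributed M lborel (\<lambda>\<omega>. W t \<omega> $ c - W s \<omega> $ c) (normal_density 0 (sqrt (t - s)))"
    using bm st unfolding brownian_motion_def by blast+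
  then show "indep_set (sets (brownian_filtration M W s))
      {(\<lambda>\<omega>. W t \<omega> - W s \<omega>) -` B \<inter> space M | B. B \<in> sets borel}"
    unfolding sets_brownian_filtration[OF bm] using past_subset_sets[OF bm] by (intro indep_augmented)
  have pos: "0 < sqrt (t - s)" using st by simp
  show E: "expectation (\<lambda>\<omega>. (W t \<omega> - W s \<omega>) $ c) = 0"
    using normal_distributed_expectation[OF pos D] by simp
  show "expectation (\<lambda>\<omega>. ((W t \<omega> - W s \<omega>) $ c)\<^sup>2) = t - s"
    using normal_distributed_variance[OF pos D] E st by simp
  show "integrable M (\<lambda>\<omega>. ((W t \<omega> - W s \<omega>) $ c)\<^sup>2)"
    using integrable_normal_moment[OF pos, of 0 2] distributed_integrable[OF D, of "\<lambda>x. x\<^sup>2"] by simp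
qed

text \<open>Freezing the Brownian motion at time \<open>u\<close> makes the simple integral up to
  \<open>u\<close> a sum over the full partition, whatever the position of \<open>u\<close> in it.
  Intervals beyond \<open>u\<close> contribute zero increments.\<close>

lemma (in prob_space) stopped_brownian_increment:
  assumes bm: "brownian_motion M W" and st: "0 \<le> s" "s < t" and u: "0 \<le> u"
  defines "D \<equiv> \<lambda>\<omega>. W (min u t) \<omega> - W (min u s) \<omega>"
  shows "D \<in> borel_measurable (brownian_filtration M W t)"
    and "indep_set (sets (brownian_filtration M W s)) {D -` B \<inter> space M | B. B \<in> sets borel}"
    and "expectation (\<lambda>\<omega>. D \<omega> $ c) = 0"
    and "integrable M (\<lambda>\<omega>. (D \<omega> $ c)\<^sup>2)"
    and "expectation (\<lambda>\<omega>. (D \<omega> $ c)\<^sup>2) = min u t - min u s"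
proof -
  show "D \<in> borel_measurable (brownian_filtration M W t)"
    unfolding D_def
  proof (rule borel_measurable_diff)
    show "W (min u t) \<in> borel_measurable (brownian_filtration M W t)"
      by (rule brownian_motion_adapted[OF bm]) (use st u in linarith)+
    show "W (min u s) \<in> borel_measurable (brownian_filtration M W t)"
      by (rule brownian_motion_adapted[OF bm]) (use st u in linarith)+
  qed
  have "indep_set (sets (brownian_filtration M W s)) {D -` B \<inter> space M | B. B \<in> sets borel} \<and>
    expectation (\<lambda>\<omega>. D \<omega> $ c) = 0 \<and> integrable M (\<lambda>\<omega>. (D \<omega> $ c)\<^sup>2) \<and>
    expectation (\<lambda>\<omega>. (D \<omega> $ c)\<^sup>2) = min u t - min u s"
  proof (cases "s < u")
    case True
    then have "s < min u t" "min u s = s" using st by auto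
    then show ?thesis
      unfolding D_def using brownian_increment[OF bm st(1) \<open>s < min u t\<close>] by simp
  next
    case False
    then have D0: "D = (\<lambda>_. 0)" and m: "min u t - min u s = 0" using st by (auto simp: D_def)
    have "indep_set (sets (brownian_filtration M W s)) {D -` B \<inter> space M | B. B \<in> sets borel}"
    proof (rule indep_setI)
      show "sets (brownian_filtration M W s) \<subseteq> events"
        using subalgebra_brownian_filtration[OF bm] by (simp add: subalgebra_def)
      show "{D -` B \<inter> space M | B. B \<in> sets borel} \<subseteq> events" by (auto simp: D0)
    next
      fix a b assume a: "a \<in> sets (brownian_filtration M W s)" and "b \<in> {D -` B \<inter> space M | B. B \<in> sets borel}"
      then obtain B where "b = (\<lambda>_. 0) -` B \<inter> space M" unfolding D0 by blast
      \<comment> \<open>A constant generates only the trivial events, which are independent of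
        everything.\<close>
      then have "b = {} \<or> b = space M" by (cases "0 \<in> B") auto
      moreover have "a \<inter> space M = a" using sets.sets_into_space[OF a] space_brownian_filtration[OF bm] by auto
      ultimately show "prob (a \<inter> b) = prob a * prob b" by (auto simp: prob_space)
    qed
    then show ?thesis using m by (simp add: D0)
  qed
  then show "indep_set (sets (brownian_filtration M W s)) {D -` B \<inter> space M | B. B \<in> sets borel}"
    "expectation (\<lambda>\<omega>. D \<omega> $ c) = 0" "integrable M (\<lambda>\<omega>. (D \<omega> $ c)\<^sup>2)"
    "expectation (\<lambda>\<omega>. (D \<omega> $ c)\<^sup>2) = min u t - min u s" by blast+
qed

section \<open>Energy of simple processes and their integrals\<close>

lemma simple_data_less:
  assumes "simple_data M W T n \<tau> \<eta>" "i < j" "j \<le> n"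
  shows "\<tau> i < \<tau> j"
  using assms(2,3)
proof (induction j)
  case (Suc j)
  then have "\<tau> j < \<tau> (Suc j)" using assms(1) by (simp add: simple_data_def)
  then show ?case using Suc by (cases "i = j") auto
qed simp

text \<open>The time integral over \<open>{0..t}\<close> of the squared norm of the simple process:
  the differences of minima are the lengths of the partition intervals cut off at \<open>t\<close>.
  As a finite sum its measurability is immediate.\<close>

definition simple_energy :: "nat \<Rightarrow> (nat \<Rightarrow> real) \<Rightarrow> (nat \<Rightarrow> 'w \<Rightarrow> 'b::real_normed_vector) \<Rightarrow> real \<Rightarrow> 'w \<Rightarrow> real" where
  "simple_energy n \<tau> \<eta> t \<omega> = (\<Sum>k<n. (min t (\<tau> (Suc k)) - min t (\<tau> k)) * (norm (\<eta> k \<omega>))\<^sup>2)"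

lemma nn_integral_simple_process:
  assumes sd: "simple_data M W T n \<tau> \<eta>" and t: "0 \<le> t"
  shows "(\<integral>\<^sup>+ s\<in>{0..t}. ennreal ((norm (simple_process n \<tau> \<eta> s \<omega>))\<^sup>2) \<partial>lborel) = ennreal (simple_energy n \<tau> \<eta> t \<omega>)"
proof -
  have less: "\<tau> i < \<tau> j" if "i < j" "j \<le> n" for i j using simple_data_less[OF sd that] .
  have nonneg: "0 \<le> \<tau> k" if "k \<le> n" for k
    using less[of 0 k] that sd by (cases "k = 0") (auto simp: simple_data_def less_imp_le)
  \<comment> \<open>The partition intervals are disjoint, so at most one summand is nonzero and the
    squared norm of the sum is the sum of the squared norms.\<close>
  have pt: "(norm (simple_process n \<tau> \<eta> s \<omega>))\<^sup>2 = (\<Sum>k<n. indicator {\<tau> k <.. \<tau> (Suc k)} s * (norm (\<eta> k \<omega>))\<^sup>2)" for s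
  proof (cases "\<exists>k<n. s \<in> {\<tau> k <.. \<tau> (Suc k)}")
    case True
    then obtain k where k: "k < n" "s \<in> {\<tau> k <.. \<tau> (Suc k)}" by blast
    have other: "indicator {\<tau> l <.. \<tau> (Suc l)} s = (0::real)" if "l < n" "l \<noteq> k" for l
    proof (cases "l < k")
      case True
      then have "\<tau> (Suc l) \<le> \<tau> k" using less[of "Suc l" k] k by (cases "Suc l = k") auto
      then show ?thesis using k by (auto simp: indicator_def)
    next
      case False
      then have "\<tau> (Suc k) \<le> \<tau> l" using less[of "Suc k" l] that by (cases "Suc k = l") auto
      then show ?thesis using k by (auto simp: indicator_def)
    qed
    have "simple_process n \<tau> \<eta> s \<omega> = \<eta> k \<omega>"
      unfolding simple_process_def using k other
      by (subst sum.remove[of _ k]) (auto intro!: sum.neutral)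
    moreover have "(\<Sum>k<n. indicator {\<tau> k <.. \<tau> (Suc k)} s * (norm (\<eta> k \<omega>))\<^sup>2) = (norm (\<eta> k \<omega>))\<^sup>2"
      using k other by (subst sum.remove[of _ k]) (auto intro!: sum.neutral)
    ultimately show ?thesis by simp
  next
    case False
    then have "indicator {\<tau> k <.. \<tau> (Suc k)} s = (0::real)" if "k < n" for k
      using that by (auto simp: indicator_def)
    then show ?thesis unfolding simple_process_def by simp
  qed
  have "(\<integral>\<^sup>+ s\<in>{0..t}. ennreal ((norm (simple_process n \<tau> \<eta> s \<omega>))\<^sup>2) \<partial>lborel)
      = (\<integral>\<^sup>+ s. (\<Sum>k<n. ennreal ((norm (\<eta> k \<omega>))\<^sup>2) * indicator ({\<tau> k <.. \<tau> (Suc k)} \<inter> {0..t}) s) \<partial>lborel)"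
    unfolding pt
    by (intro nn_integral_cong) (auto simp: indicator_def sum_ennreal[symmetric] simp del: sum_ennreal split: if_splits intro!: sum.cong)
  also have "\<dots> = (\<Sum>k<n. ennreal ((norm (\<eta> k \<omega>))\<^sup>2) * emeasure lborel ({\<tau> k <.. \<tau> (Suc k)} \<inter> {0..t}))"
    by (subst nn_integral_sum) (auto simp: nn_integral_cmult_indicator)
  also have "\<dots> = (\<Sum>k<n. ennreal ((min t (\<tau> (Suc k)) - min t (\<tau> k)) * (norm (\<eta> k \<omega>))\<^sup>2))"
  proof (intro sum.cong refl)
    fix k assume "k \<in> {..<n}"
    then have k: "k < n" "0 \<le> \<tau> k" "\<tau> k < \<tau> (Suc k)" using nonneg less by auto
    have "emeasure lborel ({\<tau> k <.. \<tau> (Suc k)} \<inter> {0..t}) = ennreal (min t (\<tau> (Suc k)) - min t (\<tau> k))"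
    proof (cases "\<tau> k \<le> t")
      case True
      then have "{\<tau> k <.. \<tau> (Suc k)} \<inter> {0..t} = {\<tau> k <.. min t (\<tau> (Suc k))}" using k by auto
      then show ?thesis using True k by simp
    next
      case False
      then have "{\<tau> k <.. \<tau> (Suc k)} \<inter> {0..t} = {}" "min t (\<tau> (Suc k)) - min t (\<tau> k) = 0" using k by auto
      then show ?thesis by (simp only: emeasure_empty) simp
    qed
    then show "ennreal ((norm (\<eta> k \<omega>))\<^sup>2) * emeasure lborel ({\<tau> k <.. \<tau> (Suc k)} \<inter> {0..t}) =
        ennreal ((min t (\<tau> (Suc k)) - min t (\<tau> k)) * (norm (\<eta> k \<omega>))\<^sup>2)"
      using k by (subst mult.commute) (simp add: ennreal_mult'')
  qed
  also have "\<dots> = ennreal (simple_energy n \<tau> \<eta> t \<omega>)"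
  proof -
    have "0 \<le> min t (\<tau> (Suc k)) - min t (\<tau> k)" if "k < n" for k using less[of k "Suc k"] that by (auto simp: min_def)
    then show ?thesis unfolding simple_energy_def by (intro sum_ennreal mult_nonneg_nonneg) auto
  qed
  finally show ?thesis .
qed

text \<open>The integrand is switched off as soon as its energy exceeds \<open>L\<close>. This plays the role of a
  stopping time: the resulting integral obeys the \<open>L\<^sup>2\<close> bound and agrees with the original one
  wherever the energy is at most \<open>L\<close>.\<close>

lemma (in prob_space) simple_integral_energy_estimate:
  fixes W :: "real \<Rightarrow> 'a \<Rightarrow> real^'m" and \<eta> :: "nat \<Rightarrow> 'a \<Rightarrow> real^'m^'d"
  assumes bm: "brownian_motion M W" and sd: "simple_data M W T n \<tau> \<eta>" and t: "0 \<le> t" and L: "0 \<le> L"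
  shows "(\<integral>\<^sup>+ \<omega>. indicator {\<omega>. simple_energy n \<tau> \<eta> t \<omega> \<le> L} \<omega> *
        ennreal ((norm (simple_stochastic_integral W n \<tau> \<eta> t \<omega>))\<^sup>2) \<partial>M)
    \<le> of_nat CARD('m) * (\<integral>\<^sup>+ \<omega>. ennreal (min L (simple_energy n \<tau> \<eta> t \<omega>)) \<partial>M)"
proof -
  let ?F = "\<lambda>k. brownian_filtration M W (\<tau> k)"
  let ?d = "\<lambda>k. min t (\<tau> (Suc k)) - min t (\<tau> k)"
  let ?D = "\<lambda>k \<omega>. W (min t (\<tau> (Suc k))) \<omega> - W (min t (\<tau> k)) \<omega>"
  define Q where "Q m \<omega> = (\<Sum>k<m. ?d k * (norm (\<eta> k \<omega>))\<^sup>2)" for m \<omega>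
  \<comment> \<open>The test already counts the energy of interval \<open>k\<close> itself, so the
    level \<open>L\<close> is never overshot. It is still decidable at time \<open>\<tau> k\<close>,
    since \<open>\<eta> k\<close> is known then and interval lengths are deterministic.\<close>
  define \<theta> where "\<theta> k \<omega> = (if Q (Suc k) \<omega> \<le> L then \<eta> k \<omega> else 0)" for k \<omega>
  define S where "S \<omega> = (\<Sum>k<n. \<theta> k \<omega> *v ?D k \<omega>)" for \<omega>
  have less: "\<tau> i < \<tau> j" if "i < j" "j \<le> n" for i j using simple_data_less[OF sd that] .
  have le: "\<tau> i \<le> \<tau> j" if "i \<le> j" "j \<le> n" for i j using less[of i j] that by (cases "i = j") auto
  have nonneg: "0 \<le> \<tau> k" if "k \<le> n" for k using le[of 0 k] that sd by (auto simp: simple_data_def)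
  have d: "0 \<le> ?d k" if "k < n" for k using less[of k "Suc k"] that by (auto simp: min_def)
  have \<eta>: "\<eta> k \<in> borel_measurable (?F k)" "\<exists>C. \<forall>\<omega>\<in>space M. norm (\<eta> k \<omega>) \<le> C" if "k < n" for k
    using sd that by (auto simp: simple_data_def)
  have \<eta>': "\<eta> l \<in> borel_measurable (?F k)" if "l \<le> k" "k < n" for k l
    using \<eta>(1)[of l] measurable_brownian_filtration_mono[OF bm le[of l k]] that by auto
  have Q: "Q (Suc k) \<in> borel_measurable (?F k)" if "k < n" for k
    unfolding Q_def
  proof (rule borel_measurable_sum)
    fix l assume "l \<in> {..<Suc k}"
    then have [measurable]: "\<eta> l \<in> borel_measurable (?F k)" using \<eta>'[of l k] that by auto
    show "(\<lambda>\<omega>. ?d l * (norm (\<eta> l \<omega>))\<^sup>2) \<in> borel_measurable (?F k)" by measurable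
  qed
  have \<theta>: "\<theta> k \<in> borel_measurable (?F k)" if "k < n" for k
    unfolding \<theta>_def using Q[OF that] \<eta>(1)[OF that] by measurable
  have \<theta>C: "\<exists>C. \<forall>\<omega>\<in>space M. norm (\<theta> k \<omega>) \<le> C" if k: "k < n" for k
  proof -
    obtain C where C: "\<forall>\<omega>\<in>space M. norm (\<eta> k \<omega>) \<le> C" using \<eta>(2)[OF k] by blast
    have "norm (\<theta> k \<omega>) \<le> norm (\<eta> k \<omega>)" for \<omega> by (simp add: \<theta>_def)
    then show ?thesis using C order_trans by blast
  qed
  have sub: "subalgebra M (?F k)" for k by (rule subalgebra_brownian_filtration[OF bm])
  have [measurable]: "\<theta> k \<in> borel_measurable M" "\<eta> k \<in> borel_measurable M" if "k < n" for k
    using measurable_from_subalg[OF sub] \<theta> \<eta>(1) that by blast+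
  have mt: "integrable M (\<lambda>\<omega>. (norm (S \<omega>))\<^sup>2) \<and>
      expectation (\<lambda>\<omega>. (norm (S \<omega>))\<^sup>2) \<le> real CARD('m) * (\<Sum>k<n. ?d k * expectation (\<lambda>\<omega>. (norm (\<theta> k \<omega>))\<^sup>2))"
    unfolding S_def
  proof (rule martingale_transform_second_moment[of n ?F \<theta> ?D ?d, THEN conjunct2])
    show "subalgebra M (?F k)" for k by (rule sub)
    fix k assume k: "k < n"
    show "sets (?F k) \<subseteq> sets (?F (Suc k))" using k by (intro brownian_filtration_mono[OF bm] le) auto
    show "\<theta> k \<in> borel_measurable (?F k)" "\<exists>C. \<forall>\<omega>\<in>space M. norm (\<theta> k \<omega>) \<le> C"
      using \<theta>[OF k] \<theta>C[OF k] by blast+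
    note inc = stopped_brownian_increment[OF bm nonneg[of k] less[of k "Suc k"] t]
    show "?D k \<in> borel_measurable (?F (Suc k))"
      "indep_set (sets (?F k)) {?D k -` B \<inter> space M | B. B \<in> sets borel}"
      using inc(1,2) k by simp_all
    show "expectation (\<lambda>\<omega>. ?D k \<omega> $ c) = 0" "integrable M (\<lambda>\<omega>. (?D k \<omega> $ c)\<^sup>2)"
      "expectation (\<lambda>\<omega>. (?D k \<omega> $ c)\<^sup>2) = ?d k" for c
      using inc(3-5)[of c] k by simp_all
  qed
  have \<theta>2: "integrable M (\<lambda>\<omega>. (norm (\<theta> k \<omega>))\<^sup>2)" if k: "k < n" for k
  proof -
    obtain C where C: "\<forall>\<omega>\<in>space M. norm (\<theta> k \<omega>) \<le> C" using \<theta>C[OF k] by blast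
    show ?thesis
    proof (rule integrable_const_bound[of _ "C\<^sup>2"])
      show "AE \<omega> in M. norm ((norm (\<theta> k \<omega>))\<^sup>2) \<le> C\<^sup>2"
        using C by (auto intro!: power_mono)
      show "(\<lambda>\<omega>. (norm (\<theta> k \<omega>))\<^sup>2) \<in> borel_measurable M" using k by measurable
    qed
  qed
  have Q_eq: "Q n \<omega> = simple_energy n \<tau> \<eta> t \<omega>" for \<omega> by (simp add: Q_def simple_energy_def)
  \<comment> \<open>If interval \<open>m\<close> passes the test, no earlier energy has been dropped
    that matters for the bound and \<open>Q (Suc m)\<close> is at most \<open>L\<close>; if it
    fails, the left side does not change while the right side does not decrease.\<close>
  have bound: "m \<le> n \<Longrightarrow> (\<Sum>k<m. ?d k * (norm (\<theta> k \<omega>))\<^sup>2) \<le> min L (Q m \<omega>)" for m \<omega>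
  proof (induction m)
    case 0
    then show ?case using L by (simp add: Q_def)
  next
    case (Suc m)
    have "(\<Sum>k<m. ?d k * (norm (\<theta> k \<omega>))\<^sup>2) \<le> Q m \<omega>" using Suc by simp
    moreover have "0 \<le> ?d m * (norm (\<eta> m \<omega>))\<^sup>2" using d[of m] Suc.prems by (intro mult_nonneg_nonneg) auto
    moreover have "Q (Suc m) \<omega> = Q m \<omega> + ?d m * (norm (\<eta> m \<omega>))\<^sup>2" by (simp add: Q_def)
    ultimately show ?case using Suc by (auto simp: \<theta>_def[of m])
  qed
  have Q_mono: "Q m \<omega> \<le> Q n \<omega>" if "m \<le> n" for m \<omega>
    unfolding Q_def by (rule sum_mono2) (use that d in auto)
  \<comment> \<open>Energy accumulates monotonically, so a final energy of at most \<open>L\<close>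
    means that the integrand was never switched off.\<close>
  have agree: "simple_stochastic_integral W n \<tau> \<eta> t \<omega> = S \<omega>" if "Q n \<omega> \<le> L" for \<omega>
    unfolding simple_stochastic_integral_def S_def
  proof (intro sum.cong refl)
    fix k assume "k \<in> {..<n}"
    then have "\<theta> k \<omega> = \<eta> k \<omega>" using Q_mono[of "Suc k" \<omega>] that by (simp add: \<theta>_def)
    then show "\<eta> k \<omega> *v ?D k \<omega> = \<theta> k \<omega> *v ?D k \<omega>" by simp
  qed
  have "(\<integral>\<^sup>+ \<omega>. indicator {\<omega>. simple_energy n \<tau> \<eta> t \<omega> \<le> L} \<omega> *
        ennreal ((norm (simple_stochastic_integral W n \<tau> \<eta> t \<omega>))\<^sup>2) \<partial>M) \<le> (\<integral>\<^sup>+ \<omega>. ennreal ((norm (S \<omega>))\<^sup>2) \<partial>M)"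
    using agree by (intro nn_integral_mono) (auto simp: indicator_def Q_eq)
  also have "\<dots> = ennreal (expectation (\<lambda>\<omega>. (norm (S \<omega>))\<^sup>2))"
    using mt by (intro nn_integral_eq_integral) auto
  also have "\<dots> \<le> ennreal (real CARD('m) * expectation (\<lambda>\<omega>. \<Sum>k<n. ?d k * (norm (\<theta> k \<omega>))\<^sup>2))"
    using mt \<theta>2 by (intro ennreal_leI) (simp add: Bochner_Integration.integral_sum)
  also have "\<dots> = of_nat CARD('m) * (\<integral>\<^sup>+ \<omega>. ennreal (\<Sum>k<n. ?d k * (norm (\<theta> k \<omega>))\<^sup>2) \<partial>M)"
  proof -
    have "0 \<le> (\<Sum>k<n. ?d k * (norm (\<theta> k \<omega>))\<^sup>2)" for \<omega> using d by (intro sum_nonneg mult_nonneg_nonneg) auto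
    moreover have "integrable M (\<lambda>\<omega>. \<Sum>k<n. ?d k * (norm (\<theta> k \<omega>))\<^sup>2)" using \<theta>2 by auto
    ultimately show ?thesis
      by (subst nn_integral_eq_integral) (auto simp: ennreal_mult' ennreal_of_nat_eq_real_of_nat)
  qed
  also have "\<dots> \<le> of_nat CARD('m) * (\<integral>\<^sup>+ \<omega>. ennreal (min L (simple_energy n \<tau> \<eta> t \<omega>)) \<partial>M)"
    using bound[of n] by (intro mult_left_mono nn_integral_mono ennreal_leI) (auto simp: Q_eq)
  finally show ?thesis .
qed

section \<open>Passage from simple processes to Ito integrals\<close>

lemma vanishes_in_probability_subseq:
  assumes "vanishes_in_probability M Z" "strict_mono r"
  shows "vanishes_in_probability M (\<lambda>j. Z (r j))"
  using assms LIMSEQ_subseq_LIMSEQ[OF _ assms(2)] unfolding vanishes_in_probability_def comp_def by blast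

text \<open>Truncation at 1 turns convergence in probability of extended-real variables into
  convergence in \<open>L^1\<close>, from which an almost surely convergent subsequence can be
  extracted. Truncation does not affect convergence to 0.\<close>

lemma (in prob_space) vanishes_in_probability_AE_subseq:
  assumes Z: "vanishes_in_probability M Z"
  shows "\<exists>r. strict_mono r \<and> (AE \<omega> in M. (\<lambda>j. Z (r j) \<omega>) \<longlonglongrightarrow> 0)"
proof -
  define u where "u j \<omega> = enn2real (min 1 (Z j \<omega>))" for j \<omega>
  have [measurable]: "Z j \<in> borel_measurable M" for j using Z by (simp add: vanishes_in_probability_def)
  have u: "ennreal (u j \<omega>) = min 1 (Z j \<omega>)" for j \<omega>
    unfolding u_def by (intro ennreal_enn2real) (simp add: min_less_iff_disj)
  have u01: "0 \<le> u j \<omega>" "u j \<omega> \<le> 1" for j \<omega>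
  proof -
    show "0 \<le> u j \<omega>" by (simp add: u_def)
    have "ennreal (u j \<omega>) \<le> ennreal 1" unfolding u by simp
    then show "u j \<omega> \<le> 1" by (subst (asm) ennreal_le_iff) auto
  qed
  have [measurable]: "u j \<in> borel_measurable M" for j unfolding u_def by measurable
  have int: "integrable M (u j)" for j
    by (rule integrable_const_bound[of _ 1]) (use u01 in auto)
  have "(\<lambda>j. expectation (u j)) \<longlonglongrightarrow> 0"
  proof (rule LIMSEQ_I)
    fix e :: real assume "0 < e"
    \<comment> \<open>Off this event \<open>u j\<close> is at most \<open>e / 2\<close>; on it the
      bound 1 is used, at the cost of its probability.\<close>
    let ?B = "\<lambda>j. {\<omega>\<in>space M. ennreal (e / 2) < Z j \<omega>}"
    have "(\<lambda>j. prob (?B j)) \<longlonglongrightarrow> 0"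
      using Z \<open>0 < e\<close> unfolding vanishes_in_probability_def by simp
    from order_tendstoD(2)[OF this, of "e / 2"] obtain j0 where j0: "\<And>j. j \<ge> j0 \<Longrightarrow> prob (?B j) < e / 2"
      using \<open>0 < e\<close> unfolding eventually_sequentially by auto
    have "norm (expectation (u j) - 0) < e" if "j \<ge> j0" for j
    proof -
      have "expectation (u j) \<le> expectation (\<lambda>\<omega>. e / 2 + indicator (?B j) \<omega>)"
      proof (rule integral_mono[OF int])
        show "integrable M (\<lambda>\<omega>. e / 2 + indicator (?B j) \<omega> :: real)"
          by (intro Bochner_Integration.integrable_add integrable_real_indicator) (auto simp: emeasure_eq_measure)
        fix \<omega> assume "\<omega> \<in> space M"
        show "u j \<omega> \<le> e / 2 + indicator (?B j) \<omega>"
        proof (cases "\<omega> \<in> ?B j")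
          case True
          then show ?thesis using u01(2)[of j \<omega>] \<open>0 < e\<close> by simp
        next
          case False
          then have "ennreal (u j \<omega>) \<le> ennreal (e / 2)"
            using \<open>\<omega> \<in> space M\<close> unfolding u by (auto simp: not_less min.coboundedI2)
          then show ?thesis using False \<open>0 < e\<close> by (subst (asm) ennreal_le_iff) auto
        qed
      qed
      also have "\<dots> = e / 2 + prob (?B j)"
        by (subst Bochner_Integration.integral_add) (auto simp: prob_space emeasure_eq_measure)
      finally have "expectation (u j) \<le> e / 2 + prob (?B j)" .
      moreover have "0 \<le> expectation (u j)" using u01(1) by (intro Bochner_Integration.integral_nonneg) auto
      ultimately show ?thesis using j0[OF that] by simp
    qed
    then show "\<exists>j0. \<forall>j\<ge>j0. norm (expectation (u j) - 0) < e" by blast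
  qed
  then have "(\<lambda>j. expectation (\<lambda>\<omega>. norm (u j \<omega>))) \<longlonglongrightarrow> 0" using u01 by simp
  from tendsto_L1_AE_subseq[OF int this] obtain r where r: "strict_mono r" "AE \<omega> in M. (\<lambda>j. u (r j) \<omega>) \<longlonglongrightarrow> 0"
    by blast
  have "AE \<omega> in M. (\<lambda>j. Z (r j) \<omega>) \<longlonglongrightarrow> 0"
    using r(2)
  proof eventually_elim
    fix \<omega> assume "(\<lambda>j. u (r j) \<omega>) \<longlonglongrightarrow> 0"
    then have lim: "(\<lambda>j. min 1 (Z (r j) \<omega>)) \<longlonglongrightarrow> 0"
      using tendsto_ennrealI[of "\<lambda>j. u (r j) \<omega>" 0 sequentially] unfolding u by simp
    then have "\<forall>\<^sub>F j in sequentially. min 1 (Z (r j) \<omega>) < 1" by (rule order_tendstoD) simp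
    then have "\<forall>\<^sub>F j in sequentially. min 1 (Z (r j) \<omega>) = Z (r j) \<omega>"
      by eventually_elim (auto simp: min_def split: if_splits)
    from tendsto_cong[OF this] lim show "(\<lambda>j. Z (r j) \<omega>) \<longlonglongrightarrow> 0" by blast
  qed
  with r(1) show ?thesis by blast
qed

lemma borel_measurable_indicator_scaleR_continuous_on:
  fixes f :: "real \<Rightarrow> 'b::real_normed_vector"
  assumes "continuous_on {0..T} f" "t \<le> T"
  shows "(\<lambda>s. indicator {0..t} s *\<^sub>R f s) \<in> borel_measurable borel"
  using assms by (intro borel_measurable_continuous_on_indicator continuous_on_subset[OF assms(1)]) auto

text \<open>From \<open>(norm a)^2 \<le> 2 (norm b)^2 + 2 (norm (a - b))^2\<close> at each time. The
  energy of \<open>H\<close> is needed only up to \<open>t\<close>, while the approximation error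
  may be taken over the whole horizon.\<close>

lemma simple_energy_le:
  fixes H :: "real \<Rightarrow> 'w \<Rightarrow> real^'m^'d"
  assumes sd: "simple_data M W T n \<tau> \<eta>" and t: "t \<in> {0..T}" and cont: "continuous_on {0..T} (\<lambda>s. H s \<omega>)"
  shows "ennreal (simple_energy n \<tau> \<eta> t \<omega>) \<le>
    2 * (\<integral>\<^sup>+ s\<in>{0..t}. ennreal ((norm (H s \<omega>))\<^sup>2) \<partial>lborel) +
    2 * (\<integral>\<^sup>+ s\<in>{0..T}. ennreal ((norm (simple_process n \<tau> \<eta> s \<omega> - H s \<omega>))\<^sup>2) \<partial>lborel)"
proof -
  let ?S = "\<lambda>s. simple_process n \<tau> \<eta> s \<omega>"
  have t0: "0 \<le> t" using t by simp
  have S[measurable]: "?S \<in> borel_measurable borel" unfolding simple_process_def by measurable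
  \<comment> \<open>Continuity makes \<open>H\<close> measurable in time only on
    \<open>{0..T}\<close>; cutting it off to 0 elsewhere gives a Borel function with the same
    integrals.\<close>
  define h where "h s = indicator {0..T} s *\<^sub>R H s \<omega>" for s
  have h_eq: "h s = H s \<omega>" if "s \<in> {0..T}" for s using that by (simp add: h_def)
  have [measurable]: "h \<in> borel_measurable borel"
    unfolding h_def[abs_def] by (rule borel_measurable_indicator_scaleR_continuous_on[OF cont]) simp
  have sq: "(norm a)\<^sup>2 \<le> 2 * (norm b)\<^sup>2 + 2 * (norm (a - b))\<^sup>2" for a b :: "real^'m^'d"
  proof -
    have "norm a \<le> norm b + norm (a - b)" using norm_triangle_ineq[of b "a - b"] by simp
    then have "(norm a)\<^sup>2 \<le> (norm b + norm (a - b))\<^sup>2" by (intro power_mono) auto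
    also have "\<dots> \<le> 2 * (norm b)\<^sup>2 + 2 * (norm (a - b))\<^sup>2"
      using sum_squares_bound[of "norm b" "norm (a - b)"] by (simp add: power2_sum)
    finally show ?thesis .
  qed
  have "ennreal (simple_energy n \<tau> \<eta> t \<omega>) = (\<integral>\<^sup>+ s\<in>{0..t}. ennreal ((norm (?S s))\<^sup>2) \<partial>lborel)"
    using nn_integral_simple_process[OF sd t0, of \<omega>] by simp
  also have "\<dots> \<le> (\<integral>\<^sup>+ s. 2 * (ennreal ((norm (h s))\<^sup>2) * indicator {0..t} s) +
      2 * (ennreal ((norm (?S s - h s))\<^sup>2) * indicator {0..T} s) \<partial>lborel)"
  proof (rule nn_integral_mono)
    fix s
    have "ennreal ((norm (?S s))\<^sup>2) \<le> ennreal (2 * (norm (H s \<omega>))\<^sup>2 + 2 * (norm (?S s - H s \<omega>))\<^sup>2)"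
      by (intro ennreal_leI sq)
    also have "\<dots> = 2 * ennreal ((norm (H s \<omega>))\<^sup>2) + 2 * ennreal ((norm (?S s - H s \<omega>))\<^sup>2)"
      by (simp add: ennreal_mult'')
    finally show "ennreal ((norm (?S s))\<^sup>2) * indicator {0..t} s \<le>
      2 * (ennreal ((norm (h s))\<^sup>2) * indicator {0..t} s) +
      2 * (ennreal ((norm (?S s - h s))\<^sup>2) * indicator {0..T} s)"
      using t h_eq[of s] by (cases "s \<in> {0..t}") auto
  qed
  also have "\<dots> = 2 * (\<integral>\<^sup>+ s\<in>{0..t}. ennreal ((norm (h s))\<^sup>2) \<partial>lborel) +
      2 * (\<integral>\<^sup>+ s\<in>{0..T}. ennreal ((norm (?S s - h s))\<^sup>2) \<partial>lborel)"
    by (subst nn_integral_add) (auto simp: nn_integral_cmult)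
  also have "(\<integral>\<^sup>+ s\<in>{0..t}. ennreal ((norm (h s))\<^sup>2) \<partial>lborel) =
      (\<integral>\<^sup>+ s\<in>{0..t}. ennreal ((norm (H s \<omega>))\<^sup>2) \<partial>lborel)"
    using t h_eq by (intro nn_integral_cong) (auto simp: indicator_def)
  also have "(\<integral>\<^sup>+ s\<in>{0..T}. ennreal ((norm (?S s - h s))\<^sup>2) \<partial>lborel) =
      (\<integral>\<^sup>+ s\<in>{0..T}. ennreal ((norm (?S s - H s \<omega>))\<^sup>2) \<partial>lborel)"
    using h_eq by (intro nn_integral_cong) (auto simp: indicator_def)
  finally show ?thesis .
qed

lemma borel_measurable_running_energy:
  fixes Y :: "real \<Rightarrow> 'w \<Rightarrow> 'b::{second_countable_topology, real_normed_vector}"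
  assumes "0 \<le> T" "\<And>t. t \<in> {0..T} \<Longrightarrow> Y t \<in> borel_measurable M"
    "\<And>\<omega>. \<omega> \<in> space M \<Longrightarrow> continuous_on {0..T} (\<lambda>t. Y t \<omega>)" and t: "t \<le> T"
  shows "(\<lambda>\<omega>. \<integral>\<^sup>+ s\<in>{0..t}. ennreal ((norm (Y s \<omega>))\<^sup>2) \<partial>lborel) \<in> borel_measurable M"
proof -
  have [measurable]: "(\<lambda>(s, \<omega>). indicator {0..T} s *\<^sub>R Y s \<omega>) \<in> borel_measurable (borel \<Otimes>\<^sub>M M)"
    using assms(1-3) by (rule borel_measurable_pair_interval)
  have "(\<lambda>\<omega>. \<integral>\<^sup>+ s. ennreal ((norm ((\<lambda>(s, \<omega>). indicator {0..T} s *\<^sub>R Y s \<omega>) (s, \<omega>)))\<^sup>2) * indicator {0..t} s \<partial>lborel)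
      \<in> borel_measurable M"
    by measurable
  moreover have "(\<lambda>\<omega>. \<integral>\<^sup>+ s. ennreal ((norm ((\<lambda>(s, \<omega>). indicator {0..T} s *\<^sub>R Y s \<omega>) (s, \<omega>)))\<^sup>2) * indicator {0..t} s \<partial>lborel) =
    (\<lambda>\<omega>. \<integral>\<^sup>+ s\<in>{0..t}. ennreal ((norm (Y s \<omega>))\<^sup>2) \<partial>lborel)"
    using t by (intro ext nn_integral_cong) (auto simp: indicator_def)
  ultimately show ?thesis by simp
qed

text \<open>The estimate for simple integrals at level \<open>4 * L\<close> passes to the limit, by
  Fatou's lemma on the left and dominated convergence on the right. The minimum keeps the right side
  finite without any moment of \<open>H\<close>, and its dependence on \<open>V\<close> is what
  Gronwall's inequality later exploits.\<close>

lemma (in prob_space) ito_energy_estimate: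
  fixes W :: "real \<Rightarrow> 'a \<Rightarrow> real^'m" and H :: "real \<Rightarrow> 'a \<Rightarrow> real^'m^'d"
  assumes bm: "brownian_motion M W" and ito: "is_ito_integral M W T H I"
    and H: "\<And>t. t \<in> {0..T} \<Longrightarrow> H t \<in> borel_measurable M"
      "\<And>\<omega>. \<omega> \<in> space M \<Longrightarrow> continuous_on {0..T} (\<lambda>t. H t \<omega>)"
    and t: "t \<in> {0..T}" and L: "0 < L"
  defines "V \<equiv> \<lambda>\<omega>. \<integral>\<^sup>+ s\<in>{0..t}. ennreal ((norm (H s \<omega>))\<^sup>2) \<partial>lborel"
  shows "(\<integral>\<^sup>+ \<omega>. indicator {\<omega>. V \<omega> \<le> ennreal L} \<omega> * ennreal ((norm (I t \<omega>))\<^sup>2) \<partial>M)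
    \<le> of_nat CARD('m) * (\<integral>\<^sup>+ \<omega>. min (ennreal (4 * L)) (2 * V \<omega>) \<partial>M)"
proof -
  have T: "0 \<le> T" "0 \<le> t" "t \<le> T" using t by auto
  obtain n \<tau> \<eta> where sd: "\<And>j. simple_data M W T (n j) (\<tau> j) (\<eta> j)"
    and Z: "vanishes_in_probability M
          (\<lambda>j \<omega>. \<integral>\<^sup>+ s\<in>{0..T}. ennreal ((norm (simple_process (n j) (\<tau> j) (\<eta> j) s \<omega> - H s \<omega>))\<^sup>2) \<partial>lborel)"
    and Y: "vanishes_in_probability M
          (\<lambda>j \<omega>. SUP t\<in>{0..T}. ennreal (norm (simple_stochastic_integral W (n j) (\<tau> j) (\<eta> j) t \<omega> - I t \<omega>)))"
    using ito unfolding is_ito_integral_def by blast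
  obtain r1 where r1: "strict_mono r1" and AE1: "AE \<omega> in M. (\<lambda>j. \<integral>\<^sup>+ s\<in>{0..T}. ennreal ((norm (simple_process (n (r1 j)) (\<tau> (r1 j)) (\<eta> (r1 j)) s \<omega> - H s \<omega>))\<^sup>2) \<partial>lborel) \<longlonglongrightarrow> 0"
    using vanishes_in_probability_AE_subseq[OF Z] by blast
  obtain r2 where r2: "strict_mono r2" and AE2: "AE \<omega> in M. (\<lambda>j. SUP t\<in>{0..T}. ennreal (norm (simple_stochastic_integral W (n (r1 (r2 j))) (\<tau> (r1 (r2 j))) (\<eta> (r1 (r2 j))) t \<omega> - I t \<omega>))) \<longlonglongrightarrow> 0"
    using vanishes_in_probability_AE_subseq[OF vanishes_in_probability_subseq[OF Y r1]] by blast
  \<comment> \<open>A subsequence of a subsequence, along which the energy error and the integral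
    error both vanish almost surely.\<close>
  define r where "r j = r1 (r2 j)" for j
  define E where "E j \<omega> = simple_energy (n (r j)) (\<tau> (r j)) (\<eta> (r j)) t \<omega>" for j \<omega>
  define J where "J j \<omega> = simple_stochastic_integral W (n (r j)) (\<tau> (r j)) (\<eta> (r j)) t \<omega>" for j \<omega>
  define \<delta> where "\<delta> j \<omega> = (\<integral>\<^sup>+ s\<in>{0..T}. ennreal ((norm (simple_process (n (r j)) (\<tau> (r j)) (\<eta> (r j)) s \<omega> - H s \<omega>))\<^sup>2) \<partial>lborel)" for j \<omega>
  have AE\<delta>: "AE \<omega> in M. (\<lambda>j. \<delta> j \<omega>) \<longlonglongrightarrow> 0"
    using AE1
  proof eventually_elim
    fix \<omega> assume a: "(\<lambda>j. \<integral>\<^sup>+ s\<in>{0..T}. ennreal ((norm (simple_process (n (r1 j)) (\<tau> (r1 j)) (\<eta> (r1 j)) s \<omega> - H s \<omega>))\<^sup>2) \<partial>lborel) \<longlonglongrightarrow> 0"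
    show "(\<lambda>j. \<delta> j \<omega>) \<longlonglongrightarrow> 0"
      using LIMSEQ_subseq_LIMSEQ[OF a r2] unfolding \<delta>_def r_def comp_def .
  qed
  have AEJ: "AE \<omega> in M. (\<lambda>j. J j \<omega>) \<longlonglongrightarrow> I t \<omega>"
    using AE2
  proof eventually_elim
    fix \<omega> assume a: "(\<lambda>j. SUP t\<in>{0..T}. ennreal (norm (simple_stochastic_integral W (n (r1 (r2 j))) (\<tau> (r1 (r2 j))) (\<eta> (r1 (r2 j))) t \<omega> - I t \<omega>))) \<longlonglongrightarrow> 0"
    have "(\<lambda>j. ennreal (norm (J j \<omega> - I t \<omega>))) \<longlonglongrightarrow> 0"
    proof (rule tendsto_sandwich[OF _ _ tendsto_const a])
      show "\<forall>\<^sub>F j in sequentially. ennreal (norm (J j \<omega> - I t \<omega>)) \<le> (SUP t\<in>{0..T}. ennreal (norm (simple_stochastic_integral W (n (r1 (r2 j))) (\<tau> (r1 (r2 j))) (\<eta> (r1 (r2 j))) t \<omega> - I t \<omega>)))"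
        unfolding J_def r_def by (intro always_eventually allI SUP_upper t)
    qed simp
    then have "(\<lambda>j. norm (J j \<omega> - I t \<omega>)) \<longlonglongrightarrow> 0"
      by (subst (asm) ennreal_0[symmetric], subst (asm) tendsto_ennreal_iff) auto
    then show "(\<lambda>j. J j \<omega>) \<longlonglongrightarrow> I t \<omega>" by (simp add: LIM_zero_iff tendsto_norm_zero_iff)
  qed
  have Emeas[measurable]: "E j \<in> borel_measurable M" for j
    unfolding E_def simple_energy_def
  proof (rule borel_measurable_sum)
    fix k assume "k \<in> {..<n (r j)}"
    then have [measurable]: "\<eta> (r j) k \<in> borel_measurable M"
      using sd[of "r j"] measurable_from_subalg[OF subalgebra_brownian_filtration[OF bm]] unfolding simple_data_def by blast
    show "(\<lambda>\<omega>. (min t (\<tau> (r j) (Suc k)) - min t (\<tau> (r j) k)) * (norm (\<eta> (r j) k \<omega>))\<^sup>2) \<in> borel_measurable M" by measurable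
  qed
  have Jmeas[measurable]: "J j \<in> borel_measurable M" for j
    unfolding J_def simple_stochastic_integral_def
  proof (rule borel_measurable_sum)
    fix k assume k: "k \<in> {..<n (r j)}"
    then have [measurable]: "\<eta> (r j) k \<in> borel_measurable M"
      using sd[of "r j"] measurable_from_subalg[OF subalgebra_brownian_filtration[OF bm]] unfolding simple_data_def by blast
    have "0 \<le> \<tau> (r j) i" if "i \<le> n (r j)" for i
      using simple_data_less[OF sd[of "r j"], of 0 i] sd[of "r j"] that by (cases "i = 0") (auto simp: simple_data_def)
    then have [measurable]: "W (min t (\<tau> (r j) (Suc k))) \<in> borel_measurable M" "W (min t (\<tau> (r j) k)) \<in> borel_measurable M"
      using bm T k unfolding brownian_motion_def by auto
    show "(\<lambda>\<omega>. \<eta> (r j) k \<omega> *v (W (min t (\<tau> (r j) (Suc k))) \<omega> - W (min t (\<tau> (r j) k)) \<omega>)) \<in> borel_measurable M" by measurable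
  qed
  have V[measurable]: "V \<in> borel_measurable M"
    unfolding V_def using T H by (intro borel_measurable_running_energy)
  have \<delta>[measurable]: "\<delta> j \<in> borel_measurable M" for j
    using Z unfolding vanishes_in_probability_def \<delta>_def by blast
  have E_le: "ennreal (E j \<omega>) \<le> 2 * V \<omega> + 2 * \<delta> j \<omega>" if "\<omega> \<in> space M" for j \<omega>
    unfolding E_def V_def \<delta>_def by (rule simple_energy_le[OF sd t, of H \<omega>, OF H(2)[OF that]])
  let ?A = "\<lambda>j \<omega>. indicator {\<omega>. E j \<omega> \<le> 4 * L} \<omega> * ennreal ((norm (J j \<omega>))\<^sup>2)"
  let ?B = "\<lambda>j \<omega>. min (ennreal (4 * L)) (2 * V \<omega> + 2 * \<delta> j \<omega>)"
  have "(\<integral>\<^sup>+ \<omega>. indicator {\<omega>. V \<omega> \<le> ennreal L} \<omega> * ennreal ((norm (I t \<omega>))\<^sup>2) \<partial>M) \<le> (\<integral>\<^sup>+ \<omega>. liminf (\<lambda>j. ?A j \<omega>) \<partial>M)"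
  proof (rule nn_integral_mono_AE)
    show "AE \<omega> in M. indicator {\<omega>. V \<omega> \<le> ennreal L} \<omega> * ennreal ((norm (I t \<omega>))\<^sup>2) \<le> liminf (\<lambda>j. ?A j \<omega>)"
      using AE\<delta> AEJ AE_space
    proof eventually_elim
      fix \<omega> assume \<omega>: "(\<lambda>j. \<delta> j \<omega>) \<longlonglongrightarrow> 0" "(\<lambda>j. J j \<omega>) \<longlonglongrightarrow> I t \<omega>" "\<omega> \<in> space M"
      show "indicator {\<omega>. V \<omega> \<le> ennreal L} \<omega> * ennreal ((norm (I t \<omega>))\<^sup>2) \<le> liminf (\<lambda>j. ?A j \<omega>)"
      proof (cases "V \<omega> \<le> ennreal L")
        case True
        have "\<forall>\<^sub>F j in sequentially. \<delta> j \<omega> < ennreal L"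
          using \<omega>(1) by (rule order_tendstoD) (simp add: L)
        then have "\<forall>\<^sub>F j in sequentially. ennreal ((norm (J j \<omega>))\<^sup>2) = ?A j \<omega>"
        proof eventually_elim
          fix j assume "\<delta> j \<omega> < ennreal L"
          \<comment> \<open>Origin of \<open>4 * L\<close>: on the event in question both
            \<open>V\<close> and the error are at most \<open>L\<close>, each entering with factor
            2. Hence the simple estimate at level \<open>4 * L\<close> eventually sees this
            \<omega>.\<close>
          then have "2 * V \<omega> + 2 * \<delta> j \<omega> \<le> 2 * ennreal L + 2 * ennreal L"
            using True by (intro add_mono mult_left_mono) auto
          also have "\<dots> = ennreal (4 * L)"
          proof -
            have "2 * ennreal L = ennreal (2 * L)" using L by (simp add: ennreal_mult'')
            then show ?thesis using L by (simp add: ennreal_plus[symmetric] del: ennreal_plus)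
          qed
          finally have "ennreal (E j \<omega>) \<le> ennreal (4 * L)" using E_le[OF \<omega>(3), of j] by (rule order_trans[rotated])
          then have "E j \<omega> \<le> 4 * L" using L by (subst (asm) ennreal_le_iff) auto
          then show "ennreal ((norm (J j \<omega>))\<^sup>2) = ?A j \<omega>" by simp
        qed
        moreover have "(\<lambda>j. ennreal ((norm (J j \<omega>))\<^sup>2)) \<longlonglongrightarrow> ennreal ((norm (I t \<omega>))\<^sup>2)"
          by (intro tendsto_intros \<omega>(2))
        ultimately have "(\<lambda>j. ?A j \<omega>) \<longlonglongrightarrow> ennreal ((norm (I t \<omega>))\<^sup>2)"
          by (rule Lim_transform_eventually[rotated])
        then have "liminf (\<lambda>j. ?A j \<omega>) = ennreal ((norm (I t \<omega>))\<^sup>2)" by (intro lim_imp_Liminf) auto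
        then show ?thesis by (simp add: indicator_def)
      qed simp
    qed
  qed
  also have "\<dots> \<le> liminf (\<lambda>j. \<integral>\<^sup>+ \<omega>. ?A j \<omega> \<partial>M)"
    by (rule nn_integral_liminf) measurable
  also have "\<dots> \<le> liminf (\<lambda>j. of_nat CARD('m) * (\<integral>\<^sup>+ \<omega>. ?B j \<omega> \<partial>M))"
  proof (intro Liminf_mono always_eventually allI)
    fix j
    have "(\<integral>\<^sup>+ \<omega>. ?A j \<omega> \<partial>M) \<le> of_nat CARD('m) * (\<integral>\<^sup>+ \<omega>. ennreal (min (4 * L) (E j \<omega>)) \<partial>M)"
      unfolding E_def J_def using L T by (intro simple_integral_energy_estimate[OF bm sd]) auto
    also have "\<dots> \<le> of_nat CARD('m) * (\<integral>\<^sup>+ \<omega>. ?B j \<omega> \<partial>M)"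
    proof (intro mult_left_mono nn_integral_mono)
      fix \<omega> assume "\<omega> \<in> space M"
      have "ennreal (min (4 * L) (E j \<omega>)) \<le> ennreal (E j \<omega>)" "ennreal (min (4 * L) (E j \<omega>)) \<le> ennreal (4 * L)"
        by (intro ennreal_leI; simp)+
      then show "ennreal (min (4 * L) (E j \<omega>)) \<le> ?B j \<omega>" using E_le[OF \<open>\<omega> \<in> space M\<close>, of j] by (auto intro: order_trans)
    qed simp
    finally show "(\<integral>\<^sup>+ \<omega>. ?A j \<omega> \<partial>M) \<le> of_nat CARD('m) * (\<integral>\<^sup>+ \<omega>. ?B j \<omega> \<partial>M)" .
  qed
  also have "\<dots> = of_nat CARD('m) * (\<integral>\<^sup>+ \<omega>. min (ennreal (4 * L)) (2 * V \<omega>) \<partial>M)"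
  proof (rule lim_imp_Liminf)
    \<comment> \<open>The constant \<open>4 * L\<close> dominates, and it is integrable for a
      probability measure.\<close>
    have "(\<lambda>j. \<integral>\<^sup>+ \<omega>. ?B j \<omega> \<partial>M) \<longlonglongrightarrow> (\<integral>\<^sup>+ \<omega>. min (ennreal (4 * L)) (2 * V \<omega>) \<partial>M)"
    proof (rule nn_integral_dominated_convergence[where w="\<lambda>_. ennreal (4 * L)"])
      show "AE \<omega> in M. (\<lambda>j. ?B j \<omega>) \<longlonglongrightarrow> min (ennreal (4 * L)) (2 * V \<omega>)"
        using AE\<delta>
      proof eventually_elim
        fix \<omega> assume a: "(\<lambda>j. \<delta> j \<omega>) \<longlonglongrightarrow> 0"
        have "(\<lambda>j. 2 * V \<omega> + 2 * \<delta> j \<omega>) \<longlonglongrightarrow> 2 * V \<omega> + 2 * 0"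
          by (intro tendsto_add tendsto_const ennreal_tendsto_cmult a) auto
        then show "(\<lambda>j. ?B j \<omega>) \<longlonglongrightarrow> min (ennreal (4 * L)) (2 * V \<omega>)"
          by (intro tendsto_min tendsto_const) simp
      qed
    qed (auto simp: emeasure_space_1 ennreal_mult_less_top)
    then show "(\<lambda>j. of_nat CARD('m) * (\<integral>\<^sup>+ \<omega>. ?B j \<omega> \<partial>M)) \<longlonglongrightarrow> of_nat CARD('m) * (\<integral>\<^sup>+ \<omega>. min (ennreal (4 * L)) (2 * V \<omega>) \<partial>M)"
      by (intro ennreal_tendsto_cmult) (auto simp: ennreal_of_nat_eq_real_of_nat)
  qed simp
  finally show ?thesis .
qed

section \<open>Second moments of solutions\<close>

text \<open>The supremum \<open>S\<close> of \<open>m\<close> weighted by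
  \<open>exp (- 2 * c1 * t)\<close> satisfies \<open>S \<le> c0 * T + S / 2\<close>. The bound
  \<open>L\<close> serves only to make \<open>S\<close> finite and does not enter the conclusion.
  Integrals of \<open>m\<close> are compared by monotonicity alone, so no regularity of
  \<open>m\<close> has to be established.\<close>

lemma gronwall_bounded:
  fixes m :: "real \<Rightarrow> real"
  assumes "0 \<le> T" "0 \<le> c0" "0 < c1"
    and m: "\<And>t. t \<in> {0..T} \<Longrightarrow> 0 \<le> m t" "\<And>t. t \<in> {0..T} \<Longrightarrow> m t \<le> L"
    and le: "\<And>t. t \<in> {0..T} \<Longrightarrow> ennreal (m t) \<le> (\<integral>\<^sup>+ s\<in>{0..t}. ennreal (c0 + c1 * m s) \<partial>lborel)"
  shows "m T \<le> 2 * c0 * T * exp (2 * c1 * T)"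
proof -
  define S where "S = (SUP t\<in>{0..T}. exp (- 2 * c1 * t) * m t)"
  have bdd: "bdd_above ((\<lambda>t. exp (- 2 * c1 * t) * m t) ` {0..T})"
  proof (rule bdd_aboveI2)
    fix t assume t: "t \<in> {0..T}"
    have "exp (- 2 * c1 * t) * m t \<le> 1 * m t"
      using t m(1) assms(3) by (intro mult_right_mono) auto
    then show "exp (- 2 * c1 * t) * m t \<le> L" using m(2)[OF t] by simp
  qed
  have S: "exp (- 2 * c1 * t) * m t \<le> S" if "t \<in> {0..T}" for t
    unfolding S_def by (rule cSUP_upper[OF that bdd])
  have S0: "0 \<le> S" using S[of 0] m(1)[of 0] assms(1) by simp
  have mS: "m t \<le> S * exp (2 * c1 * t)" if "t \<in> {0..T}" for t
    using S[OF that] by (simp add: exp_minus field_simps)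
  \<comment> \<open>The rate \<open>2 * c1\<close>, twice the coefficient of the inequality, is what
    turns the integral of \<open>c1 * S * exp (2 * c1 * s)\<close> into a term with factor
    \<open>S / 2\<close>.\<close>
  have "exp (- 2 * c1 * t) * m t \<le> c0 * T + S / 2" if t: "t \<in> {0..T}" for t
  proof -
    have "ennreal (m t) \<le> (\<integral>\<^sup>+ s\<in>{0..t}. ennreal (c0 + c1 * (S * exp (2 * c1 * s))) \<partial>lborel)"
    proof (rule order_trans[OF le[OF t]], rule nn_integral_mono)
      fix s
      show "ennreal (c0 + c1 * m s) * indicator {0..t} s \<le> ennreal (c0 + c1 * (S * exp (2 * c1 * s))) * indicator {0..t} s"
      proof (cases "s \<in> {0..t}")
        case True
        then show ?thesis using mS[of s] t assms(3) by (auto intro!: ennreal_leI)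
      qed simp
    qed
    also have "\<dots> = ennreal ((c0 * t + S / 2 * exp (2 * c1 * t)) - (c0 * 0 + S / 2 * exp (2 * c1 * 0)))"
    proof (rule nn_integral_FTC_Icc)
      show "((\<lambda>s. c0 * s + S / 2 * exp (2 * c1 * s)) has_real_derivative c0 + c1 * (S * exp (2 * c1 * s))) (at s)" for s
        by (auto intro!: derivative_eq_intros)
    qed (use assms S0 t in auto)
    also have "\<dots> \<le> ennreal (c0 * T + S / 2 * exp (2 * c1 * t))"
    proof (rule ennreal_leI)
      have "c0 * t \<le> c0 * T" using t assms(2) by (intro mult_left_mono) auto
      then show "(c0 * t + S / 2 * exp (2 * c1 * t)) - (c0 * 0 + S / 2 * exp (2 * c1 * 0)) \<le> c0 * T + S / 2 * exp (2 * c1 * t)"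
        using S0 by simp
    qed
    finally have "m t \<le> c0 * T + S / 2 * exp (2 * c1 * t)"
      using assms S0 by (subst (asm) ennreal_le_iff) auto
    then have "exp (- 2 * c1 * t) * m t \<le> exp (- 2 * c1 * t) * (c0 * T + S / 2 * exp (2 * c1 * t))"
      by (intro mult_left_mono) auto
    also have "\<dots> = exp (- 2 * c1 * t) * (c0 * T) + S / 2"
      by (simp add: distrib_left exp_minus field_simps)
    also have "exp (- 2 * c1 * t) * (c0 * T) \<le> 1 * (c0 * T)"
      using t assms by (intro mult_right_mono) auto
    finally show ?thesis by simp
  qed
  then have "S \<le> c0 * T + S / 2" unfolding S_def using assms(1) by (intro cSUP_least) auto
  then have "S \<le> 2 * c0 * T" by simp
  then have "S * exp (2 * c1 * T) \<le> 2 * c0 * T * exp (2 * c1 * T)" by (intro mult_right_mono) auto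
  with mS[of T] assms(1) show ?thesis by (auto intro: order_trans)
qed

section \<open>Inequalities for integrals over time\<close>

lemma nn_integral_interval_eq_integral:
  fixes f :: "real \<Rightarrow> real"
  assumes "continuous_on {0..T} f" "\<And>s. s \<in> {0..T} \<Longrightarrow> 0 \<le> f s" "t \<le> T"
  shows "(\<integral>\<^sup>+ s\<in>{0..t}. ennreal (f s) \<partial>lborel) = ennreal (integral {0..t} f)"
    and "0 \<le> integral {0..t} f"
proof -
  have c: "continuous_on {0..t} f" using assms(1,3) by (auto intro: continuous_on_subset)
  have si: "set_integrable lborel {0..t} f" by (rule borel_integrable_atLeastAtMost'[OF c])
  have "(\<integral>\<^sup>+ s\<in>{0..t}. ennreal (f s) \<partial>lborel) = (\<integral>\<^sup>+ s. ennreal (indicator {0..t} s *\<^sub>R f s) \<partial>lborel)"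
    by (intro nn_integral_cong) (auto simp: indicator_def)
  also have "\<dots> = ennreal (LINT s:{0..t}|lborel. f s)"
    using si assms(2,3) unfolding set_integrable_def set_lebesgue_integral_def
    by (intro nn_integral_eq_integral) (auto simp: indicator_def)
  also have "(LINT s:{0..t}|lborel. f s) = integral {0..t} f"
    using set_borel_integral_eq_integral(2)[OF si] .
  finally show "(\<integral>\<^sup>+ s\<in>{0..t}. ennreal (f s) \<partial>lborel) = ennreal (integral {0..t} f)" .
  show "0 \<le> integral {0..t} f"
    using assms(2,3) by (intro integral_nonneg integrable_continuous_interval c) auto
qed

text \<open>Cauchy-Schwarz in time, obtained by integrating
  \<open>2 * x * y \<le> x^2 + y^2\<close>.\<close>

lemma norm_set_integral_power2_le:
  fixes f :: "real \<Rightarrow> 'b::euclidean_space" and h :: "real \<Rightarrow> real"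
  assumes f: "continuous_on {0..t} f" and h: "continuous_on {0..t} h" and t: "0 \<le> t" "t \<le> T" "0 < T"
    and le: "\<And>s. s \<in> {0..t} \<Longrightarrow> (norm (f s))\<^sup>2 \<le> C * h s"
  shows "(norm (LINT s:{0..t}|lborel. f s))\<^sup>2 \<le> T * (C * integral {0..t} h)"
proof -
  have nf: "continuous_on {0..t} (\<lambda>s. norm (f s))" using f by (intro continuous_intros)
  let ?F = "integral {0..t} (\<lambda>s. norm (f s))" and ?G = "C * integral {0..t} h"
  have "norm (LINT s:{0..t}|lborel. f s) = norm (integral {0..t} f)"
    using set_borel_integral_eq_integral(2)[OF borel_integrable_atLeastAtMost'[OF f]] by simp
  also have "\<dots> \<le> ?F"
    by (intro integral_norm_bound_integral integrable_continuous_interval f nf) auto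
  finally have F: "norm (LINT s:{0..t}|lborel. f s) \<le> ?F" .
  have F0: "0 \<le> ?F" by (intro integral_nonneg integrable_continuous_interval nf) auto
  \<comment> \<open>With \<open>F\<close> the integral of \<open>norm (f s)\<close>, the choice
    \<open>x = F / T\<close> and \<open>y = norm (f s)\<close> gives \<open>2 * F^2 / T\<close> on
    the left and at most \<open>F^2 / T\<close> plus the target on the right.\<close>
  have "integral {0..t} (\<lambda>s. 2 * (?F / T) * norm (f s)) \<le> integral {0..t} (\<lambda>s. (?F / T)\<^sup>2 + C * h s)"
  proof (rule integral_le)
    fix s assume s: "s \<in> {0..t}"
    have "2 * (?F / T) * norm (f s) \<le> (?F / T)\<^sup>2 + (norm (f s))\<^sup>2" by (rule sum_squares_bound)
    then show "2 * (?F / T) * norm (f s) \<le> (?F / T)\<^sup>2 + C * h s" using le[OF s] by simp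
  qed (intro integrable_continuous_interval continuous_intros nf h)+
  also have "\<dots> = (?F / T)\<^sup>2 * t + ?G"
    using t by (subst integral_add) (auto intro!: integrable_continuous_interval continuous_intros h)
  also have "(?F / T)\<^sup>2 * t \<le> (?F / T)\<^sup>2 * T" using t by (intro mult_left_mono) auto
  finally have "2 * (?F / T) * ?F \<le> (?F / T)\<^sup>2 * T + ?G" by simp
  then have "?F\<^sup>2 / T \<le> ?G" using t by (simp add: power2_eq_square field_simps)
  then have "?F\<^sup>2 \<le> T * ?G" using t by (simp add: field_simps)
  moreover have "(norm (LINT s:{0..t}|lborel. f s))\<^sup>2 \<le> ?F\<^sup>2" using F by (intro power_mono) auto
  ultimately show ?thesis by linarith
qed

text \<open>\<open>u\<close> is continuous and nondecreasing. If it exceeds \<open>L\<close> at time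
  \<open>t\<close>, it equals \<open>L\<close> at some earlier time \<open>r\<close>; all times up
  to \<open>r\<close> pass the test \<open>u s \<le> L\<close>, and they already contribute
  \<open>L\<close>.\<close>

lemma min_integral_le_truncated_integral:
  fixes h :: "real \<Rightarrow> real"
  assumes h: "continuous_on {0..T} h" "\<And>s. s \<in> {0..T} \<Longrightarrow> 0 \<le> h s" and t: "t \<in> {0..T}" and L: "0 \<le> L"
  defines "u \<equiv> \<lambda>t. integral {0..t} h"
  shows "ennreal (min L (u t)) \<le> (\<integral>\<^sup>+ s\<in>{0..t}. indicator {s. u s \<le> L} s * ennreal (h s) \<partial>lborel)"
proof -
  have mono: "u r \<le> u s" if "r \<le> s" "s \<le> T" for r s
    unfolding u_def using that h 
    by (intro integral_subset_le integrable_continuous_interval continuous_on_subset[OF h(1)]) auto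
  have key: "ennreal (u r) \<le> (\<integral>\<^sup>+ s\<in>{0..t}. indicator {s. u s \<le> L} s * ennreal (h s) \<partial>lborel)"
    if "r \<in> {0..t}" "u r \<le> L" for r
  proof -
    have "ennreal (u r) = (\<integral>\<^sup>+ s\<in>{0..r}. ennreal (h s) \<partial>lborel)"
      unfolding u_def using that t h by (intro nn_integral_interval_eq_integral(1)[symmetric]) auto
    also have "\<dots> \<le> (\<integral>\<^sup>+ s\<in>{0..t}. indicator {s. u s \<le> L} s * ennreal (h s) \<partial>lborel)"
    proof (rule nn_integral_mono)
      fix s
      show "ennreal (h s) * indicator {0..r} s \<le> indicator {s. u s \<le> L} s * ennreal (h s) * indicator {0..t} s"
        using mono[of s r] that t by (auto simp: indicator_def)
    qed
    finally show ?thesis .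
  qed
  show ?thesis
  proof (cases "u t \<le> L")
    case True
    then show ?thesis using key[of t] t by simp
  next
    case False
    have "\<exists>r\<ge>0. r \<le> t \<and> u r = L"
    proof (rule IVT')
      show "u 0 \<le> L" using L by (simp add: u_def)
      show "continuous_on {0..t} u"
        unfolding u_def using t by (intro indefinite_integral_continuous_1 integrable_continuous_interval continuous_on_subset[OF h(1)]) auto
    qed (use False t in auto)
    then obtain r where "r \<in> {0..t}" "u r = L" by auto
    then show ?thesis using key[of r] False by simp
  qed
qed

lemma borel_measurable_time_integral:
  fixes Y :: "real \<Rightarrow> 'w \<Rightarrow> real"
  assumes "0 \<le> T" "\<And>t. t \<in> {0..T} \<Longrightarrow> Y t \<in> borel_measurable M"
    "\<And>\<omega>. \<omega> \<in> space M \<Longrightarrow> continuous_on {0..T} (\<lambda>t. Y t \<omega>)" and t: "t \<le> T"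
  shows "(\<lambda>\<omega>. LINT s:{0..t}|lborel. Y s \<omega>) \<in> borel_measurable M"
proof -
  have [measurable]: "(\<lambda>(s, \<omega>). indicator {0..T} s *\<^sub>R Y s \<omega>) \<in> borel_measurable (borel \<Otimes>\<^sub>M M)"
    using assms(1-3) by (rule borel_measurable_pair_interval)
  have "(\<lambda>\<omega>. LINT s|lborel. indicator {0..t} s *\<^sub>R (\<lambda>(s, \<omega>). indicator {0..T} s *\<^sub>R Y s \<omega>) (s, \<omega>))
      \<in> borel_measurable M"
    by measurable
  moreover have "(\<lambda>\<omega>. LINT s|lborel. indicator {0..t} s *\<^sub>R (\<lambda>(s, \<omega>). indicator {0..T} s *\<^sub>R Y s \<omega>) (s, \<omega>)) =
    (\<lambda>\<omega>. LINT s:{0..t}|lborel. Y s \<omega>)"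
    unfolding set_lebesgue_integral_def
    using t by (intro ext Bochner_Integration.integral_cong) (auto simp: indicator_def)
  ultimately show ?thesis by simp
qed

section \<open>The localised moment bound\<close>

lemma norm_add3_power2_le:
  fixes a b c :: "'b::real_normed_vector"
  shows "(norm (a + b + c))\<^sup>2 \<le> 3 * (norm a)\<^sup>2 + 3 * (norm b)\<^sup>2 + 3 * (norm c)\<^sup>2"
proof -
  have "norm (a + b + c) \<le> norm a + norm b + norm c"
    using norm_triangle_ineq[of "a + b" c] norm_triangle_ineq[of a b] by linarith
  then have "(norm (a + b + c))\<^sup>2 \<le> (norm a + norm b + norm c)\<^sup>2" by (intro power_mono) auto
  also have "\<dots> \<le> 3 * (norm a)\<^sup>2 + 3 * (norm b)\<^sup>2 + 3 * (norm c)\<^sup>2"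
    using sum_squares_bound[of "norm a" "norm b"] sum_squares_bound[of "norm a" "norm c"]
      sum_squares_bound[of "norm b" "norm c"]
    by (simp add: power2_eq_square algebra_simps)
  finally show ?thesis .
qed

text \<open>No moments of \<open>X\<close> are known beforehand, so every estimate is localised to the event that the
  accumulated energy \<open>u t\<close> is at most \<open>L\<close>. Since \<open>min L (u t)\<close> is bounded by the integral of
  \<open>u'\<close> over the times at which \<open>u \<le> L\<close>, Gronwall's inequality for the expectation of
  \<open>min L (u t)\<close> gives a bound that does not depend on \<open>L\<close>.\<close>

lemma (in prob_space) sde_second_moments:
  fixes W :: "real \<Rightarrow> 'a \<Rightarrow> real^'m" and H :: "real \<Rightarrow> 'a \<Rightarrow> real^'m^'d" and X :: "real \<Rightarrow> 'a \<Rightarrow> real^'d"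
  assumes T: "0 < T" and bm: "brownian_motion M W" and ito: "is_ito_integral M W T H I"
    and X: "\<And>t. t \<in> {0..T} \<Longrightarrow> X t \<in> borel_measurable M"
      "\<And>\<omega>. \<omega> \<in> space M \<Longrightarrow> continuous_on {0..T} (\<lambda>t. X t \<omega>)"
    and H: "\<And>t. t \<in> {0..T} \<Longrightarrow> H t \<in> borel_measurable M"
      "\<And>\<omega>. \<omega> \<in> space M \<Longrightarrow> continuous_on {0..T} (\<lambda>t. H t \<omega>)"
    and \<beta>: "\<And>\<omega>. \<omega> \<in> space M \<Longrightarrow> continuous_on {0..T} (\<lambda>t. \<beta> t \<omega>)"
    and C: "0 < C"
      "\<And>s \<omega>. s \<in> {0..T} \<Longrightarrow> \<omega> \<in> space M \<Longrightarrow> (norm (\<beta> s \<omega>))\<^sup>2 \<le> C * (1 + (norm (X s \<omega>))\<^sup>2)"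
      "\<And>s \<omega>. s \<in> {0..T} \<Longrightarrow> \<omega> \<in> space M \<Longrightarrow> (norm (H s \<omega>))\<^sup>2 \<le> C * (1 + (norm (X s \<omega>))\<^sup>2)"
    and sde: "AE \<omega> in M. \<forall>t\<in>{0..T}. X t \<omega> = \<xi> + (LINT s:{0..t}|lborel. \<beta> s \<omega>) + I t \<omega>"
  shows "integrable M (\<lambda>\<omega>. LINT s:{0..T}|lborel. 1 + (norm (X s \<omega>))\<^sup>2)"
    and "integrable M (\<lambda>\<omega>. (norm (X T \<omega>))\<^sup>2)"
proof -
  \<comment> \<open>The summand 1 lets a multiple of \<open>h\<close> dominate the squared drift and
    the squared diffusion coefficient, so that one process \<open>u\<close> controls both.\<close>
  define h where "h s \<omega> = 1 + (norm (X s \<omega>))\<^sup>2" for s \<omega>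
  define u where "u t \<omega> = integral {0..t} (\<lambda>s. h s \<omega>)" for t \<omega>
  have h_meas: "h t \<in> borel_measurable M" if "t \<in> {0..T}" for t
    using X(1)[OF that] unfolding h_def[abs_def] by measurable
  have h_cont: "continuous_on {0..T} (\<lambda>s. h s \<omega>)" if "\<omega> \<in> space M" for \<omega>
    unfolding h_def by (intro continuous_intros X(2) that)
  have h0: "0 \<le> h s \<omega>" for s \<omega> unfolding h_def by simp
  have u_LINT: "(LINT s:{0..t}|lborel. h s \<omega>) = u t \<omega>" if "\<omega> \<in> space M" "t \<in> {0..T}" for t \<omega>
    unfolding u_def using that
    by (intro set_borel_integral_eq_integral(2) borel_integrable_atLeastAtMost' continuous_on_subset[OF h_cont]) auto
  have u_meas: "u t \<in> borel_measurable M" if t: "t \<in> {0..T}" for t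
  proof -
    have "(\<lambda>\<omega>. LINT s:{0..t}|lborel. h s \<omega>) \<in> borel_measurable M"
      using T t h_meas h_cont by (intro borel_measurable_time_integral[of T]) auto
    then show ?thesis
      by (subst measurable_cong[of M _ "\<lambda>\<omega>. LINT s:{0..t}|lborel. h s \<omega>"]) (use u_LINT[OF _ t] in auto)
  qed
  have u_cont: "continuous_on {0..T} (\<lambda>t. u t \<omega>)" if "\<omega> \<in> space M" for \<omega>
    unfolding u_def by (intro indefinite_integral_continuous_1 integrable_continuous_interval h_cont that)
  have u_nn: "(\<integral>\<^sup>+ s\<in>{0..t}. ennreal (h s \<omega>) \<partial>lborel) = ennreal (u t \<omega>)" and u0: "0 \<le> u t \<omega>"
    if "\<omega> \<in> space M" "t \<in> {0..T}" for t \<omega>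
    unfolding u_def using nn_integral_interval_eq_integral[OF h_cont[OF that(1)], of t] h0 that(2) by auto
  have I_meas: "I t \<in> borel_measurable M" if "t \<in> {0..T}" for t
    using ito that measurable_from_subalg[OF subalgebra_brownian_filtration[OF bm]]
    unfolding is_ito_integral_def by blast
  define q where "q = real CARD('m)"
  define c0 where "c0 = 1 + 3 * (norm \<xi>)\<^sup>2"
  \<comment> \<open>The 3 comes from squaring a sum of three terms. The drift contributes
    \<open>T * C\<close> by Cauchy-Schwarz in time, and the stochastic integral contributes
    \<open>q * 4 * C\<close> from the Ito estimate at level \<open>C * L\<close>.\<close>
  define c1 where "c1 = 3 * T * C + 12 * C * q"
  have c: "0 \<le> c0" "0 < c1" "0 \<le> q" using T C(1) by (auto simp: c0_def c1_def q_def intro!: add_pos_nonneg)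
  \<comment> \<open>\<open>J\<close> is the second moment localised to energy at most
    \<open>L\<close>, and \<open>m\<close> is the truncated mean energy. They bound each other:
    \<open>J\<close> by \<open>m\<close> through the equation (\<open>J_le\<close>), and
    \<open>m\<close> by the time integral of \<open>J\<close> (\<open>m_int\<close>).\<close>
  define J where "J L t = (\<integral>\<^sup>+ \<omega>. indicator {\<omega>. u t \<omega> \<le> L} \<omega> * ennreal (h t \<omega>) \<partial>M)" for L t
  define m where "m L t = expectation (\<lambda>\<omega>. min L (u t \<omega>))" for L t
  have m_nn: "ennreal (m L t) = (\<integral>\<^sup>+ \<omega>. ennreal (min L (u t \<omega>)) \<partial>M)" and m_bound: "0 \<le> m L t" "m L t \<le> L"
    if t: "t \<in> {0..T}" and L: "0 < L" for L t
  proof -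
    have [measurable]: "u t \<in> borel_measurable M" by (rule u_meas[OF t])
    have int: "integrable M (\<lambda>\<omega>. min L (u t \<omega>))"
      by (rule integrable_const_bound[of _ L]) (use u0[OF _ t] L in auto)
    show "ennreal (m L t) = (\<integral>\<^sup>+ \<omega>. ennreal (min L (u t \<omega>)) \<partial>M)"
      unfolding m_def using u0[OF _ t] L by (intro nn_integral_eq_integral[symmetric] int AE_I2) auto
    show "0 \<le> m L t"
      unfolding m_def using u0[OF _ t] L by (intro Bochner_Integration.integral_nonneg) auto
    have "m L t \<le> expectation (\<lambda>_. L)"
      unfolding m_def by (intro integral_mono int) auto
    then show "m L t \<le> L" by (simp add: prob_space)
  qed
  have J_le: "J L t \<le> ennreal (c0 + c1 * m L t)" if t: "t \<in> {0..T}" and L: "0 < L" for L t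
  proof -
    define V where "V \<omega> = (\<integral>\<^sup>+ s\<in>{0..t}. ennreal ((norm (H s \<omega>))\<^sup>2) \<partial>lborel)" for \<omega>
    have [measurable]: "V \<in> borel_measurable M"
      unfolding V_def using T t by (intro borel_measurable_running_energy[of T] H) auto
    have [measurable]: "u t \<in> borel_measurable M" "I t \<in> borel_measurable M"
      using u_meas[OF t] I_meas[OF t] .
    have V_le: "V \<omega> \<le> ennreal (C * u t \<omega>)" if \<omega>: "\<omega> \<in> space M" for \<omega>
    proof -
      have "V \<omega> \<le> (\<integral>\<^sup>+ s\<in>{0..t}. ennreal (C * h s \<omega>) \<partial>lborel)"
        unfolding V_def h_def using C(3)[OF _ \<omega>] t
        by (intro nn_integral_mono) (auto simp: indicator_def intro!: ennreal_leI)
      also have "\<dots> = ennreal (integral {0..t} (\<lambda>s. C * h s \<omega>))"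
        using C(1) h0 t by (intro nn_integral_interval_eq_integral(1)[of T] continuous_intros h_cont \<omega>) auto
      finally show ?thesis unfolding u_def by simp
    qed
    \<comment> \<open>For the Ito term the event \<open>u t \<le> L\<close> is enlarged to
      \<open>V \<le> C * L\<close>, the form required by \<open>ito_energy_estimate\<close>.\<close>
    have pt: "AE \<omega> in M. indicator {\<omega>. u t \<omega> \<le> L} \<omega> * ennreal (h t \<omega>) \<le>
        ennreal c0 + ennreal (3 * T * C) * ennreal (min L (u t \<omega>)) +
        3 * (indicator {\<omega>. V \<omega> \<le> ennreal (C * L)} \<omega> * ennreal ((norm (I t \<omega>))\<^sup>2))"
      using sde AE_space
    proof eventually_elim
      fix \<omega> assume eq: "\<forall>t\<in>{0..T}. X t \<omega> = \<xi> + (LINT s:{0..t}|lborel. \<beta> s \<omega>) + I t \<omega>" and \<omega>: "\<omega> \<in> space M"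
      let ?B = "LINT s:{0..t}|lborel. \<beta> s \<omega>"
      show "indicator {\<omega>. u t \<omega> \<le> L} \<omega> * ennreal (h t \<omega>) \<le>
        ennreal c0 + ennreal (3 * T * C) * ennreal (min L (u t \<omega>)) +
        3 * (indicator {\<omega>. V \<omega> \<le> ennreal (C * L)} \<omega> * ennreal ((norm (I t \<omega>))\<^sup>2))"
      proof (cases "u t \<omega> \<le> L")
        case True
        have V: "V \<omega> \<le> ennreal (C * L)"
          using True C(1) by (intro order_trans[OF V_le[OF \<omega>]] ennreal_leI) simp
        have "h t \<omega> \<le> c0 + 3 * T * C * u t \<omega> + 3 * (norm (I t \<omega>))\<^sup>2"
        proof -
          have "(norm ?B)\<^sup>2 \<le> T * (C * u t \<omega>)"
            unfolding u_def using t T C(2)[OF _ \<omega>]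
            by (intro norm_set_integral_power2_le continuous_on_subset[OF \<beta>[OF \<omega>]] continuous_on_subset[OF h_cont[OF \<omega>]])
              (auto simp: h_def)
          moreover have "h t \<omega> \<le> 1 + (3 * (norm \<xi>)\<^sup>2 + 3 * (norm ?B)\<^sup>2 + 3 * (norm (I t \<omega>))\<^sup>2)"
            using norm_add3_power2_le[of \<xi> ?B "I t \<omega>"] eq t unfolding h_def by simp
          ultimately show ?thesis unfolding c0_def by linarith
        qed
        then have "ennreal (h t \<omega>) \<le> ennreal (c0 + 3 * T * C * u t \<omega> + 3 * (norm (I t \<omega>))\<^sup>2)" by (rule ennreal_leI)
        also have "\<dots> = ennreal c0 + ennreal (3 * T * C) * ennreal (u t \<omega>) + 3 * ennreal ((norm (I t \<omega>))\<^sup>2)"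
          using c(1) T C(1) u0[OF \<omega> t] by (simp add: ennreal_mult'')
        finally show ?thesis using True V by (simp add: min_absorb2)
      qed simp
    qed
    have ito_le: "(\<integral>\<^sup>+ \<omega>. indicator {\<omega>. V \<omega> \<le> ennreal (C * L)} \<omega> * ennreal ((norm (I t \<omega>))\<^sup>2) \<partial>M)
        \<le> ennreal q * (ennreal (4 * C) * ennreal (m L t))"
    proof -
      have "(\<integral>\<^sup>+ \<omega>. indicator {\<omega>. V \<omega> \<le> ennreal (C * L)} \<omega> * ennreal ((norm (I t \<omega>))\<^sup>2) \<partial>M)
          \<le> of_nat CARD('m) * (\<integral>\<^sup>+ \<omega>. min (ennreal (4 * (C * L))) (2 * V \<omega>) \<partial>M)"
        unfolding V_def using C(1) L by (intro ito_energy_estimate[OF bm ito H t]) auto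
      also have "of_nat CARD('m) = ennreal q" by (simp add: q_def ennreal_of_nat_eq_real_of_nat)
      also have "(\<integral>\<^sup>+ \<omega>. min (ennreal (4 * (C * L))) (2 * V \<omega>) \<partial>M) \<le> (\<integral>\<^sup>+ \<omega>. ennreal (4 * C) * ennreal (min L (u t \<omega>)) \<partial>M)"
      proof (rule nn_integral_mono)
        fix \<omega> assume \<omega>: "\<omega> \<in> space M"
        have eq: "ennreal (4 * C) * ennreal (min L (u t \<omega>)) = ennreal (4 * C * min L (u t \<omega>))"
          using C(1) L u0[OF \<omega> t] by (simp add: ennreal_mult'')
        show "min (ennreal (4 * (C * L))) (2 * V \<omega>) \<le> ennreal (4 * C) * ennreal (min L (u t \<omega>))"
        \<comment> \<open>Below the level \<open>V_le\<close> bounds the second argument of the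
          minimum; above it the first argument is exactly \<open>4 * C * L\<close>.\<close>
        proof (cases "u t \<omega> \<le> L")
          case True
          have "2 * V \<omega> \<le> 2 * ennreal (C * u t \<omega>)" by (intro mult_left_mono V_le \<omega>) simp
          also have "\<dots> = ennreal (2 * (C * u t \<omega>))" using C(1) u0[OF \<omega> t] by (simp add: ennreal_mult'')
          also have "\<dots> \<le> ennreal (4 * C * min L (u t \<omega>))"
            using True C(1) u0[OF \<omega> t] by (intro ennreal_leI) (simp add: min_absorb2)
          finally show ?thesis unfolding eq by (rule min.coboundedI2)
        next
          case False
          then show ?thesis unfolding eq by (intro min.coboundedI1) (simp add: mult.assoc)
        qed
      qed
      also have "\<dots> = ennreal (4 * C) * ennreal (m L t)"
        unfolding m_nn[OF t L] by (rule nn_integral_cmult) measurable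
      finally show ?thesis by (simp add: mult_left_mono)
    qed
    have "J L t \<le> (\<integral>\<^sup>+ \<omega>. ennreal c0 + ennreal (3 * T * C) * ennreal (min L (u t \<omega>)) +
        3 * (indicator {\<omega>. V \<omega> \<le> ennreal (C * L)} \<omega> * ennreal ((norm (I t \<omega>))\<^sup>2)) \<partial>M)"
      unfolding J_def by (rule nn_integral_mono_AE[OF pt])
    also have "\<dots> = ennreal c0 + ennreal (3 * T * C) * ennreal (m L t) +
        3 * (\<integral>\<^sup>+ \<omega>. indicator {\<omega>. V \<omega> \<le> ennreal (C * L)} \<omega> * ennreal ((norm (I t \<omega>))\<^sup>2) \<partial>M)"
      unfolding m_nn[OF t L] by (simp add: nn_integral_add nn_integral_cmult emeasure_space_1)
    also have "\<dots> \<le> ennreal c0 + ennreal (3 * T * C) * ennreal (m L t) + 3 * (ennreal q * (ennreal (4 * C) * ennreal (m L t)))"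
      by (intro add_left_mono mult_left_mono ito_le) simp
    also have "\<dots> = ennreal (c0 + 3 * T * C * m L t + 3 * (q * (4 * C * m L t)))"
    proof -
      have nn: "0 \<le> 4 * C" "0 \<le> 3 * T * C" "0 \<le> m L t" "0 \<le> 4 * C * m L t" "0 \<le> q * (4 * C * m L t)"
        "0 \<le> 3 * T * C * m L t" "0 \<le> 3 * (q * (4 * C * m L t))" "0 \<le> c0 + 3 * T * C * m L t"
        using c C(1) T m_bound(1)[OF t L] by simp_all
      have m3: "ennreal (3 * (q * (4 * C * m L t))) = 3 * ennreal (q * (4 * C * m L t))"
        using ennreal_mult[of 3, OF _ nn(5)] by (simp only: ennreal_numeral zero_le_numeral)
      show ?thesis
        unfolding ennreal_plus[OF nn(8,7)] ennreal_plus[OF c(1) nn(6)] ennreal_mult[OF nn(2,3)]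
          m3 ennreal_mult[OF c(3) nn(4)] ennreal_mult[OF nn(1,3)] ..
    qed
    also have "c0 + 3 * T * C * m L t + 3 * (q * (4 * C * m L t)) = c0 + c1 * m L t"
      by (simp add: c1_def algebra_simps)
    finally show ?thesis .
  qed
  have m_int: "ennreal (m L t) \<le> (\<integral>\<^sup>+ s\<in>{0..t}. ennreal (c0 + c1 * m L s) \<partial>lborel)"
    if t: "t \<in> {0..T}" and L: "0 < L" for L t
  proof -
    interpret P: pair_sigma_finite lborel M by unfold_locales
    have [measurable]: "(\<lambda>(s, \<omega>). indicator {0..T} s *\<^sub>R u s \<omega>) \<in> borel_measurable (borel \<Otimes>\<^sub>M M)"
      "(\<lambda>(s, \<omega>). indicator {0..T} s *\<^sub>R h s \<omega>) \<in> borel_measurable (borel \<Otimes>\<^sub>M M)"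
      using T by (intro borel_measurable_pair_interval u_meas u_cont h_meas h_cont; simp)+
    \<comment> \<open>Written with the versions of \<open>u\<close> and \<open>h\<close> cut off to
      \<open>{0..T}\<close>, which are jointly measurable as Fubini's theorem requires; on
      \<open>{0..t}\<close> they agree with the originals.\<close>
    let ?G = "\<lambda>s \<omega>. indicator {..L} ((\<lambda>(s, \<omega>). indicator {0..T} s *\<^sub>R u s \<omega>) (s, \<omega>)) *
        ennreal ((\<lambda>(s, \<omega>). indicator {0..T} s *\<^sub>R h s \<omega>) (s, \<omega>)) * indicator {0..t} s"
    have G: "?G s \<omega> = indicator {\<omega>. u s \<omega> \<le> L} \<omega> * ennreal (h s \<omega>) * indicator {0..t} s" for s \<omega>
      using t by (auto simp: indicator_def)
    have "ennreal (m L t) \<le> (\<integral>\<^sup>+ \<omega>. \<integral>\<^sup>+ s. ?G s \<omega> \<partial>lborel \<partial>M)"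
      unfolding m_nn[OF t L]
    proof (rule nn_integral_mono)
      fix \<omega> assume \<omega>: "\<omega> \<in> space M"
      have "ennreal (min L (u t \<omega>)) \<le> (\<integral>\<^sup>+ s\<in>{0..t}. indicator {s. u s \<omega> \<le> L} s * ennreal (h s \<omega>) \<partial>lborel)"
        unfolding u_def using L by (intro min_integral_le_truncated_integral[OF h_cont[OF \<omega>] h0 t]) simp
      also have "\<dots> = (\<integral>\<^sup>+ s. ?G s \<omega> \<partial>lborel)"
        unfolding G by (intro nn_integral_cong) (simp add: indicator_def)
      finally show "ennreal (min L (u t \<omega>)) \<le> (\<integral>\<^sup>+ s. ?G s \<omega> \<partial>lborel)" .
    qed
    also have "\<dots> = (\<integral>\<^sup>+ s. \<integral>\<^sup>+ \<omega>. ?G s \<omega> \<partial>M \<partial>lborel)"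
      by (rule P.Fubini') measurable
    also have "\<dots> \<le> (\<integral>\<^sup>+ s\<in>{0..t}. ennreal (c0 + c1 * m L s) \<partial>lborel)"
    proof (rule nn_integral_mono)
      fix s
      show "(\<integral>\<^sup>+ \<omega>. ?G s \<omega> \<partial>M) \<le> ennreal (c0 + c1 * m L s) * indicator {0..t} s"
      proof (cases "s \<in> {0..t}")
        case True
        then have "(\<integral>\<^sup>+ \<omega>. ?G s \<omega> \<partial>M) = J L s" unfolding G J_def by simp
        then show ?thesis using J_le[of s L] True t L by simp
      next
        case False
        then show ?thesis unfolding G by simp
      qed
    qed
    finally show ?thesis .
  qed
  define K where "K = 2 * c0 * T * exp (2 * c1 * T)"
  have mK: "m L T \<le> K" if "0 < L" for L
    unfolding K_def using T c m_bound[OF _ that] m_int[OF _ that] by (intro gronwall_bounded[where L=L]) auto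
  have T_in: "T \<in> {0..T}" using T by simp
  have [measurable]: "u T \<in> borel_measurable M" "h T \<in> borel_measurable M" using u_meas h_meas T_in by auto
  let ?L = "\<lambda>n. real (Suc n)"
  have ev: "\<forall>\<^sub>F n in sequentially. u T \<omega> \<le> ?L n" for \<omega>
  proof -
    obtain n0 where "u T \<omega> \<le> real n0" using real_arch_simple by blast
    then show ?thesis unfolding eventually_sequentially by (intro exI[of _ n0]) auto
  qed
  \<comment> \<open>The bound \<open>K\<close> is free of the level, so levels \<open>Suc n\<close>
    are sent to infinity with Fatou's lemma. For each \<omega> the truncation is eventually
    inactive.\<close>
  have "(\<integral>\<^sup>+ \<omega>. ennreal (u T \<omega>) \<partial>M) = (\<integral>\<^sup>+ \<omega>. liminf (\<lambda>n. ennreal (min (?L n) (u T \<omega>))) \<partial>M)"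
  proof (intro nn_integral_cong lim_imp_Liminf[symmetric])
    fix \<omega> show "(\<lambda>n. ennreal (min (?L n) (u T \<omega>))) \<longlonglongrightarrow> ennreal (u T \<omega>)"
      by (rule tendsto_eventually, rule eventually_mono[OF ev[of \<omega>]]) (simp add: min_absorb2)
  qed simp
  also have "\<dots> \<le> liminf (\<lambda>n. \<integral>\<^sup>+ \<omega>. ennreal (min (?L n) (u T \<omega>)) \<partial>M)"
    by (rule nn_integral_liminf) measurable
  also have "\<dots> \<le> liminf (\<lambda>n. ennreal K)"
    using mK m_nn[OF T_in] by (intro Liminf_mono always_eventually allI) (metis ennreal_leI of_nat_0_less_iff zero_less_Suc)
  also have "\<dots> = ennreal K" by (simp add: Liminf_const)
  finally have uK: "(\<integral>\<^sup>+ \<omega>. ennreal (u T \<omega>) \<partial>M) \<le> ennreal K" .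
  have "integrable M (u T)"
    using uK u0[OF _ T_in]
    by (intro integrableI_nonneg) (auto simp: AE_I2 intro: le_less_trans)
  then show "integrable M (\<lambda>\<omega>. LINT s:{0..T}|lborel. 1 + (norm (X s \<omega>))\<^sup>2)"
    by (subst Bochner_Integration.integrable_cong[OF refl, of _ _ "u T"]) (use u_LINT[OF _ T_in] in \<open>auto simp: h_def\<close>)
  \<comment> \<open>Integrability over time says nothing about the single time \<open>T\<close>. The
    terminal moment comes from \<open>J_le\<close> at \<open>T\<close>, again with levels tending to
    infinity.\<close>
  have "(\<integral>\<^sup>+ \<omega>. ennreal (h T \<omega>) \<partial>M) = (\<integral>\<^sup>+ \<omega>. liminf (\<lambda>n. indicator {\<omega>. u T \<omega> \<le> ?L n} \<omega> * ennreal (h T \<omega>)) \<partial>M)"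
  proof (intro nn_integral_cong lim_imp_Liminf[symmetric])
    fix \<omega> show "(\<lambda>n. indicator {\<omega>. u T \<omega> \<le> ?L n} \<omega> * ennreal (h T \<omega>)) \<longlonglongrightarrow> ennreal (h T \<omega>)"
      by (rule tendsto_eventually, rule eventually_mono[OF ev[of \<omega>]]) simp
  qed simp
  also have "\<dots> \<le> liminf (\<lambda>n. \<integral>\<^sup>+ \<omega>. indicator {\<omega>. u T \<omega> \<le> ?L n} \<omega> * ennreal (h T \<omega>) \<partial>M)"
    by (rule nn_integral_liminf) measurable
  also have "\<dots> \<le> liminf (\<lambda>n. ennreal (c0 + c1 * K))"
  proof (intro Liminf_mono always_eventually allI)
    fix n
    have "J (?L n) T \<le> ennreal (c0 + c1 * m (?L n) T)" by (rule J_le[OF T_in]) simp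
    also have "\<dots> \<le> ennreal (c0 + c1 * K)" using mK[of "?L n"] c by (intro ennreal_leI) simp
    finally show "(\<integral>\<^sup>+ \<omega>. indicator {\<omega>. u T \<omega> \<le> ?L n} \<omega> * ennreal (h T \<omega>) \<partial>M) \<le> ennreal (c0 + c1 * K)"
      unfolding J_def .
  qed
  also have "\<dots> = ennreal (c0 + c1 * K)" by (simp add: Liminf_const)
  finally have "(\<integral>\<^sup>+ \<omega>. ennreal (h T \<omega>) \<partial>M) \<le> ennreal (c0 + c1 * K)" .
  then have "integrable M (h T)"
    using h0 by (intro integrableI_nonneg) (auto simp: AE_I2 intro: le_less_trans)
  then have "integrable M (\<lambda>\<omega>. h T \<omega> - 1)" by simp
  then show "integrable M (\<lambda>\<omega>. (norm (X T \<omega>))\<^sup>2)" by (simp add: h_def)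
qed

section \<open>The potential game\<close>

text \<open>Comparison with the value at one point \<open>(0, a0)\<close>: since \<open>A\<close> is
  bounded, the distance of the actions is absorbed into a constant and linear growth in
  \<open>x\<close> remains.\<close>

lemma lipschitz_quadratic_growth:
  fixes b :: "'x::real_normed_vector \<Rightarrow> 'y::real_normed_vector \<Rightarrow> 'z::real_normed_vector"
  assumes lip: "L-lipschitz_on (UNIV \<times> A) (\<lambda>(x, a). b x a)" and A: "bounded A"
  shows "\<exists>C>0. \<forall>x. \<forall>a\<in>A. (norm (b x a))\<^sup>2 \<le> C * (1 + (norm x)\<^sup>2)"
proof (cases "A = {}")
  case True
  then show ?thesis by (auto intro: exI[of _ 1])
next
  case False
  then obtain a0 where a0: "a0 \<in> A" by blast
  obtain R where R: "\<And>a. a \<in> A \<Longrightarrow> norm a \<le> R" using A unfolding bounded_iff by blast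
  have L: "0 \<le> L" using lip by (rule lipschitz_on_nonneg)
  define B where "B = norm (b 0 a0) + L * (R + norm a0)"
  \<comment> \<open>The 2s come from squaring \<open>B + L * norm x\<close>, and the 1 keeps the
    constant positive when \<open>B\<close> and \<open>L\<close> vanish.\<close>
  have "(norm (b x a))\<^sup>2 \<le> (2 * B\<^sup>2 + 2 * L\<^sup>2 + 1) * (1 + (norm x)\<^sup>2)" if a: "a \<in> A" for x a
  proof -
    have "dist (b x a) (b 0 a0) \<le> L * dist (x, a) (0, a0)"
      using lipschitz_onD[OF lip, of "(x, a)" "(0, a0)"] a a0 by simp
    also have "dist (x, a) (0, a0) \<le> norm x + norm (a - a0)"
      using norm_Pair_le[of x "a - a0"] by (simp add: dist_norm)
    also have "norm (a - a0) \<le> R + norm a0" using norm_triangle_ineq4[of a a0] R[OF a] by simp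
    finally have "dist (b x a) (b 0 a0) \<le> L * (norm x + (R + norm a0))" using L by (simp add: mult_left_mono)
    moreover have "norm (b x a) \<le> norm (b 0 a0) + dist (b x a) (b 0 a0)"
      using norm_triangle_ineq[of "b 0 a0" "b x a - b 0 a0"] by (simp add: dist_norm)
    ultimately have "norm (b x a) \<le> B + L * norm x" unfolding B_def by (simp add: algebra_simps)
    then have "(norm (b x a))\<^sup>2 \<le> (B + L * norm x)\<^sup>2" by (intro power_mono) auto
    also have "\<dots> \<le> 2 * B\<^sup>2 + 2 * (L * norm x)\<^sup>2"
      using sum_squares_bound[of B "L * norm x"] by (simp add: power2_sum)
    also have "\<dots> \<le> (2 * B\<^sup>2 + 2 * L\<^sup>2 + 1) * (1 + (norm x)\<^sup>2)"
    proof -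
      have "0 \<le> B\<^sup>2 * (norm x)\<^sup>2" "0 \<le> L\<^sup>2" "0 \<le> (norm x)\<^sup>2" by simp_all
      then show ?thesis by (simp add: algebra_simps power_mult_distrib)
    qed
    finally show ?thesis .
  qed
  moreover have "0 < 2 * B\<^sup>2 + 2 * L\<^sup>2 + 1" by (intro add_nonneg_pos) auto
  ultimately show ?thesis by blast
qed

text \<open>The time map \<open>r\<close> covers two uses: \<open>r t = t\<close> along a path of
  the state, and constant \<open>r\<close> for dependence on the state at a fixed time, which yields
  measurability in \<omega>.\<close>

lemma continuous_on_along_policy:
  fixes F :: "'x::topological_space \<Rightarrow> 'y::topological_space \<Rightarrow> 'z::topological_space"
  assumes F: "continuous_on (UNIV \<times> A) (\<lambda>(x, a). F x a)"
    and \<phi>: "continuous_on (S \<times> UNIV) \<phi>" "\<phi> ` (S \<times> UNIV) \<subseteq> A"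
    and X: "continuous_on U X" and r: "continuous_on U r" "r ` U \<subseteq> S"
  shows "continuous_on U (\<lambda>t. F (X t) (\<phi> (r t, X t)))"
proof -
  have "continuous_on U (\<lambda>t. \<phi> (r t, X t))"
    by (rule continuous_on_compose2[OF \<phi>(1)]) (use X r in \<open>auto intro!: continuous_intros\<close>)
  then have "continuous_on U (\<lambda>t. (X t, \<phi> (r t, X t)))" using X by (intro continuous_on_Pair)
  then have "continuous_on U (\<lambda>t. (\<lambda>(x, a). F x a) (X t, \<phi> (r t, X t)))"
    by (rule continuous_on_compose2[OF F]) (use \<phi>(2) r(2) image_subset_iff in \<open>fastforce\<close>)
  then show ?thesis by simp
qed

lemma borel_measurable_along_policy:
  fixes F :: "'x::topological_space \<Rightarrow> 'y::topological_space \<Rightarrow> 'z::topological_space"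
  assumes F: "continuous_on (UNIV \<times> A) (\<lambda>(x, a). F x a)"
    and \<phi>: "continuous_on (S \<times> UNIV) \<phi>" "\<phi> ` (S \<times> UNIV) \<subseteq> A"
    and t: "t \<in> S" and X: "X \<in> borel_measurable M"
  shows "(\<lambda>\<omega>. F (X \<omega>) (\<phi> (t, X \<omega>))) \<in> borel_measurable M"
proof -
  have "continuous_on UNIV (\<lambda>x. F x (\<phi> (t, x)))"
    using t by (intro continuous_on_along_policy[OF F \<phi>] continuous_on_id continuous_on_const) auto
  from borel_measurable_continuous_on[OF this X] show ?thesis .
qed

section \<open>Splitting off the cost of one player\<close>

text \<open>Detailed balance makes the averaged coefficient of a pair containing \<open>i\<close>
  equal to \<open>p i * \<Lambda> i j\<close>. Pairs avoiding \<open>i\<close> and costs of the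
  other players do not see \<open>\<phi> i\<close>. The expected own cost and interaction are
  abstracted to \<open>a\<close> and \<kappa>, so this is finite algebra.\<close>

lemma potential_eq_scaled_cost_plus_rest:
  fixes a :: "nat \<Rightarrow> 'p \<Rightarrow> real" and \<kappa> :: "nat \<Rightarrow> nat \<Rightarrow> 'p \<Rightarrow> 'p \<Rightarrow> real"
  assumes sym: "\<And>i j x y. \<kappa> i j x y = \<kappa> j i y x"
    and db: "\<And>i j. i \<in> {1..N} \<Longrightarrow> j \<in> {1..N} \<Longrightarrow> p i * \<Lambda> i j = p j * \<Lambda> j i" and i: "i \<in> {1..N}"
  defines "pairs \<equiv> {(i, j). 1 \<le> i \<and> i < j \<and> j \<le> N}"
  shows "(\<Sum>i\<in>{1..N}. p i * a i (\<phi> i)) + (\<Sum>(i, j)\<in>pairs. (p i * \<Lambda> i j + p j * \<Lambda> j i) / 2 * \<kappa> i j (\<phi> i) (\<phi> j))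
    = p i * (a i (\<phi> i) + (\<Sum>j\<in>{1..N} - {i}. \<Lambda> i j * \<kappa> i j (\<phi> i) (\<phi> j))) +
      ((\<Sum>l\<in>{1..N} - {i}. p l * a l (\<phi> l)) +
       (\<Sum>(k, j)\<in>{z \<in> pairs. fst z \<noteq> i \<and> snd z \<noteq> i}. (p k * \<Lambda> k j + p j * \<Lambda> j k) / 2 * \<kappa> k j (\<phi> k) (\<phi> j)))"
proof -
  let ?w = "\<lambda>(k, j). (p k * \<Lambda> k j + p j * \<Lambda> j k) / 2 * \<kappa> k j (\<phi> k) (\<phi> j)"
  have fin: "finite pairs"
    by (rule finite_subset[of _ "{1..N} \<times> {1..N}"]) (auto simp: pairs_def)
  have "(\<Sum>z\<in>{z \<in> pairs. \<not> (fst z \<noteq> i \<and> snd z \<noteq> i)}. ?w z) = (\<Sum>j\<in>{1..N} - {i}. p i * (\<Lambda> i j * \<kappa> i j (\<phi> i) (\<phi> j)))"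
  \<comment> \<open>A pair containing \<open>i\<close> is identified with its other member;
    \<open>min\<close> and \<open>max\<close> restore the increasing order. If \<open>i\<close> is
    the larger member, the symmetry of \<kappa> exchanges the arguments.\<close>
  proof (rule sum.reindex_bij_witness[where i="\<lambda>j. (min i j, max i j)" and j="\<lambda>z. if fst z = i then snd z else fst z"])
    fix z assume z: "z \<in> {z \<in> pairs. \<not> (fst z \<noteq> i \<and> snd z \<noteq> i)}"
    show "(min i (if fst z = i then snd z else fst z), max i (if fst z = i then snd z else fst z)) = z"
      using z by (cases z) (auto simp: pairs_def)
    show "(if fst z = i then snd z else fst z) \<in> {1..N} - {i}" using z by (cases z) (auto simp: pairs_def)
    obtain k j where kj: "z = (k, j)" by (cases z)
    have eq: "p k * \<Lambda> k j = p j * \<Lambda> j k" using db[of k j] z kj by (auto simp: pairs_def)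
    then show "p i * (\<Lambda> i (if fst z = i then snd z else fst z) * \<kappa> i (if fst z = i then snd z else fst z) (\<phi> i) (\<phi> (if fst z = i then snd z else fst z))) = ?w z"
    proof (cases "k = i")
      case True
      then show ?thesis using eq kj by simp
    next
      case False
      then have "j = i" using z kj by auto
      then show ?thesis using eq kj False sym[of k i] by simp
    qed
  next
    fix j assume "j \<in> {1..N} - {i}"
    then show "(if fst (min i j, max i j) = i then snd (min i j, max i j) else fst (min i j, max i j)) = j"
      "(min i j, max i j) \<in> {z \<in> pairs. \<not> (fst z \<noteq> i \<and> snd z \<noteq> i)}"
      using i by (auto simp: pairs_def min_def max_def)
  qed
  moreover have "(\<Sum>z\<in>pairs. ?w z) = (\<Sum>z\<in>{z \<in> pairs. fst z \<noteq> i \<and> snd z \<noteq> i}. ?w z) +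
      (\<Sum>z\<in>{z \<in> pairs. \<not> (fst z \<noteq> i \<and> snd z \<noteq> i)}. ?w z)"
    using fin by (subst sum.union_disjoint[symmetric]) (auto intro!: sum.cong)
  moreover have "(\<Sum>i\<in>{1..N}. p i * a i (\<phi> i)) = p i * a i (\<phi> i) + (\<Sum>l\<in>{1..N} - {i}. p l * a l (\<phi> l))"
    using i by (intro sum.remove) auto
  ultimately show ?thesis by (simp add: distrib_left sum_distrib_left)
qed

section \<open>Integrability of the costs and the equilibrium property\<close>

lemma policy_classD:
  assumes "policy_class T A P" "\<phi> \<in> P"
  shows "continuous_on ({0..T} \<times> UNIV) \<phi>" "\<phi> ` ({0..T} \<times> UNIV) \<subseteq> A"
  using assms unfolding policy_class_def by blast+

lemma strong_solutionD:
  assumes "brownian_motion M W" "strong_solution M W T b \<sigma> \<xi> \<phi> X"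
  shows "\<And>t. t \<in> {0..T} \<Longrightarrow> X t \<in> borel_measurable M"
    and "\<And>\<omega>. \<omega> \<in> space M \<Longrightarrow> continuous_on {0..T} (\<lambda>t. X t \<omega>)"
  using assms measurable_from_subalg[OF subalgebra_brownian_filtration[OF assms(1)]]
  unfolding strong_solution_def by blast+

lemma (in prob_space) strong_solution_second_moments:
  fixes W :: "real \<Rightarrow> 'a \<Rightarrow> real^'m" and X :: "real \<Rightarrow> 'a \<Rightarrow> real^'d" and \<phi> :: "real \<times> (real^'d) \<Rightarrow> real^'k"
  assumes T: "0 < T" and bm: "brownian_motion M W" and A: "compact A"
    and \<phi>: "continuous_on ({0..T} \<times> UNIV) \<phi>" "\<phi> ` ({0..T} \<times> UNIV) \<subseteq> A"
    and b: "L-lipschitz_on (UNIV \<times> A) (\<lambda>(x, a). b x a)"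
    and \<sigma>: "L'-lipschitz_on (UNIV \<times> A) (\<lambda>(x, a). \<sigma> x a)"
    and sol: "strong_solution M W T b \<sigma> \<xi> \<phi> X"
  shows "integrable M (\<lambda>\<omega>. LINT s:{0..T}|lborel. 1 + (norm (X s \<omega>))\<^sup>2)"
    and "integrable M (\<lambda>\<omega>. (norm (X T \<omega>))\<^sup>2)"
proof -
  note X = strong_solutionD[OF bm sol]
  obtain I where ito: "is_ito_integral M W T (\<lambda>t \<omega>. \<sigma> (X t \<omega>) (\<phi> (t, X t \<omega>))) I"
    and sde: "AE \<omega> in M. \<forall>t\<in>{0..T}. X t \<omega> = \<xi> + (LINT s:{0..t}|lborel. b (X s \<omega>) (\<phi> (s, X s \<omega>))) + I t \<omega>"
    using sol unfolding strong_solution_def by blast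
  obtain C1 where C1: "0 < C1" "\<And>x a. a \<in> A \<Longrightarrow> (norm (b x a))\<^sup>2 \<le> C1 * (1 + (norm x)\<^sup>2)"
    using lipschitz_quadratic_growth[OF b compact_imp_bounded[OF A]] by blast
  obtain C2 where C2: "0 < C2" "\<And>x a. a \<in> A \<Longrightarrow> (norm (\<sigma> x a))\<^sup>2 \<le> C2 * (1 + (norm x)\<^sup>2)"
    using lipschitz_quadratic_growth[OF \<sigma> compact_imp_bounded[OF A]] by blast
  have pos: "0 \<le> 1 + (norm x)\<^sup>2" for x :: "real^'d" by simp
  \<comment> \<open>The sum \<open>C1 + C2\<close> serves as a common growth constant for drift and
    diffusion, as \<open>sde_second_moments\<close> expects a single one.\<close>
  have b_le: "(norm (b x a))\<^sup>2 \<le> (C1 + C2) * (1 + (norm x)\<^sup>2)" if "a \<in> A" for x a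
    using C1(2)[OF that, of x] mult_nonneg_nonneg[OF less_imp_le[OF C2(1)] pos[of x]] by (simp add: distrib_right)
  have \<sigma>_le: "(norm (\<sigma> x a))\<^sup>2 \<le> (C1 + C2) * (1 + (norm x)\<^sup>2)" if "a \<in> A" for x a
    using C2(2)[OF that, of x] mult_nonneg_nonneg[OF less_imp_le[OF C1(1)] pos[of x]] by (simp add: distrib_right)
  have \<phi>A: "\<phi> (s, x) \<in> A" if "s \<in> {0..T}" for s x using \<phi>(2) that by blast
  have cont: "continuous_on {0..T} (\<lambda>t. F (X t \<omega>) (\<phi> (t, X t \<omega>)))"
    if "K-lipschitz_on (UNIV \<times> A) (\<lambda>(x, a). F x a)" "\<omega> \<in> space M" for K \<omega> and F :: "real^'d \<Rightarrow> real^'k \<Rightarrow> 'z::metric_space"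
    by (rule continuous_on_along_policy[OF lipschitz_on_continuous_on[OF that(1)] \<phi> X(2)[OF that(2)] continuous_on_id])
      simp
  have meas: "(\<lambda>\<omega>. \<sigma> (X t \<omega>) (\<phi> (t, X t \<omega>))) \<in> borel_measurable M" if "t \<in> {0..T}" for t
    by (rule borel_measurable_along_policy[OF lipschitz_on_continuous_on[OF \<sigma>] \<phi> that X(1)[OF that]])
  note moments = sde_second_moments[OF T bm ito X meas cont[OF \<sigma>] cont[OF b] _ b_le[OF \<phi>A] \<sigma>_le[OF \<phi>A] sde]
  show "integrable M (\<lambda>\<omega>. LINT s:{0..T}|lborel. 1 + (norm (X s \<omega>))\<^sup>2)"
    "integrable M (\<lambda>\<omega>. (norm (X T \<omega>))\<^sup>2)"
    using C1(1) C2(1) by (intro moments; simp)+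
qed

lemma integrable_time_integral:
  fixes Y h :: "real \<Rightarrow> 'w \<Rightarrow> real"
  assumes T: "0 \<le> T"
    and Y: "\<And>t. t \<in> {0..T} \<Longrightarrow> Y t \<in> borel_measurable M"
      "\<And>\<omega>. \<omega> \<in> space M \<Longrightarrow> continuous_on {0..T} (\<lambda>t. Y t \<omega>)"
    and h: "\<And>\<omega>. \<omega> \<in> space M \<Longrightarrow> continuous_on {0..T} (\<lambda>t. h t \<omega>)"
      "integrable M (\<lambda>\<omega>. LINT t:{0..T}|lborel. h t \<omega>)"
    and le: "\<And>t \<omega>. t \<in> {0..T} \<Longrightarrow> \<omega> \<in> space M \<Longrightarrow> \<bar>Y t \<omega>\<bar> \<le> C * h t \<omega>"
  shows "integrable M (\<lambda>\<omega>. LINT t:{0..T}|lborel. Y t \<omega>)"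
proof (rule Bochner_Integration.integrable_bound)
  show "integrable M (\<lambda>\<omega>. C * (LINT t:{0..T}|lborel. h t \<omega>))" using h(2) by simp
  show "(\<lambda>\<omega>. LINT t:{0..T}|lborel. Y t \<omega>) \<in> borel_measurable M"
    using T by (intro borel_measurable_time_integral[of T] Y) auto
  show "AE \<omega> in M. norm (LINT t:{0..T}|lborel. Y t \<omega>) \<le> norm (C * (LINT t:{0..T}|lborel. h t \<omega>))"
  proof (rule AE_I2)
    fix \<omega> assume \<omega>: "\<omega> \<in> space M"
    have "norm (LINT t:{0..T}|lborel. Y t \<omega>) = norm (integral {0..T} (\<lambda>t. Y t \<omega>))"
      using set_borel_integral_eq_integral(2)[OF borel_integrable_atLeastAtMost'[OF Y(2)[OF \<omega>]]] by simp
    also have "\<dots> \<le> integral {0..T} (\<lambda>t. C * h t \<omega>)"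
      using le[OF _ \<omega>]
      by (intro integral_norm_bound_integral integrable_continuous_interval continuous_intros Y(2) h(1) \<omega>) auto
    also have "\<dots> = C * (LINT t:{0..T}|lborel. h t \<omega>)"
      using set_borel_integral_eq_integral(2)[OF borel_integrable_atLeastAtMost'[OF h(1)[OF \<omega>]]] by simp
    finally show "norm (LINT t:{0..T}|lborel. Y t \<omega>) \<le> norm (C * (LINT t:{0..T}|lborel. h t \<omega>))" by simp
  qed
qed

lemma
  fixes f :: "'i \<Rightarrow> 'a \<Rightarrow> 'b::{banach, second_countable_topology}"
  assumes "\<And>i. i \<in> I \<Longrightarrow> set_integrable M A (f i)"
  shows set_integrable_sum: "set_integrable M A (\<lambda>x. \<Sum>i\<in>I. f i x)"
    and set_integral_sum: "(LINT x:A|M. \<Sum>i\<in>I. f i x) = (\<Sum>i\<in>I. LINT x:A|M. f i x)"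
  using assms unfolding set_integrable_def set_lebesgue_integral_def
  by (simp_all add: scaleR_sum_right Bochner_Integration.integral_sum)

text \<open>Policies are decentralized: the state of a player depends on that player's policy alone.
  Once all expectations are finite, costs and potential are therefore finite sums of terms depending
  on one or two policies, and a unilateral deviation changes the potential by \<open>p i\<close>
  times the change of the cost.\<close>

lemma (in prob_space) potential_minimizer_is_nash:
  fixes W :: "real \<Rightarrow> 'a \<Rightarrow> real^'m"
    and A :: "nat \<Rightarrow> (real^'k) set" and P :: "nat \<Rightarrow> (real \<times> (real^'d) \<Rightarrow> real^'k) set"
    and X :: "nat \<Rightarrow> (real \<times> (real^'d) \<Rightarrow> real^'k) \<Rightarrow> real \<Rightarrow> 'a \<Rightarrow> real^'d"
  assumes T: "0 < T" and bm: "brownian_motion M W"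
    and A: "\<And>i. i \<in> {1..N} \<Longrightarrow> compact (A i)"
    and P: "\<And>i. i \<in> {1..N} \<Longrightarrow> policy_class T (A i) (P i)"
    and b: "\<And>i. i \<in> {1..N} \<Longrightarrow> \<exists>L. L-lipschitz_on (UNIV \<times> A i) (\<lambda>(x, a). b i x a)"
    and \<sigma>: "\<And>i. i \<in> {1..N} \<Longrightarrow> \<exists>L. L-lipschitz_on (UNIV \<times> A i) (\<lambda>(x, a). \<sigma> i x a)"
    and f: "\<And>i. i \<in> {1..N} \<Longrightarrow> continuous_on (UNIV \<times> A i) (\<lambda>(x, a). f i x a)"
    and f_le: "\<And>i. i \<in> {1..N} \<Longrightarrow>
           \<exists>C. \<forall>x. \<forall>a\<in>A i. \<bar>f i x a\<bar> \<le> C * (1 + (norm x)\<^sup>2 + (norm a)\<^sup>2)"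
    and g: "\<And>i. i \<in> {1..N} \<Longrightarrow> continuous_on UNIV (g i)"
    and g_le: "\<And>i. i \<in> {1..N} \<Longrightarrow> \<exists>C. \<forall>x. \<bar>g i x\<bar> \<le> C * (1 + (norm x)\<^sup>2)"
    and K: "bounded (range K)" "continuous_on UNIV K" "\<And>x. K x = K (- x)"
    and sol: "\<And>i \<phi>. i \<in> {1..N} \<Longrightarrow> \<phi> \<in> P i \<Longrightarrow> strong_solution M W T (b i) (\<sigma> i) (\<xi> i) \<phi> (X i \<phi>)"
    and p: "p \<in> positive_weights N"
    and db: "\<And>i j. i \<in> {1..N} \<Longrightarrow> j \<in> {1..N} \<Longrightarrow> p i * \<Lambda> i j = p j * \<Lambda> j i"
    and min: "is_arg_min (potential M T N f g K \<Lambda> X p) (\<lambda>\<psi>. \<psi> \<in> PiE {1..N} P) \<phi>"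
  shows "nash_equilibrium N P (cost M T N f g K \<Lambda> X) \<phi>"
proof -
  let ?F = "\<lambda>i \<psi> t \<omega>. f i (X i \<psi> t \<omega>) (\<psi> (t, X i \<psi> t \<omega>))"
  let ?K = "\<lambda>i j \<psi> \<zeta> t \<omega>. K (X i \<psi> t \<omega> - X j \<zeta> t \<omega>)"
  define a where "a i \<psi> = expectation (\<lambda>\<omega>. LINT t:{0..T}|lborel. ?F i \<psi> t \<omega>) + expectation (\<lambda>\<omega>. g i (X i \<psi> T \<omega>))" for i \<psi>
  define \<kappa> where "\<kappa> i j \<psi> \<zeta> = expectation (\<lambda>\<omega>. LINT t:{0..T}|lborel. ?K i j \<psi> \<zeta> t \<omega>)" for i j \<psi> \<zeta>
  have F_cont: "continuous_on {0..T} (\<lambda>t. ?F i \<psi> t \<omega>)"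
    and F_int: "integrable M (\<lambda>\<omega>. LINT t:{0..T}|lborel. ?F i \<psi> t \<omega>)"
    and G_int: "integrable M (\<lambda>\<omega>. g i (X i \<psi> T \<omega>))"
    if i: "i \<in> {1..N}" and \<psi>: "\<psi> \<in> P i" and \<omega>: "\<omega> \<in> space M" for i \<psi> \<omega>
  proof -
    note \<phi> = policy_classD[OF P[OF i] \<psi>]
    note X = strong_solutionD[OF bm sol[OF i \<psi>]]
    obtain L L' where "L-lipschitz_on (UNIV \<times> A i) (\<lambda>(x, a). b i x a)"
      "L'-lipschitz_on (UNIV \<times> A i) (\<lambda>(x, a). \<sigma> i x a)"
      using b[OF i] \<sigma>[OF i] by blast
    note mom = strong_solution_second_moments[OF T bm A[OF i] \<phi> this sol[OF i \<psi>]]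
    have cont: "continuous_on {0..T} (\<lambda>t. ?F i \<psi> t \<omega>)" if "\<omega> \<in> space M" for \<omega>
      by (rule continuous_on_along_policy[OF f[OF i] \<phi> X(2)[OF that] continuous_on_id]) simp
    then show "continuous_on {0..T} (\<lambda>t. ?F i \<psi> t \<omega>)" using \<omega> .
    obtain C where C: "\<And>x a. a \<in> A i \<Longrightarrow> \<bar>f i x a\<bar> \<le> C * (1 + (norm x)\<^sup>2 + (norm a)\<^sup>2)" using f_le[OF i] by blast
    obtain R where R: "\<And>a. a \<in> A i \<Longrightarrow> norm a \<le> R"
      using compact_imp_bounded[OF A[OF i]] unfolding bounded_iff by blast
    \<comment> \<open>Actions are bounded by \<open>R\<close>, so their growth goes into the
      constant. The absolute value covers a negative \<open>C\<close>.\<close>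
    have bound: "\<bar>f i x a\<bar> \<le> (\<bar>C\<bar> * (1 + R\<^sup>2)) * (1 + (norm x)\<^sup>2)" if "a \<in> A i" for x a
    proof -
      have "(norm a)\<^sup>2 \<le> R\<^sup>2" using R[OF that] by (intro power_mono) auto
      have "\<bar>f i x a\<bar> \<le> \<bar>C\<bar> * (1 + (norm x)\<^sup>2 + (norm a)\<^sup>2)"
        by (rule order_trans[OF C[OF that]]) (intro mult_right_mono; simp)
      also have "\<dots> \<le> \<bar>C\<bar> * ((1 + R\<^sup>2) * (1 + (norm x)\<^sup>2))"
      proof (intro mult_left_mono)
        have "0 \<le> R\<^sup>2 * (norm x)\<^sup>2" by simp
        moreover have "(1 + R\<^sup>2) * (1 + (norm x)\<^sup>2) = 1 + (norm x)\<^sup>2 + R\<^sup>2 + R\<^sup>2 * (norm x)\<^sup>2"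
          by (simp add: algebra_simps)
        ultimately show "1 + (norm x)\<^sup>2 + (norm a)\<^sup>2 \<le> (1 + R\<^sup>2) * (1 + (norm x)\<^sup>2)"
          using \<open>(norm a)\<^sup>2 \<le> R\<^sup>2\<close> by linarith
      qed simp
      finally show ?thesis by (simp add: mult.assoc)
    qed
    show "integrable M (\<lambda>\<omega>. LINT t:{0..T}|lborel. ?F i \<psi> t \<omega>)"
    proof (rule integrable_time_integral[OF _ _ cont _ mom(1)])
      show "?F i \<psi> t \<in> borel_measurable M" if "t \<in> {0..T}" for t
        by (rule borel_measurable_along_policy[OF f[OF i] \<phi> that X(1)[OF that]])
      show "\<bar>?F i \<psi> t \<omega>\<bar> \<le> (\<bar>C\<bar> * (1 + R\<^sup>2)) * (1 + (norm (X i \<psi> t \<omega>))\<^sup>2)" if "t \<in> {0..T}" for t \<omega>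
        using that \<phi>(2) by (intro bound) blast
    qed (use T in \<open>auto intro!: continuous_intros X(2)\<close>)
    obtain D where D: "\<And>x. \<bar>g i x\<bar> \<le> D * (1 + (norm x)\<^sup>2)" using g_le[OF i] by blast
    show "integrable M (\<lambda>\<omega>. g i (X i \<psi> T \<omega>))"
    proof (rule Bochner_Integration.integrable_bound)
      show "integrable M (\<lambda>\<omega>. D * (1 + (norm (X i \<psi> T \<omega>))\<^sup>2))" using mom(2) by simp
      show "(\<lambda>\<omega>. g i (X i \<psi> T \<omega>)) \<in> borel_measurable M"
        using T by (intro borel_measurable_continuous_on[OF g[OF i]] X(1)) auto
      show "AE \<omega> in M. norm (g i (X i \<psi> T \<omega>)) \<le> norm (D * (1 + (norm (X i \<psi> T \<omega>))\<^sup>2))"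
        using D by (intro AE_I2) (auto intro: order_trans[OF _ abs_ge_self])
    qed
  qed
  have K_cont: "continuous_on {0..T} (\<lambda>t. ?K i j \<psi> \<zeta> t \<omega>)"
    and K_int: "integrable M (\<lambda>\<omega>. LINT t:{0..T}|lborel. ?K i j \<psi> \<zeta> t \<omega>)"
    if i: "i \<in> {1..N}" "\<psi> \<in> P i" and j: "j \<in> {1..N}" "\<zeta> \<in> P j" and \<omega>: "\<omega> \<in> space M" for i j \<psi> \<zeta> \<omega>
  proof -
    note X = strong_solutionD[OF bm sol[OF i]] and Y = strong_solutionD[OF bm sol[OF j]]
    have cont: "continuous_on {0..T} (\<lambda>t. ?K i j \<psi> \<zeta> t \<omega>)" if "\<omega> \<in> space M" for \<omega>
      by (rule continuous_on_compose2[OF K(2)]) (auto intro!: continuous_intros X(2) Y(2) that)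
    then show "continuous_on {0..T} (\<lambda>t. ?K i j \<psi> \<zeta> t \<omega>)" using \<omega> .
    obtain B where B: "\<And>x. \<bar>K x\<bar> \<le> B" using K(1) unfolding bounded_iff by auto
    show "integrable M (\<lambda>\<omega>. LINT t:{0..T}|lborel. ?K i j \<psi> \<zeta> t \<omega>)"
    \<comment> \<open>Since \<open>K\<close> is bounded, the constant process 1 dominates it up to
      the factor \<open>B\<close>.\<close>
    proof (rule integrable_time_integral[OF _ _ cont, where h="\<lambda>_ _. 1" and C=B])
      show "?K i j \<psi> \<zeta> t \<in> borel_measurable M" if "t \<in> {0..T}" for t
        using X(1)[OF that] Y(1)[OF that] by (intro borel_measurable_continuous_on[OF K(2)]) measurable
    qed (use T B in auto)
  qed
  have set_int: "set_integrable lborel {0..T} y" if "continuous_on {0..T} y" for y :: "real \<Rightarrow> real"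
    by (rule borel_integrable_atLeastAtMost'[OF that])
  have cost_eq: "cost M T N f g K \<Lambda> X i \<psi> = a i (\<psi> i) + (\<Sum>j\<in>{1..N} - {i}. \<Lambda> i j * \<kappa> i j (\<psi> i) (\<psi> j))"
    if \<psi>: "\<psi> \<in> PiE {1..N} P" and i: "i \<in> {1..N}" for \<psi> i
  proof -
    have mem: "\<psi> j \<in> P j" if "j \<in> {1..N}" for j using \<psi> that by auto
    have "cost M T N f g K \<Lambda> X i \<psi> = expectation (\<lambda>\<omega>. (LINT t:{0..T}|lborel. ?F i (\<psi> i) t \<omega>) +
        (\<Sum>j\<in>{1..N} - {i}. \<Lambda> i j * (LINT t:{0..T}|lborel. ?K i j (\<psi> i) (\<psi> j) t \<omega>)) + g i (X i (\<psi> i) T \<omega>))"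
      unfolding cost_def
    proof (rule Bochner_Integration.integral_cong[OF refl], rule arg_cong2[where f="(+)", OF _ refl])
      fix \<omega> assume \<omega>: "\<omega> \<in> space M"
      have K': "set_integrable lborel {0..T} (\<lambda>t. \<Lambda> i j * ?K i j (\<psi> i) (\<psi> j) t \<omega>)" if "j \<in> {1..N} - {i}" for j
        using that by (intro set_int continuous_intros K_cont i mem \<omega>) auto
      have "(LINT t:{0..T}|lborel. ?F i (\<psi> i) t \<omega> + (\<Sum>j\<in>{1..N} - {i}. \<Lambda> i j * ?K i j (\<psi> i) (\<psi> j) t \<omega>)) =
        (LINT t:{0..T}|lborel. ?F i (\<psi> i) t \<omega>) + (LINT t:{0..T}|lborel. (\<Sum>j\<in>{1..N} - {i}. \<Lambda> i j * ?K i j (\<psi> i) (\<psi> j) t \<omega>))"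
        using K' by (intro set_integral_add set_int F_cont i mem \<omega> continuous_on_sum continuous_on_mult_left K_cont) auto
      also have "(LINT t:{0..T}|lborel. (\<Sum>j\<in>{1..N} - {i}. \<Lambda> i j * ?K i j (\<psi> i) (\<psi> j) t \<omega>)) =
          (\<Sum>j\<in>{1..N} - {i}. \<Lambda> i j * (LINT t:{0..T}|lborel. ?K i j (\<psi> i) (\<psi> j) t \<omega>))"
        using K' by (subst set_integral_sum) auto
      finally show "(LINT t:{0..T}|lborel. ?F i (\<psi> i) t \<omega> + (\<Sum>j\<in>{1..N} - {i}. \<Lambda> i j * ?K i j (\<psi> i) (\<psi> j) t \<omega>)) =
        (LINT t:{0..T}|lborel. ?F i (\<psi> i) t \<omega>) + (\<Sum>j\<in>{1..N} - {i}. \<Lambda> i j * (LINT t:{0..T}|lborel. ?K i j (\<psi> i) (\<psi> j) t \<omega>))" .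
    qed
    also have "\<dots> = a i (\<psi> i) + (\<Sum>j\<in>{1..N} - {i}. \<Lambda> i j * \<kappa> i j (\<psi> i) (\<psi> j))"
    proof -
      \<comment> \<open>Any point of the space discharges the premise
        \<open>\<omega> \<in> space M\<close>, which the integrability facts carry because they are
        stated together with continuity of paths.\<close>
      obtain \<omega>0 where \<omega>0: "\<omega>0 \<in> space M" using not_empty by blast
      have K': "integrable M (\<lambda>\<omega>. \<Lambda> i j * (LINT t:{0..T}|lborel. ?K i j (\<psi> i) (\<psi> j) t \<omega>))" if "j \<in> {1..N} - {i}" for j
        using that by (intro integrable_mult_right K_int[OF _ _ _ _ \<omega>0] i mem) auto
      note F' = F_int[OF i mem[OF i] \<omega>0] and G' = G_int[OF i mem[OF i] \<omega>0]
      have S': "integrable M (\<lambda>\<omega>. \<Sum>j\<in>{1..N} - {i}. \<Lambda> i j * (LINT t:{0..T}|lborel. ?K i j (\<psi> i) (\<psi> j) t \<omega>))"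
        using K' by (rule Bochner_Integration.integrable_sum)
      have sum: "expectation (\<lambda>\<omega>. \<Sum>j\<in>{1..N} - {i}. \<Lambda> i j * (LINT t:{0..T}|lborel. ?K i j (\<psi> i) (\<psi> j) t \<omega>)) =
          (\<Sum>j\<in>{1..N} - {i}. \<Lambda> i j * \<kappa> i j (\<psi> i) (\<psi> j))"
        unfolding \<kappa>_def by (subst Bochner_Integration.integral_sum, use K' in blast) simp
      show ?thesis
        unfolding Bochner_Integration.integral_add[OF Bochner_Integration.integrable_add[OF F' S'] G']
          Bochner_Integration.integral_add[OF F' S'] a_def sum by simp
    qed
    finally show ?thesis .
  qed
  let ?pairs = "{(i, j). 1 \<le> i \<and> i < j \<and> j \<le> N}"
  let ?w = "\<lambda>z. (p (fst z) * \<Lambda> (fst z) (snd z) + p (snd z) * \<Lambda> (snd z) (fst z)) / 2"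
  have pairs: "finite ?pairs" "\<And>z. z \<in> ?pairs \<Longrightarrow> fst z \<in> {1..N} \<and> snd z \<in> {1..N}"
    by (rule finite_subset[of _ "{1..N} \<times> {1..N}"]) auto
  have potential_eq: "potential M T N f g K \<Lambda> X p \<psi> =
      (\<Sum>i\<in>{1..N}. p i * a i (\<psi> i)) + (\<Sum>(i, j)\<in>?pairs. (p i * \<Lambda> i j + p j * \<Lambda> j i) / 2 * \<kappa> i j (\<psi> i) (\<psi> j))"
    if \<psi>: "\<psi> \<in> PiE {1..N} P" for \<psi>
  proof -
    have mem: "\<psi> j \<in> P j" if "j \<in> {1..N}" for j using \<psi> that by auto
    let ?Kz = "\<lambda>z t \<omega>. ?K (fst z) (snd z) (\<psi> (fst z)) (\<psi> (snd z)) t \<omega>"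
    have "potential M T N f g K \<Lambda> X p \<psi> = expectation (\<lambda>\<omega>. (\<Sum>i\<in>{1..N}. p i * (LINT t:{0..T}|lborel. ?F i (\<psi> i) t \<omega>)) +
        (\<Sum>z\<in>?pairs. ?w z * (LINT t:{0..T}|lborel. ?Kz z t \<omega>)) + (\<Sum>i\<in>{1..N}. p i * g i (X i (\<psi> i) T \<omega>)))"
      unfolding potential_def terminal_potential_def
    proof (rule Bochner_Integration.integral_cong[OF refl], rule arg_cong2[where f="(+)", OF _ refl])
      fix \<omega> assume \<omega>: "\<omega> \<in> space M"
      have F': "set_integrable lborel {0..T} (\<lambda>t. p i * ?F i (\<psi> i) t \<omega>)" if "i \<in> {1..N}" for i
        using that by (intro set_int continuous_on_mult_left F_cont mem \<omega>) auto
      have K': "set_integrable lborel {0..T} (\<lambda>t. ?w z * ?Kz z t \<omega>)" if "z \<in> ?pairs" for z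
        using pairs(2)[OF that] by (intro set_int continuous_on_mult_left K_cont mem \<omega>) auto
      have "(LINT t:{0..T}|lborel. running_potential N f K \<Lambda> p (\<lambda>i. X i (\<psi> i) t \<omega>) (\<lambda>i. \<psi> i (t, X i (\<psi> i) t \<omega>))) =
        (LINT t:{0..T}|lborel. (\<Sum>i\<in>{1..N}. p i * ?F i (\<psi> i) t \<omega>) + (\<Sum>z\<in>?pairs. ?w z * ?Kz z t \<omega>))"
        unfolding running_potential_def by (simp add: case_prod_beta')
      also have "\<dots> = (LINT t:{0..T}|lborel. (\<Sum>i\<in>{1..N}. p i * ?F i (\<psi> i) t \<omega>)) + (LINT t:{0..T}|lborel. (\<Sum>z\<in>?pairs. ?w z * ?Kz z t \<omega>))"
        using F' K' pairs(1) by (intro set_integral_add set_integrable_sum) auto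
      also have "\<dots> = (\<Sum>i\<in>{1..N}. p i * (LINT t:{0..T}|lborel. ?F i (\<psi> i) t \<omega>)) +
          (\<Sum>z\<in>?pairs. ?w z * (LINT t:{0..T}|lborel. ?Kz z t \<omega>))"
        using F' K' pairs(1) by (subst (1 2) set_integral_sum) auto
      finally show "(LINT t:{0..T}|lborel. running_potential N f K \<Lambda> p (\<lambda>i. X i (\<psi> i) t \<omega>) (\<lambda>i. \<psi> i (t, X i (\<psi> i) t \<omega>))) =
        (\<Sum>i\<in>{1..N}. p i * (LINT t:{0..T}|lborel. ?F i (\<psi> i) t \<omega>)) + (\<Sum>z\<in>?pairs. ?w z * (LINT t:{0..T}|lborel. ?Kz z t \<omega>))" .
    qed
    also have "\<dots> = (\<Sum>i\<in>{1..N}. p i * expectation (\<lambda>\<omega>. LINT t:{0..T}|lborel. ?F i (\<psi> i) t \<omega>)) +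
        (\<Sum>z\<in>?pairs. ?w z * \<kappa> (fst z) (snd z) (\<psi> (fst z)) (\<psi> (snd z))) + (\<Sum>i\<in>{1..N}. p i * expectation (\<lambda>\<omega>. g i (X i (\<psi> i) T \<omega>)))"
    proof -
      obtain \<omega>0 where \<omega>0: "\<omega>0 \<in> space M" using not_empty by blast
      have F': "integrable M (\<lambda>\<omega>. p i * (LINT t:{0..T}|lborel. ?F i (\<psi> i) t \<omega>))" "integrable M (\<lambda>\<omega>. p i * g i (X i (\<psi> i) T \<omega>))"
        if "i \<in> {1..N}" for i
        using that by (intro integrable_mult_right F_int[OF _ _ \<omega>0] G_int[OF _ _ \<omega>0] mem; simp)+
      have K': "integrable M (\<lambda>\<omega>. ?w z * (LINT t:{0..T}|lborel. ?Kz z t \<omega>))" if "z \<in> ?pairs" for z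
        using pairs(2)[OF that] by (intro integrable_mult_right K_int[OF _ _ _ _ \<omega>0] mem) auto
      have sums: "integrable M (\<lambda>\<omega>. \<Sum>i\<in>{1..N}. p i * (LINT t:{0..T}|lborel. ?F i (\<psi> i) t \<omega>))"
        "integrable M (\<lambda>\<omega>. \<Sum>z\<in>?pairs. ?w z * (LINT t:{0..T}|lborel. ?Kz z t \<omega>))"
        "integrable M (\<lambda>\<omega>. \<Sum>i\<in>{1..N}. p i * g i (X i (\<psi> i) T \<omega>))"
        using F' K' by (auto intro!: Bochner_Integration.integrable_sum)
      show ?thesis
        unfolding Bochner_Integration.integral_add[OF Bochner_Integration.integrable_add[OF sums(1,2)] sums(3)]
          Bochner_Integration.integral_add[OF sums(1,2)] \<kappa>_def
        by (subst Bochner_Integration.integral_sum, use F' K' in blast)+ simp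
    qed
    also have "\<dots> = (\<Sum>i\<in>{1..N}. p i * a i (\<psi> i)) + (\<Sum>(i, j)\<in>?pairs. (p i * \<Lambda> i j + p j * \<Lambda> j i) / 2 * \<kappa> i j (\<psi> i) (\<psi> j))"
      unfolding a_def by (simp add: distrib_left sum.distrib case_prod_beta')
    finally show ?thesis .
  qed
  \<comment> \<open>Evenness of \<open>K\<close> is what makes the interaction mutual.\<close>
  have sym: "\<kappa> i j x y = \<kappa> j i y x" for i j x y
    unfolding \<kappa>_def by (subst K(3)) simp
  have \<phi>: "\<phi> \<in> PiE {1..N} P" and opt: "\<And>\<psi>. \<psi> \<in> PiE {1..N} P \<Longrightarrow> potential M T N f g K \<Lambda> X p \<phi> \<le> potential M T N f g K \<Lambda> X p \<psi>"
    using min unfolding is_arg_min_def by (auto simp: not_less)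
  have "cost M T N f g K \<Lambda> X i \<phi> \<le> cost M T N f g K \<Lambda> X i (\<phi>(i := \<psi>))" if i: "i \<in> {1..N}" and \<psi>: "\<psi> \<in> P i" for i \<psi>
  proof -
    have mem: "\<phi>(i := \<psi>) \<in> PiE {1..N} P" using \<phi> \<psi> i by (auto simp: PiE_iff extensional_def)
    note split = potential_eq_scaled_cost_plus_rest[of \<kappa>, OF sym db i, where a=a]
    let ?R = "\<lambda>\<psi>. (\<Sum>l\<in>{1..N} - {i}. p l * a l (\<psi> l)) +
       (\<Sum>(k, j)\<in>{z \<in> ?pairs. fst z \<noteq> i \<and> snd z \<noteq> i}. (p k * \<Lambda> k j + p j * \<Lambda> j k) / 2 * \<kappa> k j (\<psi> k) (\<psi> j))"
    \<comment> \<open>Every index at which the policy is evaluated here differs from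
      \<open>i\<close>.\<close>
    have rest: "?R (\<phi>(i := \<psi>)) = ?R \<phi>"
      by (intro arg_cong2[where f="(+)"] sum.cong refl) auto
    have eq: "potential M T N f g K \<Lambda> X p \<zeta> = p i * cost M T N f g K \<Lambda> X i \<zeta> + ?R \<zeta>" if "\<zeta> \<in> PiE {1..N} P" for \<zeta>
      unfolding potential_eq[OF that] cost_eq[OF that i] by (rule split)
    have "p i * cost M T N f g K \<Lambda> X i \<phi> \<le> p i * cost M T N f g K \<Lambda> X i (\<phi>(i := \<psi>))"
      using opt[OF mem] rest unfolding eq[OF \<phi>] eq[OF mem] by linarith
    moreover have "0 < p i" using p i by (auto simp: positive_weights_def)
    ultimately show ?thesis by simp
  qed
  with \<phi> show ?thesis unfolding nash_equilibrium_def by blast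
qed

theorem theorem4p5:
  fixes T :: real and N :: nat
    and M :: "'w measure" and W :: "real \<Rightarrow> 'w \<Rightarrow> real^'m"
    and A :: "nat \<Rightarrow> (real^'k) set" and P :: "nat \<Rightarrow> (real \<times> (real^'d) \<Rightarrow> real^'k) set"
    and b :: "nat \<Rightarrow> real^'d \<Rightarrow> real^'k \<Rightarrow> real^'d"
    and \<sigma> :: "nat \<Rightarrow> real^'d \<Rightarrow> real^'k \<Rightarrow> real^'m^'d"
    and \<xi> :: "nat \<Rightarrow> real^'d"
    and f :: "nat \<Rightarrow> real^'d \<Rightarrow> real^'k \<Rightarrow> real" and g :: "nat \<Rightarrow> real^'d \<Rightarrow> real"
    and K :: "real^'d \<Rightarrow> real" and \<Lambda> :: "nat \<Rightarrow> nat \<Rightarrow> real"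
    and X :: "nat \<Rightarrow> (real \<times> (real^'d) \<Rightarrow> real^'k) \<Rightarrow> real \<Rightarrow> 'w \<Rightarrow> real^'d"
  assumes "0 < T" and "1 \<le> N"
    and "prob_space M" and "complete_measure M" and "brownian_motion M W"
    and "\<And>i. i \<in> {1..N} \<Longrightarrow> A i \<noteq> {} \<and> compact (A i)"
    and "\<And>i. i \<in> {1..N} \<Longrightarrow> policy_class T (A i) (P i)"
    and "\<And>i. i \<in> {1..N} \<Longrightarrow> \<exists>L. L-lipschitz_on (UNIV \<times> A i) (\<lambda>(x, a). b i x a)"
    and "\<And>i. i \<in> {1..N} \<Longrightarrow> \<exists>L. L-lipschitz_on (UNIV \<times> A i) (\<lambda>(x, a). \<sigma> i x a)"
    and "\<And>i. i \<in> {1..N} \<Longrightarrow> continuous_on (UNIV \<times> A i) (\<lambda>(x, a). f i x a)"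
    and "\<And>i. i \<in> {1..N} \<Longrightarrow>
           \<exists>C. \<forall>x. \<forall>a\<in>A i. \<bar>f i x a\<bar> \<le> C * (1 + (norm x)\<^sup>2 + (norm a)\<^sup>2)"
    and "\<And>i. i \<in> {1..N} \<Longrightarrow> continuous_on UNIV (g i)"
    and "\<And>i. i \<in> {1..N} \<Longrightarrow> \<exists>C. \<forall>x. \<bar>g i x\<bar> \<le> C * (1 + (norm x)\<^sup>2)"
    and "bounded (range K)" and "continuous_on UNIV K"
    and "\<And>x. K x = K (- x)" and "\<exists>x. K x \<noteq> 0"
    and "\<And>i j. i \<in> {1..N} \<Longrightarrow> j \<in> {1..N} \<Longrightarrow> 0 \<le> \<Lambda> i j"
    and "\<And>i \<phi>. i \<in> {1..N} \<Longrightarrow> \<phi> \<in> P i \<Longrightarrow>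
           strong_solution M W T (b i) (\<sigma> i) (\<xi> i) \<phi> (X i \<phi>)"
  shows "(r_star N \<Lambda> = 0 \<longleftrightarrow>
            (\<exists>p\<in>positive_weights N. \<forall>i\<in>{1..N}. \<forall>j\<in>{1..N}. p i * \<Lambda> i j = p j * \<Lambda> j i))
       \<and> ((\<exists>p\<in>positive_weights N. \<forall>i\<in>{1..N}. \<forall>j\<in>{1..N}. p i * \<Lambda> i j = p j * \<Lambda> j i) \<longleftrightarrow>
            kolmogorov_cyclic N \<Lambda>)
       \<and> (r_star N \<Lambda> = 0 \<or>
          (\<exists>p\<in>positive_weights N. \<forall>i\<in>{1..N}. \<forall>j\<in>{1..N}. p i * \<Lambda> i j = p j * \<Lambda> j i) \<or>
          kolmogorov_cyclic N \<Lambda> \<longrightarrow>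
            (\<forall>p\<in>positive_weights N. (\<forall>i\<in>{1..N}. \<forall>j\<in>{1..N}. p i * \<Lambda> i j = p j * \<Lambda> j i) \<longrightarrow>
               (\<forall>\<phi>. is_arg_min (potential M T N f g K \<Lambda> X p) (\<lambda>\<psi>. \<psi> \<in> PiE {1..N} P) \<phi> \<longrightarrow>
                    nash_equilibrium N P (cost M T N f g K \<Lambda> X) \<phi>)))"
proof -
  let ?db = "\<lambda>p. \<forall>i\<in>{1..N}. \<forall>j\<in>{1..N}. p i * \<Lambda> i j = p j * \<Lambda> j i"
  interpret prob_space M by (rule assms(3))
  \<comment> \<open>The three equivalences are proved as a cycle: detailed balance, then
    \<open>r_star = 0\<close>, then the cyclic condition, then detailed balance again.\<close>
  have 1: "r_star N \<Lambda> = 0" if "\<exists>p\<in>positive_weights N. ?db p"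
    using that detailed_balance_imp_r_star[OF assms(2)] by blast
  have 2: "kolmogorov_cyclic N \<Lambda>" if "r_star N \<Lambda> = 0"
    by (rule r_star_zero_imp_kolmogorov[OF assms(2) that])
  \<comment> \<open>Nonnegativity of the weights enters here: the ratios along walks must be
    positive.\<close>
  have 3: "\<exists>p\<in>positive_weights N. ?db p" if "kolmogorov_cyclic N \<Lambda>"
    by (rule kolmogorov_imp_detailed_balance[OF that assms(18)])
  have nash: "nash_equilibrium N P (cost M T N f g K \<Lambda> X) \<phi>"
    if "p \<in> positive_weights N" "?db p" "is_arg_min (potential M T N f g K \<Lambda> X p) (\<lambda>\<psi>. \<psi> \<in> PiE {1..N} P) \<phi>" for p \<phi>
    by (rule potential_minimizer_is_nash[OF assms(1,5) _ assms(7-16,19) that(1) _ that(3)])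
      (use assms(6) that(2) in blast)+
  show ?thesis using 1 2 3 nash by blast
qed

end
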